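(* Let $k$ be a field, $(\mathcal B,\mathbb E,\mathfrak s)$ a Krull–Schmidt, Hom-finite, $k$-linear extriangulated category with enough projectives $\mathcal P$ and enough injectives $\mathcal I$, satisfying condition (WIC), and let $R$ be a basic rigid object with no nonzero direct summand in $\mathcal P$ and with $\mathbb E(R,P)=0$ for all $P\in\mathcal P$. Let $\mathcal R$, $\mathcal H$, $U*[R]$ and the order $\geq$ be as defined in the context. Let $M=U\oplus X\in\mathcal H$ be a basic maximal $\mathcal R$-rigid object where $X$ is a non-projective indecomposable object and $\mathcal P\subseteq\operatorname{add}U$. Then: (a) If $X\in U*[R]$, there is an $\mathbb E$-triangle $Y\to U_1\xrightarrow{f}X\dashrightarrow$ where $f$ is a right minimal $\operatorname{add}U$-approximation of $X$, $Y$ is another complement to $U$, and $U\oplus Y>M$. (b) If $X\notin U*[R]$, there is an $\mathbb E$-triangle $X\xrightarrow{g}U_2\to Y\dashrightarrow$ where $g$ is a left minimal $\operatorname{add}U$-approximation of $X$, $Y$ is another complement to $U$, and $U\oplus Y<M$.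
   Context: Extriangulated category $(\mathcal B,\mathbb E,\mathfrak s)$ (Nakaoka–Palu): $\mathcal B$ is additive and $\mathbb E:\mathcal B^{\mathrm{op}}\times\mathcal B\to\mathrm{Ab}$ is an additive bifunctor; for $\delta\in\mathbb E(C,A)$, $a:A\to A'$, $c:C'\to C$ put $a_*\delta=\mathbb E(C,a)(\delta)$, $c^*\delta=\mathbb E(c,A)(\delta)$; a morphism from $\delta\in\mathbb E(C,A)$ to $\delta'\in\mathbb E(C',A')$ is a pair $(a:A\to A',c:C\to C')$ with $a_*\delta=c^*\delta'$. $\mathfrak s$ assigns to each $\delta\in\mathbb E(C,A)$ an equivalence class $[A\to B\to C]$ of sequences (equivalence: isomorphism of middle terms compatible with the identities of $A$ and $C$), such that every morphism $(a,c)$ of extensions extends to a commutative morphism $(a,b,c)$ of realizing sequences, $\mathfrak s(0)=[A\to A\oplus C\to C]$ is split, and $\mathfrak s(\delta\oplus\delta')=\mathfrak s(\delta)\oplus\mathfrak s(\delta')$. (ET3): if $\delta,\delta'$ are realized by $A\xrightarrow{x}B\xrightarrow{y}C$, $A'\xrightarrow{x'}B'\xrightarrow{y'}C'$ and $x'a=bx$, there is $c$ with $cy=y'b$ and $(a,c):\delta\to\delta'$ a morphism. (ET4): if $\delta\in\mathbb E(D,A)$, $\delta'\in\mathbb E(F,B)$ are realized by $A\xrightarrow{f}B\xrightarrow{f'}D$, $B\xrightarrow{g}C\xrightarrow{g'}F$, there are $E$, $d:D\to E$, $e:E\to F$ and $\delta''\in\mathbb E(E,A)$ realized by $A\xrightarrow{gf}C\xrightarrow{h'}E$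 with $h'g=df'$, $eh'=g'$, $D\xrightarrow{d}E\xrightarrow{e}F$ realizing $f'_*\delta'$, $d^*\delta''=\delta$, $f_*\delta''=e^*\delta'$. The duals of (ET3), (ET4) also hold. A sequence $A\xrightarrow{x}B\xrightarrow{y}C$ realizing some $\delta$ is a conflation ($x$ an inflation, $y$ a deflation); together with $\delta$ it is an $\mathbb E$-triangle, written $A\to B\to C\dashrightarrow$. A morphism of $\mathbb E$-triangles is a commutative $(a,b,c)$ with $(a,c)$ a morphism of the extensions. $P$ is projective if every morphism from $P$ to $C$ lifts through every deflation $B\to C$; injective is dual; $\mathcal P,\mathcal I$ are the subcategories of projectives, injectives. Enough projectives: every $C$ admits an $\mathbb E$-triangle $A\to P\to C\dashrightarrow$ with $P\in\mathcal P$; enough injectives is dual. (WIC): if $gf$ is a deflation then $g$ is a deflation; if $gf$ is an inflation then $f$ is an inflation. $R$ rigid means $\mathbb E(R,R)=0$. $\mathcal R=(\operatorname{add}R)\vee\mathcal P$ is the smallest subcategory containing all direct sums of objects in $\operatorname{add}R$ and $\mathcal P$. $\mathcal H=\operatorname{CoCone}(\mathcal R,\mathcal R)$ is the subcategory of objects $X$ admitting an $\mathbb E$-triangle $X\to R'\to R''\dashrightarrow$ with $R',R''\in\mathcal R$. $\mathcal R^{\perp_1}=\{X\in\mathcal B\mid\mathbb E(\mathcal R,X)=0\}$. For $M,N\in\mathcal B$ choose an $\mathbb E$-triangle $N\to I_N\xrightarrow{i}\Sigma N\dashrightarrow$ with $I_N\in\mathcal I$. $[R](M,\Sigma N)$ is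 the set of morphisms $M\to\Sigma N$ factoring through an object of $\operatorname{add}R$, and $\overline{[R]}(M,\Sigma N)$ is the subset of those which also factor through $i$. $X$ is $\mathcal R$-rigid if $\overline{[R]}(X,\Sigma X)=[R](X,\Sigma X)$. An $\mathcal R$-rigid object $X\in\mathcal H$ is maximal $\mathcal R$-rigid (with respect to $\mathcal H$) if for every non-projective indecomposable $Z\in\mathcal H$, $X\oplus Z$ being $\mathcal R$-rigid implies $Z\in\operatorname{add}X$. For $M\in\mathcal H$, $M*[R]$ is the class of objects $X\in\mathcal B$ for which there are $M_X\in\operatorname{add}M$, $I_M\in\mathcal I$ and a morphism of $\mathbb E$-triangles $(m,i',1)$ from $M_X\to I_M\to\Sigma M_X\dashrightarrow$ to $X\xrightarrow{\eta_X}C_X\to\Sigma M_X\dashrightarrow$ such that $\eta_X$ factors through an object of $\mathcal R^{\perp_1}$. For maximal $\mathcal R$-rigid $M,N$: $M\ge N$ means $M*[R]\supseteq N*[R]$, and $M>N$ means $M\ge N$ but not $N\ge M$. "$Y$ is another complement to $U$" means that $Y\in\mathcal H$ is a non-projective indecomposable object, not isomorphic to $X$, such that $U\oplus Y$ is maximal $\mathcal R$-rigid. *)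

theory Defs
  imports "HOL-Algebra.Module"
begin

text \<open>
  The objects are all elements of the type \<open>'o\<close>. Morphisms and extensions are always used
  together with the objects they belong to, so the sets \<open>Hom A C\<close> need not be disjoint.
  \<open>Ext C A\<close> is the group usually written \<open>\<bbbE>(C, A)\<close>; only the additive part of the library's
  ring and module records is used. \<open>push a \<delta>\<close> is \<open>a\<^sub>*\<delta>\<close> and \<open>pull c \<delta>\<close> is \<open>c\<^sup>*\<delta>\<close>.
  For \<open>\<delta> \<in> \<bbbE>(C, A)\<close>, \<open>rlz C A \<delta>\<close> is the equivalence class \<open>\<ss>(\<delta>)\<close>; its elements \<open>(x, M, y)\<close>
  stand for sequences \<open>A \<rightarrow> M \<rightarrow> C\<close>.
\<close>

record ('k, 'o, 'm, 'e) excat =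
  Hom :: "'o \<Rightarrow> 'o \<Rightarrow> ('k, 'm) module"
  cmp :: "'m \<Rightarrow> 'm \<Rightarrow> 'm" (infixl "\<cdot>\<index>" 70)
  idt :: "'o \<Rightarrow> 'm"
  zob :: "'o"
  dsum :: "'o \<Rightarrow> 'o \<Rightarrow> 'o" (infixl "\<boxplus>\<index>" 65)
  in1 :: "'o \<Rightarrow> 'o \<Rightarrow> 'm"
  in2 :: "'o \<Rightarrow> 'o \<Rightarrow> 'm"
  pr1 :: "'o \<Rightarrow> 'o \<Rightarrow> 'm"
  pr2 :: "'o \<Rightarrow> 'o \<Rightarrow> 'm"
  Ext :: "'o \<Rightarrow> 'o \<Rightarrow> 'e ring"
  push :: "'m \<Rightarrow> 'e \<Rightarrow> 'e"
  pull :: "'m \<Rightarrow> 'e \<Rightarrow> 'e"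
  rlz :: "'o \<Rightarrow> 'o \<Rightarrow> 'e \<Rightarrow> ('m \<times> 'o \<times> 'm) set"

abbreviation mor :: "('k, 'o, 'm, 'e) excat \<Rightarrow> 'o \<Rightarrow> 'o \<Rightarrow> 'm set"
  where "mor \<B> A C \<equiv> carrier (Hom \<B> A C)"

abbreviation ext :: "('k, 'o, 'm, 'e) excat \<Rightarrow> 'o \<Rightarrow> 'o \<Rightarrow> 'e set"
  where "ext \<B> C A \<equiv> carrier (Ext \<B> C A)"


section \<open>Linear additive categories\<close>

text \<open>The binary direct sums are part of the data; by the biproduct equations they are
  determined up to isomorphism.\<close>

locale linear_category =
  fixes K :: "'k ring" and \<B> :: "('k, 'o, 'm, 'e) excat" (structure)
  assumes field_K: "field K"
    and module_Hom: "module K (Hom \<B> A C)"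
    and idt_closed: "idt \<B> A \<in> mor \<B> A A"
    and cmp_closed: "\<lbrakk>f \<in> mor \<B> A C; g \<in> mor \<B> C D\<rbrakk> \<Longrightarrow> g \<cdot> f \<in> mor \<B> A D"
    and cmp_assoc: "\<lbrakk>f \<in> mor \<B> A C; g \<in> mor \<B> C D; h \<in> mor \<B> D F\<rbrakk> \<Longrightarrow> h \<cdot> (g \<cdot> f) = h \<cdot> g \<cdot> f"
    and cmp_idt_left: "f \<in> mor \<B> A C \<Longrightarrow> idt \<B> C \<cdot> f = f"
    and cmp_idt_right: "f \<in> mor \<B> A C \<Longrightarrow> f \<cdot> idt \<B> A = f"
    and cmp_add_right: "\<lbrakk>f \<in> mor \<B> A C; f' \<in> mor \<B> A C; g \<in> mor \<B> C D\<rbrakk> \<Longrightarrow>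
          g \<cdot> (f \<oplus>\<^bsub>Hom \<B> A C\<^esub> f') = g \<cdot> f \<oplus>\<^bsub>Hom \<B> A D\<^esub> g \<cdot> f'"
    and cmp_add_left: "\<lbrakk>f \<in> mor \<B> A C; g \<in> mor \<B> C D; g' \<in> mor \<B> C D\<rbrakk> \<Longrightarrow>
          (g \<oplus>\<^bsub>Hom \<B> C D\<^esub> g') \<cdot> f = g \<cdot> f \<oplus>\<^bsub>Hom \<B> A D\<^esub> g' \<cdot> f"
    and cmp_smult_right: "\<lbrakk>k \<in> carrier K; f \<in> mor \<B> A C; g \<in> mor \<B> C D\<rbrakk> \<Longrightarrow>
          g \<cdot> (k \<odot>\<^bsub>Hom \<B> A C\<^esub> f) = k \<odot>\<^bsub>Hom \<B> A D\<^esub> (g \<cdot> f)"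
    and cmp_smult_left: "\<lbrakk>k \<in> carrier K; f \<in> mor \<B> A C; g \<in> mor \<B> C D\<rbrakk> \<Longrightarrow>
          (k \<odot>\<^bsub>Hom \<B> C D\<^esub> g) \<cdot> f = k \<odot>\<^bsub>Hom \<B> A D\<^esub> (g \<cdot> f)"
    and zob_terminal: "mor \<B> A (zob \<B>) = {\<zero>\<^bsub>Hom \<B> A (zob \<B>)\<^esub>}"
    and zob_initial: "mor \<B> (zob \<B>) A = {\<zero>\<^bsub>Hom \<B> (zob \<B>) A\<^esub>}"
    and in1_closed: "in1 \<B> A C \<in> mor \<B> A (A \<boxplus> C)"
    and in2_closed: "in2 \<B> A C \<in> mor \<B> C (A \<boxplus> C)"
    and pr1_closed: "pr1 \<B> A C \<in> mor \<B> (A \<boxplus> C) A"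
    and pr2_closed: "pr2 \<B> A C \<in> mor \<B> (A \<boxplus> C) C"
    and pr1_in1: "pr1 \<B> A C \<cdot> in1 \<B> A C = idt \<B> A"
    and pr2_in2: "pr2 \<B> A C \<cdot> in2 \<B> A C = idt \<B> C"
    and pr1_in2: "pr1 \<B> A C \<cdot> in2 \<B> A C = \<zero>\<^bsub>Hom \<B> C A\<^esub>"
    and pr2_in1: "pr2 \<B> A C \<cdot> in1 \<B> A C = \<zero>\<^bsub>Hom \<B> A C\<^esub>"
    and in_pr_sum: "in1 \<B> A C \<cdot> pr1 \<B> A C \<oplus>\<^bsub>Hom \<B> (A \<boxplus> C) (A \<boxplus> C)\<^esub> in2 \<B> A C \<cdot> pr2 \<B> A C
          = idt \<B> (A \<boxplus> C)"

definition finite_dim :: "'k ring \<Rightarrow> ('k, 'm) module \<Rightarrow> bool"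
  where "finite_dim K V \<longleftrightarrow> (\<exists>S. finite S \<and> S \<subseteq> carrier V \<and>
    (\<forall>v\<in>carrier V. \<exists>c\<in>S \<rightarrow> carrier K. v = (\<Oplus>\<^bsub>V\<^esub>s\<in>S. c s \<odot>\<^bsub>V\<^esub> s)))"

definition hom_finite :: "'k ring \<Rightarrow> ('k, 'o, 'm, 'e) excat \<Rightarrow> bool"
  where "hom_finite K \<B> \<longleftrightarrow> (\<forall>A C. finite_dim K (Hom \<B> A C))"

definition iso_mor :: "('k, 'o, 'm, 'e) excat \<Rightarrow> 'o \<Rightarrow> 'o \<Rightarrow> 'm set"
  where "iso_mor \<B> A C = {f \<in> mor \<B> A C.
    \<exists>g\<in>mor \<B> C A. g \<cdot>\<^bsub>\<B>\<^esub> f = idt \<B> A \<and> f \<cdot>\<^bsub>\<B>\<^esub> g = idt \<B> C}"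

definition isomorphic :: "('k, 'o, 'm, 'e) excat \<Rightarrow> 'o \<Rightarrow> 'o \<Rightarrow> bool"
  where "isomorphic \<B> A C \<longleftrightarrow> iso_mor \<B> A C \<noteq> {}"

definition zero_object :: "('k, 'o, 'm, 'e) excat \<Rightarrow> 'o \<Rightarrow> bool"
  where "zero_object \<B> A \<longleftrightarrow> isomorphic \<B> A (zob \<B>)"

definition indecomposable :: "('k, 'o, 'm, 'e) excat \<Rightarrow> 'o \<Rightarrow> bool"
  where "indecomposable \<B> X \<longleftrightarrow> \<not> zero_object \<B> X \<and>
    (\<forall>A C. isomorphic \<B> X (A \<boxplus>\<^bsub>\<B>\<^esub> C) \<longrightarrow> zero_object \<B> A \<or> zero_object \<B> C)"

definition dsum_list :: "('k, 'o, 'm, 'e) excat \<Rightarrow> 'o list \<Rightarrow> 'o"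
  where "dsum_list \<B> As = foldr (dsum \<B>) As (zob \<B>)"

definition summand :: "('k, 'o, 'm, 'e) excat \<Rightarrow> 'o \<Rightarrow> 'o \<Rightarrow> bool"
  where "summand \<B> X Z \<longleftrightarrow> (\<exists>Y. isomorphic \<B> Z (X \<boxplus>\<^bsub>\<B>\<^esub> Y))"

definition add_cl :: "('k, 'o, 'm, 'e) excat \<Rightarrow> 'o \<Rightarrow> 'o set"
  where "add_cl \<B> M = {X. \<exists>n. summand \<B> X (dsum_list \<B> (replicate n M))}"

definition basic :: "('k, 'o, 'm, 'e) excat \<Rightarrow> 'o \<Rightarrow> bool"
  where "basic \<B> M \<longleftrightarrow> (\<exists>As. isomorphic \<B> M (dsum_list \<B> As) \<and>
    (\<forall>A\<in>set As. indecomposable \<B> A) \<and> sorted_wrt (\<lambda>A C. \<not> isomorphic \<B> A C) As)"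

definition End_ring :: "('k, 'o, 'm, 'e) excat \<Rightarrow> 'o \<Rightarrow> 'm ring"
  where "End_ring \<B> A = \<lparr>carrier = mor \<B> A A, mult = cmp \<B>, one = idt \<B> A,
    zero = zero (Hom \<B> A A), add = add (Hom \<B> A A)\<rparr>"

text \<open>Local in the noncommutative sense: the ring is nonzero and its non-units are closed
  under addition.\<close>

definition local_nc_ring :: "'a ring \<Rightarrow> bool"
  where "local_nc_ring S \<longleftrightarrow> ring S \<and> \<one>\<^bsub>S\<^esub> \<noteq> \<zero>\<^bsub>S\<^esub> \<and>
    (\<forall>a\<in>carrier S - Units S. \<forall>b\<in>carrier S - Units S. a \<oplus>\<^bsub>S\<^esub> b \<notin> Units S)"

definition krull_schmidt :: "('k, 'o, 'm, 'e) excat \<Rightarrow> bool"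
  where "krull_schmidt \<B> \<longleftrightarrow> (\<forall>A. \<exists>As. isomorphic \<B> A (dsum_list \<B> As) \<and>
    (\<forall>X\<in>set As. local_nc_ring (End_ring \<B> X)))"


section \<open>Extriangulated categories\<close>

definition dsum_mor :: "('k, 'o, 'm, 'e) excat \<Rightarrow> 'o \<Rightarrow> 'o \<Rightarrow> 'o \<Rightarrow> 'o \<Rightarrow> 'm \<Rightarrow> 'm \<Rightarrow> 'm"
  where "dsum_mor \<B> A A' C C' f f' =
    in1 \<B> C C' \<cdot>\<^bsub>\<B>\<^esub> f \<cdot>\<^bsub>\<B>\<^esub> pr1 \<B> A A' \<oplus>\<^bsub>Hom \<B> (A \<boxplus>\<^bsub>\<B>\<^esub> A') (C \<boxplus>\<^bsub>\<B>\<^esub> C')\<^esub>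
    in2 \<B> C C' \<cdot>\<^bsub>\<B>\<^esub> f' \<cdot>\<^bsub>\<B>\<^esub> pr2 \<B> A A'"

text \<open>\<open>\<delta> \<oplus> \<delta>' \<in> \<bbbE>(C \<oplus> C', A \<oplus> A')\<close> is the element with components \<open>(\<delta>, 0, 0, \<delta>')\<close> in
  \<open>\<bbbE>(C, A) \<oplus> \<bbbE>(C, A') \<oplus> \<bbbE>(C', A) \<oplus> \<bbbE>(C', A')\<close>.\<close>

definition dsum_ext :: "('k, 'o, 'm, 'e) excat \<Rightarrow> 'o \<Rightarrow> 'o \<Rightarrow> 'o \<Rightarrow> 'o \<Rightarrow> 'e \<Rightarrow> 'e \<Rightarrow> 'e"
  where "dsum_ext \<B> C C' A A' \<delta> \<delta>' =
    push \<B> (in1 \<B> A A') (pull \<B> (pr1 \<B> C C') \<delta>) \<oplus>\<^bsub>Ext \<B> (C \<boxplus>\<^bsub>\<B>\<^esub> C') (A \<boxplus>\<^bsub>\<B>\<^esub> A')\<^esub>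
    push \<B> (in2 \<B> A A') (pull \<B> (pr2 \<B> C C') \<delta>')"

definition seqs :: "('k, 'o, 'm, 'e) excat \<Rightarrow> 'o \<Rightarrow> 'o \<Rightarrow> ('m \<times> 'o \<times> 'm) set"
  where "seqs \<B> A C = {(x, M, y). x \<in> mor \<B> A M \<and> y \<in> mor \<B> M C}"

definition seq_equiv ::
    "('k, 'o, 'm, 'e) excat \<Rightarrow> 'o \<Rightarrow> 'o \<Rightarrow> (('m \<times> 'o \<times> 'm) \<times> ('m \<times> 'o \<times> 'm)) set"
  where "seq_equiv \<B> A C = {((x, M, y), (x', M', y')).
    (x, M, y) \<in> seqs \<B> A C \<and> (x', M', y') \<in> seqs \<B> A C \<and>
    (\<exists>b\<in>iso_mor \<B> M M'. b \<cdot>\<^bsub>\<B>\<^esub> x = x' \<and> y' \<cdot>\<^bsub>\<B>\<^esub> b = y)}"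

text \<open>\<open>etri \<B> A x M y C \<delta>\<close>: the sequence \<open>A \<rightarrow> M \<rightarrow> C\<close> given by \<open>x\<close> and \<open>y\<close>, together with
  \<open>\<delta> \<in> \<bbbE>(C, A)\<close>, is an \<open>\<bbbE>\<close>-triangle.\<close>

definition etri :: "('k, 'o, 'm, 'e) excat \<Rightarrow> 'o \<Rightarrow> 'm \<Rightarrow> 'o \<Rightarrow> 'm \<Rightarrow> 'o \<Rightarrow> 'e \<Rightarrow> bool"
  where "etri \<B> A x M y C \<delta> \<longleftrightarrow> \<delta> \<in> ext \<B> C A \<and> (x, M, y) \<in> rlz \<B> C A \<delta>"

locale extriangulated_category = linear_category +
  assumes abelian_group_Ext: "abelian_group (Ext \<B> C A)"
    and push_closed: "\<lbrakk>a \<in> mor \<B> A A'; \<delta> \<in> ext \<B> C A\<rbrakk> \<Longrightarrow> push \<B> a \<delta> \<in> ext \<B> C A'"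
    and pull_closed: "\<lbrakk>c \<in> mor \<B> C' C; \<delta> \<in> ext \<B> C A\<rbrakk> \<Longrightarrow> pull \<B> c \<delta> \<in> ext \<B> C' A"
    and push_add: "\<lbrakk>a \<in> mor \<B> A A'; \<delta> \<in> ext \<B> C A; \<delta>' \<in> ext \<B> C A\<rbrakk> \<Longrightarrow>
          push \<B> a (\<delta> \<oplus>\<^bsub>Ext \<B> C A\<^esub> \<delta>') = push \<B> a \<delta> \<oplus>\<^bsub>Ext \<B> C A'\<^esub> push \<B> a \<delta>'"
    and pull_add: "\<lbrakk>c \<in> mor \<B> C' C; \<delta> \<in> ext \<B> C A; \<delta>' \<in> ext \<B> C A\<rbrakk> \<Longrightarrow>
          pull \<B> c (\<delta> \<oplus>\<^bsub>Ext \<B> C A\<^esub> \<delta>') = pull \<B> c \<delta> \<oplus>\<^bsub>Ext \<B> C' A\<^esub> pull \<B> c \<delta>'"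
    and push_idt: "\<delta> \<in> ext \<B> C A \<Longrightarrow> push \<B> (idt \<B> A) \<delta> = \<delta>"
    and pull_idt: "\<delta> \<in> ext \<B> C A \<Longrightarrow> pull \<B> (idt \<B> C) \<delta> = \<delta>"
    and push_cmp: "\<lbrakk>a \<in> mor \<B> A A'; a' \<in> mor \<B> A' A''; \<delta> \<in> ext \<B> C A\<rbrakk> \<Longrightarrow>
          push \<B> (a' \<cdot> a) \<delta> = push \<B> a' (push \<B> a \<delta>)"
    and pull_cmp: "\<lbrakk>c \<in> mor \<B> C' C; c' \<in> mor \<B> C'' C'; \<delta> \<in> ext \<B> C A\<rbrakk> \<Longrightarrow>
          pull \<B> (c \<cdot> c') \<delta> = pull \<B> c' (pull \<B> c \<delta>)"
    and push_pull: "\<lbrakk>a \<in> mor \<B> A A'; c \<in> mor \<B> C' C; \<delta> \<in> ext \<B> C A\<rbrakk> \<Longrightarrow>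
          push \<B> a (pull \<B> c \<delta>) = pull \<B> c (push \<B> a \<delta>)"
    and push_add_mor: "\<lbrakk>a \<in> mor \<B> A A'; a' \<in> mor \<B> A A'; \<delta> \<in> ext \<B> C A\<rbrakk> \<Longrightarrow>
          push \<B> (a \<oplus>\<^bsub>Hom \<B> A A'\<^esub> a') \<delta> = push \<B> a \<delta> \<oplus>\<^bsub>Ext \<B> C A'\<^esub> push \<B> a' \<delta>"
    and pull_add_mor: "\<lbrakk>c \<in> mor \<B> C' C; c' \<in> mor \<B> C' C; \<delta> \<in> ext \<B> C A\<rbrakk> \<Longrightarrow>
          pull \<B> (c \<oplus>\<^bsub>Hom \<B> C' C\<^esub> c') \<delta> = pull \<B> c \<delta> \<oplus>\<^bsub>Ext \<B> C' A\<^esub> pull \<B> c' \<delta>"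
    and rlz_class: "\<delta> \<in> ext \<B> C A \<Longrightarrow> rlz \<B> C A \<delta> \<in> seqs \<B> A C // seq_equiv \<B> A C"
    and rlz_morphism: "\<lbrakk>etri \<B> A x M y C \<delta>; etri \<B> A' x' M' y' C' \<delta>';
          a \<in> mor \<B> A A'; c \<in> mor \<B> C C'; push \<B> a \<delta> = pull \<B> c \<delta>'\<rbrakk> \<Longrightarrow>
          \<exists>b\<in>mor \<B> M M'. b \<cdot> x = x' \<cdot> a \<and> y' \<cdot> b = c \<cdot> y"
    and rlz_zero: "(in1 \<B> A C, A \<boxplus> C, pr2 \<B> A C) \<in> rlz \<B> C A \<zero>\<^bsub>Ext \<B> C A\<^esub>"
    and rlz_dsum: "\<lbrakk>etri \<B> A x M y C \<delta>; etri \<B> A' x' M' y' C' \<delta>'\<rbrakk> \<Longrightarrow>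
          (dsum_mor \<B> A A' M M' x x', M \<boxplus> M', dsum_mor \<B> M M' C C' y y')
            \<in> rlz \<B> (C \<boxplus> C') (A \<boxplus> A') (dsum_ext \<B> C C' A A' \<delta> \<delta>')"
    and ET3: "\<lbrakk>etri \<B> A x M y C \<delta>; etri \<B> A' x' M' y' C' \<delta>';
          a \<in> mor \<B> A A'; b \<in> mor \<B> M M'; x' \<cdot> a = b \<cdot> x\<rbrakk> \<Longrightarrow>
          \<exists>c\<in>mor \<B> C C'. c \<cdot> y = y' \<cdot> b \<and> push \<B> a \<delta> = pull \<B> c \<delta>'"
    and ET3_op: "\<lbrakk>etri \<B> A x M y C \<delta>; etri \<B> A' x' M' y' C' \<delta>';
          b \<in> mor \<B> M M'; c \<in> mor \<B> C C'; c \<cdot> y = y' \<cdot> b\<rbrakk> \<Longrightarrow>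
          \<exists>a\<in>mor \<B> A A'. x' \<cdot> a = b \<cdot> x \<and> push \<B> a \<delta> = pull \<B> c \<delta>'"
    and ET4: "\<lbrakk>etri \<B> A f M f' D \<delta>; etri \<B> M g C g' F \<delta>'\<rbrakk> \<Longrightarrow>
          \<exists>E d e h' \<delta>''. d \<in> mor \<B> D E \<and> e \<in> mor \<B> E F \<and> h' \<in> mor \<B> C E \<and>
            etri \<B> A (g \<cdot> f) C h' E \<delta>'' \<and> h' \<cdot> g = d \<cdot> f' \<and> e \<cdot> h' = g' \<and>
            etri \<B> D d E e F (push \<B> f' \<delta>') \<and>
            pull \<B> d \<delta>'' = \<delta> \<and> push \<B> f \<delta>'' = pull \<B> e \<delta>'"
    and ET4_op: "\<lbrakk>etri \<B> D f' M f A \<delta>; etri \<B> F g' C g M \<delta>'\<rbrakk> \<Longrightarrow>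
          \<exists>E d e h' \<delta>''. d \<in> mor \<B> E D \<and> e \<in> mor \<B> F E \<and> h' \<in> mor \<B> E C \<and>
            etri \<B> E h' C (f \<cdot> g) A \<delta>'' \<and> g \<cdot> h' = f' \<cdot> d \<and> h' \<cdot> e = g' \<and>
            etri \<B> F e E d D (pull \<B> f' \<delta>') \<and>
            push \<B> d \<delta>'' = \<delta> \<and> pull \<B> f \<delta>'' = push \<B> e \<delta>'"

definition etri_morphism :: "('k, 'o, 'm, 'e) excat \<Rightarrow>
    'o \<Rightarrow> 'm \<Rightarrow> 'o \<Rightarrow> 'm \<Rightarrow> 'o \<Rightarrow> 'e \<Rightarrow> 'o \<Rightarrow> 'm \<Rightarrow> 'o \<Rightarrow> 'm \<Rightarrow> 'o \<Rightarrow> 'e \<Rightarrow>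
    'm \<Rightarrow> 'm \<Rightarrow> 'm \<Rightarrow> bool"
  where "etri_morphism \<B> A x M y C \<delta> A' x' M' y' C' \<delta>' a b c \<longleftrightarrow>
    etri \<B> A x M y C \<delta> \<and> etri \<B> A' x' M' y' C' \<delta>' \<and>
    a \<in> mor \<B> A A' \<and> b \<in> mor \<B> M M' \<and> c \<in> mor \<B> C C' \<and>
    b \<cdot>\<^bsub>\<B>\<^esub> x = x' \<cdot>\<^bsub>\<B>\<^esub> a \<and> c \<cdot>\<^bsub>\<B>\<^esub> y = y' \<cdot>\<^bsub>\<B>\<^esub> b \<and> push \<B> a \<delta> = pull \<B> c \<delta>'"

definition inflation :: "('k, 'o, 'm, 'e) excat \<Rightarrow> 'o \<Rightarrow> 'o \<Rightarrow> 'm \<Rightarrow> bool"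
  where "inflation \<B> A M x \<longleftrightarrow> (\<exists>y C \<delta>. etri \<B> A x M y C \<delta>)"

definition deflation :: "('k, 'o, 'm, 'e) excat \<Rightarrow> 'o \<Rightarrow> 'o \<Rightarrow> 'm \<Rightarrow> bool"
  where "deflation \<B> M C y \<longleftrightarrow> (\<exists>A x \<delta>. etri \<B> A x M y C \<delta>)"

definition projectives :: "('k, 'o, 'm, 'e) excat \<Rightarrow> 'o set"
  where "projectives \<B> = {P. \<forall>M C y. deflation \<B> M C y \<longrightarrow>
    (\<forall>f\<in>mor \<B> P C. \<exists>g\<in>mor \<B> P M. y \<cdot>\<^bsub>\<B>\<^esub> g = f)}"

definition injectives :: "('k, 'o, 'm, 'e) excat \<Rightarrow> 'o set"
  where "injectives \<B> = {I. \<forall>A M x. inflation \<B> A M x \<longrightarrow>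
    (\<forall>f\<in>mor \<B> A I. \<exists>g\<in>mor \<B> M I. g \<cdot>\<^bsub>\<B>\<^esub> x = f)}"

definition enough_projectives :: "('k, 'o, 'm, 'e) excat \<Rightarrow> bool"
  where "enough_projectives \<B> \<longleftrightarrow> (\<forall>C. \<exists>A x P y \<delta>. P \<in> projectives \<B> \<and> etri \<B> A x P y C \<delta>)"

definition enough_injectives :: "('k, 'o, 'm, 'e) excat \<Rightarrow> bool"
  where "enough_injectives \<B> \<longleftrightarrow> (\<forall>A. \<exists>x I y C \<delta>. I \<in> injectives \<B> \<and> etri \<B> A x I y C \<delta>)"

definition WIC :: "('k, 'o, 'm, 'e) excat \<Rightarrow> bool"
  where "WIC \<B> \<longleftrightarrow> (\<forall>A M C. \<forall>f\<in>mor \<B> A M. \<forall>g\<in>mor \<B> M C.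
    (deflation \<B> A C (g \<cdot>\<^bsub>\<B>\<^esub> f) \<longrightarrow> deflation \<B> M C g) \<and>
    (inflation \<B> A C (g \<cdot>\<^bsub>\<B>\<^esub> f) \<longrightarrow> inflation \<B> A M f))"


section \<open>Relative rigidity\<close>

definition Ext_vanishes :: "('k, 'o, 'm, 'e) excat \<Rightarrow> 'o \<Rightarrow> 'o \<Rightarrow> bool"
  where "Ext_vanishes \<B> C A \<longleftrightarrow> ext \<B> C A = {\<zero>\<^bsub>Ext \<B> C A\<^esub>}"

definition rigid :: "('k, 'o, 'm, 'e) excat \<Rightarrow> 'o \<Rightarrow> bool"
  where "rigid \<B> R \<longleftrightarrow> Ext_vanishes \<B> R R"

text \<open>The subcategory \<open>\<R> = (add R) \<or> \<P>\<close>.\<close>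

definition calR :: "('k, 'o, 'm, 'e) excat \<Rightarrow> 'o \<Rightarrow> 'o set"
  where "calR \<B> R = {X. \<exists>A\<in>add_cl \<B> R. \<exists>P\<in>projectives \<B>. isomorphic \<B> X (A \<boxplus>\<^bsub>\<B>\<^esub> P)}"

text \<open>\<open>\<H> = CoCone(\<R>, \<R>)\<close>.\<close>

definition calH :: "('k, 'o, 'm, 'e) excat \<Rightarrow> 'o \<Rightarrow> 'o set"
  where "calH \<B> R = {X. \<exists>R'\<in>calR \<B> R. \<exists>R''\<in>calR \<B> R. \<exists>x y \<delta>. etri \<B> X x R' y R'' \<delta>}"

text \<open>The class of all \<open>X\<close> with \<open>\<bbbE>(\<R>, X) = 0\<close>.\<close>

definition R_perp :: "('k, 'o, 'm, 'e) excat \<Rightarrow> 'o \<Rightarrow> 'o set"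
  where "R_perp \<B> R = {X. \<forall>T\<in>calR \<B> R. Ext_vanishes \<B> T X}"

definition factors_through :: "('k, 'o, 'm, 'e) excat \<Rightarrow> 'o \<Rightarrow> 'o \<Rightarrow> 'o set \<Rightarrow> 'm \<Rightarrow> bool"
  where "factors_through \<B> A C \<T> f \<longleftrightarrow>
    (\<exists>T\<in>\<T>. \<exists>a\<in>mor \<B> A T. \<exists>b\<in>mor \<B> T C. f = b \<cdot>\<^bsub>\<B>\<^esub> a)"

text \<open>A choice of an \<open>\<bbbE>\<close>-triangle \<open>N \<rightarrow> I \<rightarrow> \<Sigma>N\<close> with \<open>I\<close> injective, for every \<open>N\<close>; it exists as
  soon as there are enough injectives.\<close>

definition inj_tri :: "('k, 'o, 'm, 'e) excat \<Rightarrow> 'o \<Rightarrow> 'm \<times> 'o \<times> 'm \<times> 'o \<times> 'e"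
  where "inj_tri \<B> N = (SOME (j, I, i, S, \<delta>). I \<in> injectives \<B> \<and> etri \<B> N j I i S \<delta>)"

definition inj_obj :: "('k, 'o, 'm, 'e) excat \<Rightarrow> 'o \<Rightarrow> 'o"
  where "inj_obj \<B> N = (case inj_tri \<B> N of (j, I, i, S, \<delta>) \<Rightarrow> I)"

definition inj_defl :: "('k, 'o, 'm, 'e) excat \<Rightarrow> 'o \<Rightarrow> 'm"
  where "inj_defl \<B> N = (case inj_tri \<B> N of (j, I, i, S, \<delta>) \<Rightarrow> i)"

definition Sig :: "('k, 'o, 'm, 'e) excat \<Rightarrow> 'o \<Rightarrow> 'o"
  where "Sig \<B> N = (case inj_tri \<B> N of (j, I, i, S, \<delta>) \<Rightarrow> S)"

text \<open>\<open>R_mor\<close> is \<open>[R](M, \<Sigma>N)\<close>, and \<open>R_mor_bar\<close> is its subset with the overline.\<close>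

definition R_mor :: "('k, 'o, 'm, 'e) excat \<Rightarrow> 'o \<Rightarrow> 'o \<Rightarrow> 'o \<Rightarrow> 'm set"
  where "R_mor \<B> R M N =
    {f \<in> mor \<B> M (Sig \<B> N). factors_through \<B> M (Sig \<B> N) (add_cl \<B> R) f}"

definition R_mor_bar :: "('k, 'o, 'm, 'e) excat \<Rightarrow> 'o \<Rightarrow> 'o \<Rightarrow> 'o \<Rightarrow> 'm set"
  where "R_mor_bar \<B> R M N =
    {f \<in> R_mor \<B> R M N. \<exists>h\<in>mor \<B> M (inj_obj \<B> N). f = inj_defl \<B> N \<cdot>\<^bsub>\<B>\<^esub> h}"

definition R_rigid :: "('k, 'o, 'm, 'e) excat \<Rightarrow> 'o \<Rightarrow> 'o \<Rightarrow> bool"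
  where "R_rigid \<B> R X \<longleftrightarrow> R_mor_bar \<B> R X X = R_mor \<B> R X X"

definition max_R_rigid :: "('k, 'o, 'm, 'e) excat \<Rightarrow> 'o \<Rightarrow> 'o \<Rightarrow> bool"
  where "max_R_rigid \<B> R X \<longleftrightarrow> X \<in> calH \<B> R \<and> R_rigid \<B> R X \<and>
    (\<forall>Z\<in>calH \<B> R. indecomposable \<B> Z \<and> Z \<notin> projectives \<B> \<and> R_rigid \<B> R (X \<boxplus>\<^bsub>\<B>\<^esub> Z) \<longrightarrow>
      Z \<in> add_cl \<B> X)"

text \<open>The class \<open>M*[R]\<close>. Here \<open>I\<close> is an arbitrary injective object fitting into an \<open>\<bbbE>\<close>-triangle
  starting at \<open>M\<^sub>X\<close>, and \<open>S\<close> is the \<open>\<Sigma>M\<^sub>X\<close> which that triangle provides; neither need be the one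
  chosen in \<open>inj_tri\<close>.\<close>

definition star :: "('k, 'o, 'm, 'e) excat \<Rightarrow> 'o \<Rightarrow> 'o \<Rightarrow> 'o set"
  where "star \<B> R M = {X. \<exists>M\<^sub>X\<in>add_cl \<B> M. \<exists>I\<in>injectives \<B>. \<exists>u v S \<delta> \<eta> C q \<delta>' m i.
    etri_morphism \<B> M\<^sub>X u I v S \<delta> X \<eta> C q S \<delta>' m i (idt \<B> S) \<and>
    factors_through \<B> X C (R_perp \<B> R) \<eta>}"

definition geq_R :: "('k, 'o, 'm, 'e) excat \<Rightarrow> 'o \<Rightarrow> 'o \<Rightarrow> 'o \<Rightarrow> bool"
  where "geq_R \<B> R M N \<longleftrightarrow> star \<B> R N \<subseteq> star \<B> R M"

definition gt_R :: "('k, 'o, 'm, 'e) excat \<Rightarrow> 'o \<Rightarrow> 'o \<Rightarrow> 'o \<Rightarrow> bool"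
  where "gt_R \<B> R M N \<longleftrightarrow> geq_R \<B> R M N \<and> \<not> geq_R \<B> R N M"


section \<open>Approximations and complements\<close>

definition right_min_approx :: "('k, 'o, 'm, 'e) excat \<Rightarrow> 'o set \<Rightarrow> 'o \<Rightarrow> 'o \<Rightarrow> 'm \<Rightarrow> bool"
  where "right_min_approx \<B> \<T> T X f \<longleftrightarrow> T \<in> \<T> \<and> f \<in> mor \<B> T X \<and>
    (\<forall>T'\<in>\<T>. \<forall>g\<in>mor \<B> T' X. \<exists>h\<in>mor \<B> T' T. f \<cdot>\<^bsub>\<B>\<^esub> h = g) \<and>
    (\<forall>h\<in>mor \<B> T T. f \<cdot>\<^bsub>\<B>\<^esub> h = f \<longrightarrow> h \<in> iso_mor \<B> T T)"

definition left_min_approx :: "('k, 'o, 'm, 'e) excat \<Rightarrow> 'o set \<Rightarrow> 'o \<Rightarrow> 'o \<Rightarrow> 'm \<Rightarrow> bool"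
  where "left_min_approx \<B> \<T> X T g \<longleftrightarrow> T \<in> \<T> \<and> g \<in> mor \<B> X T \<and>
    (\<forall>T'\<in>\<T>. \<forall>f\<in>mor \<B> X T'. \<exists>h\<in>mor \<B> T T'. h \<cdot>\<^bsub>\<B>\<^esub> g = f) \<and>
    (\<forall>h\<in>mor \<B> T T. h \<cdot>\<^bsub>\<B>\<^esub> g = g \<longrightarrow> h \<in> iso_mor \<B> T T)"

definition another_complement :: "('k, 'o, 'm, 'e) excat \<Rightarrow> 'o \<Rightarrow> 'o \<Rightarrow> 'o \<Rightarrow> 'o \<Rightarrow> bool"
  where "another_complement \<B> R U X Y \<longleftrightarrow> Y \<in> calH \<B> R \<and> Y \<notin> projectives \<B> \<and>
    indecomposable \<B> Y \<and> \<not> isomorphic \<B> Y X \<and> max_R_rigid \<B> R (U \<boxplus>\<^bsub>\<B>\<^esub> Y)"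

end

theory Submission
  imports Defs
begin

text \<open>
  Call an extension relative if it is killed by all maps from syzygies of objects of \<open>\<R>\<close>. The exact sequences of
  the extriangulated category restrict to relative extensions. On \<open>\<H>\<close> they are the extensions pulled back from
  \<open>\<R>\<close>, so \<open>R\<close>-rigidity is the vanishing of relative self-extensions, and relative extension groups are right
  exact in both arguments, as over a hereditary ring. Moreover \<open>X\<close> lies in \<open>N * [R]\<close> iff every map from a syzygy
  \<open>W\<close> of \<open>R\<close> to \<open>X\<close> factors through \<open>add N\<close>.

  If \<open>X\<close> lies in \<open>U * [R]\<close>, its right \<open>add U\<close>-approximation is therefore a deflation with a relative extension.
  Otherwise take a left minimal \<open>add M\<close>-approximation \<open>W \<rightarrow> V\<close>. By maximality its cone \<open>C\<close> lies in \<open>add M\<close>, and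
  \<open>X\<close> is a summand of \<open>V\<close>, hence not of \<open>C\<close>, so that \<open>C\<close> lies in \<open>add U\<close>. The pushout of \<open>W \<rightarrow> V\<close> along \<open>W \<rightarrow> P\<close>,
  for a projective cover \<open>P \<rightarrow> R\<close> with kernel \<open>W\<close>, is a conflation \<open>V \<rightarrow> P \<boxplus> C \<rightarrow> R\<close>. All maps \<open>X \<rightarrow> R\<close> lift along
  it, since \<open>X\<close> has no relative extensions by \<open>V\<close>. So they factor through \<open>add U\<close>, and the left \<open>add
  U\<close>-approximation of \<open>X\<close> is a relative inflation.

  In both cases right exactness makes \<open>N = U \<boxplus> Y\<close> rigid, an idempotent of \<open>Y\<close> acts on the local ring of \<open>X\<close> and
  so is trivial, and it remains to see that \<open>N\<close> is maximal. For this it suffices that each object of \<open>\<H>\<close> without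
  relative extensions by \<open>N\<close> lies in \<open>N * [R]\<close> (or the dual statement): two successive \<open>add N\<close>-approximations
  then split off any object compatible with \<open>N\<close>.
\<close>

section \<open>The radical of a linear category\<close>

text \<open>Right exactness has two sources. A class over an object of \<open>\<R>\<close> is a
  pushout of a syzygy sequence, and maps from syzygies lift along the deflation of a relative
  extension; maps into objects of \<open>\<R>\<close> extend along its inflation, since
  \<open>\<R>\<close> has no extensions with itself. Arbitrary conflations need not have either
  property, so each approximation must be shown to yield a relative class. For right approximations
  of A this is what A in N * [R] provides; for left approximations it is that maps from A to R
  factor through add N. The two conditions are not dual to one another, hence the two cases are
  proved separately, and the formal opposite category serves only the exact sequences, the
  approximations and the idempotent argument. Failure of the first condition for X must be turned
  into the second; that step compares summands by means of the radical. In both cases X and Y lie on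
  different sides of U * [R], which separates Y from X and makes the order strict.\<close>

definition retract :: "('k, 'o, 'm, 'e) excat \<Rightarrow> 'o \<Rightarrow> 'o \<Rightarrow> bool"
  where "retract \<B> A C \<longleftrightarrow> (\<exists>i\<in>mor \<B> A C. \<exists>p\<in>mor \<B> C A. p \<cdot>\<^bsub>\<B>\<^esub> i = idt \<B> A)"

text \<open>The structure maps are arguments, not those chosen by \<open>dsum\<close>, so a given
  object can be decomposed and regrouped without passing to an isomorphic copy.\<close>

definition biprod :: "('k, 'o, 'm, 'e) excat \<Rightarrow> 'o \<Rightarrow> 'o \<Rightarrow> 'o \<Rightarrow> 'm \<Rightarrow> 'm \<Rightarrow> 'm \<Rightarrow> 'm \<Rightarrow> bool"
  where "biprod \<B> A C T i p j q \<longleftrightarrow> i \<in> mor \<B> A T \<and> p \<in> mor \<B> T A \<and> j \<in> mor \<B> C T \<and> q \<in> mor \<B> T C \<and>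
    p \<cdot>\<^bsub>\<B>\<^esub> i = idt \<B> A \<and> q \<cdot>\<^bsub>\<B>\<^esub> j = idt \<B> C \<and> p \<cdot>\<^bsub>\<B>\<^esub> j = \<zero>\<^bsub>Hom \<B> C A\<^esub> \<and> q \<cdot>\<^bsub>\<B>\<^esub> i = \<zero>\<^bsub>Hom \<B> A C\<^esub> \<and>
    (i \<cdot>\<^bsub>\<B>\<^esub> p) \<oplus>\<^bsub>Hom \<B> T T\<^esub> (j \<cdot>\<^bsub>\<B>\<^esub> q) = idt \<B> T"

text \<open>This is locality of the endomorphism ring: of two elements with sum 1, one is a unit.
  Phrased inside the Hom groups it is visibly self-dual.\<close>

definition local_obj :: "('k, 'o, 'm, 'e) excat \<Rightarrow> 'o \<Rightarrow> bool"
  where "local_obj \<B> A \<longleftrightarrow> idt \<B> A \<noteq> \<zero>\<^bsub>Hom \<B> A A\<^esub> \<and> (\<forall>f\<in>mor \<B> A A. \<forall>g\<in>mor \<B> A A.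
    f \<oplus>\<^bsub>Hom \<B> A A\<^esub> g = idt \<B> A \<longrightarrow> f \<in> iso_mor \<B> A A \<or> g \<in> iso_mor \<B> A A)"

text \<open>The number of local summands is part of the predicate: it is the induction measure, and
  the quantity that a minimal approximation minimises.\<close>

primrec local_decomp :: "('k, 'o, 'm, 'e) excat \<Rightarrow> nat \<Rightarrow> 'o \<Rightarrow> bool" where
  "local_decomp \<B> 0 T \<longleftrightarrow> idt \<B> T = \<zero>\<^bsub>Hom \<B> T T\<^esub>"
| "local_decomp \<B> (Suc n) T \<longleftrightarrow> (\<exists>A C i p j q. biprod \<B> A C T i p j q \<and> local_obj \<B> A \<and> local_decomp \<B> n C)"

text \<open>The Jacobson radical of the category. Here \<open>u\<close> plays the role of 1 - kg,
  given by an equation so that no subtraction occurs.\<close>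

definition radical :: "('k, 'o, 'm, 'e) excat \<Rightarrow> 'o \<Rightarrow> 'o \<Rightarrow> 'm set"
  where "radical \<B> A C = {g \<in> mor \<B> A C. \<forall>k\<in>mor \<B> C A. \<forall>u\<in>mor \<B> A A.
    u \<oplus>\<^bsub>Hom \<B> A A\<^esub> (k \<cdot>\<^bsub>\<B>\<^esub> g) = idt \<B> A \<longrightarrow> u \<in> iso_mor \<B> A A}"

context linear_category
begin

abbreviation arr where "arr A C \<equiv> mor \<B> A C"
abbreviation zmor where "zmor A C \<equiv> \<zero>\<^bsub>Hom \<B> A C\<^esub>"
abbreviation zext where "zext C A \<equiv> \<zero>\<^bsub>Ext \<B> C A\<^esub>"

section \<open>Hom groups, isomorphisms, retracts and biproducts\<close>

lemma Hom_abelian_group: "abelian_group (Hom \<B> A C)"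
  using module_Hom module.axioms by blast

lemma add_closed: "\<lbrakk>f \<in> arr A C; g \<in> arr A C\<rbrakk> \<Longrightarrow> f \<oplus>\<^bsub>Hom \<B> A C\<^esub> g \<in> arr A C"
  by (rule abelian_monoid.a_closed[OF abelian_group.axioms(1)[OF Hom_abelian_group]])

lemma zero_closed: "zmor A C \<in> arr A C"
  by (rule abelian_monoid.zero_closed[OF abelian_group.axioms(1)[OF Hom_abelian_group]])

lemma add_comm: "\<lbrakk>f \<in> arr A C; g \<in> arr A C\<rbrakk> \<Longrightarrow> f \<oplus>\<^bsub>Hom \<B> A C\<^esub> g = g \<oplus>\<^bsub>Hom \<B> A C\<^esub> f"
  by (rule abelian_monoid.a_comm[OF abelian_group.axioms(1)[OF Hom_abelian_group]])

lemma add_assoc: "\<lbrakk>f \<in> arr A C; g \<in> arr A C; h \<in> arr A C\<rbrakk> \<Longrightarrow>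
    f \<oplus>\<^bsub>Hom \<B> A C\<^esub> g \<oplus>\<^bsub>Hom \<B> A C\<^esub> h = f \<oplus>\<^bsub>Hom \<B> A C\<^esub> (g \<oplus>\<^bsub>Hom \<B> A C\<^esub> h)"
  by (rule abelian_monoid.a_assoc[OF abelian_group.axioms(1)[OF Hom_abelian_group]])

lemma add_zero: "f \<in> arr A C \<Longrightarrow> f \<oplus>\<^bsub>Hom \<B> A C\<^esub> zmor A C = f"
  by (rule abelian_monoid.r_zero[OF abelian_group.axioms(1)[OF Hom_abelian_group]])

lemma zero_add: "f \<in> arr A C \<Longrightarrow> zmor A C \<oplus>\<^bsub>Hom \<B> A C\<^esub> f = f"
  by (rule abelian_monoid.l_zero[OF abelian_group.axioms(1)[OF Hom_abelian_group]])

text \<open>This is the difference g - f. Later proofs introduce a difference by the equation it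
  solves, which distributes over composition.\<close>

lemma complement: assumes "f \<in> arr A C" "g \<in> arr A C"
  obtains h where "h \<in> arr A C" "h \<oplus>\<^bsub>Hom \<B> A C\<^esub> f = g"
proof
  interpret H: abelian_group "Hom \<B> A C" by (rule Hom_abelian_group)
  show "g \<oplus>\<^bsub>Hom \<B> A C\<^esub> (\<ominus>\<^bsub>Hom \<B> A C\<^esub> f) \<in> arr A C" using assms by (intro H.a_closed H.a_inv_closed)
  show "g \<oplus>\<^bsub>Hom \<B> A C\<^esub> (\<ominus>\<^bsub>Hom \<B> A C\<^esub> f) \<oplus>\<^bsub>Hom \<B> A C\<^esub> f = g"
    using assms H.a_assoc[OF assms(2) H.a_inv_closed[OF assms(1)] assms(1)] H.l_neg[OF assms(1)] H.r_zero
      by metis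
qed

lemma add_cancel: assumes "f \<in> arr A C" "g \<in> arr A C" "h \<in> arr A C"
  and eq: "f \<oplus>\<^bsub>Hom \<B> A C\<^esub> g = f \<oplus>\<^bsub>Hom \<B> A C\<^esub> h" shows "g = h"
proof -
  obtain n where n: "n \<in> arr A C" "n \<oplus>\<^bsub>Hom \<B> A C\<^esub> f = zmor A C"
    using complement[OF assms(1) zero_closed] by blast
  have "n \<oplus>\<^bsub>Hom \<B> A C\<^esub> (f \<oplus>\<^bsub>Hom \<B> A C\<^esub> g) = n \<oplus>\<^bsub>Hom \<B> A C\<^esub> (f \<oplus>\<^bsub>Hom \<B> A C\<^esub> h)" by (simp only: eq)
  then show ?thesis
    by (simp only: add_assoc[OF n(1) assms(1) assms(2), symmetric] add_assoc[OF n(1) assms(1) assms(3),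
      symmetric] n(2) zero_add assms(1-3))
qed

lemma zero_unique: assumes "f \<in> arr A C" "f \<oplus>\<^bsub>Hom \<B> A C\<^esub> g = f" "g \<in> arr A C"
  shows "g = zmor A C"
  by (rule add_cancel[OF assms(1,3) zero_closed]) (simp only: assms add_zero)

lemma cmp_zero: assumes "g \<in> arr C D" shows "g \<cdot> zmor A C = zmor A D"
proof (rule zero_unique)
  show *: "g \<cdot> zmor A C \<in> arr A D" by (rule cmp_closed[OF zero_closed assms])
  show "g \<cdot> zmor A C \<oplus>\<^bsub>Hom \<B> A D\<^esub> g \<cdot> zmor A C = g \<cdot> zmor A C"
    by (simp only: cmp_add_right[OF zero_closed zero_closed assms, symmetric] zero_add zero_closed)
  show "g \<cdot> zmor A C \<in> arr A D" by (rule *)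
qed

lemma zero_cmp: assumes "f \<in> arr A C" shows "zmor C D \<cdot> f = zmor A D"
proof (rule zero_unique)
  show *: "zmor C D \<cdot> f \<in> arr A D" by (rule cmp_closed[OF assms zero_closed])
  show "zmor C D \<cdot> f \<oplus>\<^bsub>Hom \<B> A D\<^esub> zmor C D \<cdot> f = zmor C D \<cdot> f"
    by (simp only: cmp_add_left[OF assms zero_closed zero_closed, symmetric] zero_add zero_closed)
  show "zmor C D \<cdot> f \<in> arr A D" by (rule *)
qed

lemmas arr_intros = cmp_closed idt_closed add_closed zero_closed in1_closed in2_closed pr1_closed pr2_closed

lemma assoc_right: "\<lbrakk>f \<in> arr A C; g \<in> arr C D; h \<in> arr D F\<rbrakk> \<Longrightarrow> h \<cdot> g \<cdot> f = h \<cdot> (g \<cdot> f)"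
  by (simp only: cmp_assoc)

lemma cmp4: assumes "f \<in> arr A C" "g \<in> arr C D" "h \<in> arr D F" "k \<in> arr F G"
  shows "k \<cdot> h \<cdot> (g \<cdot> f) = k \<cdot> (h \<cdot> g \<cdot> f)"
  using assms cmp_closed[OF assms(1,2)] cmp_closed[OF assms(2,3)] cmp_closed[OF assms(3,4)]
  by (simp add: cmp_assoc)

lemma cmp_mid_idt: assumes "f \<in> arr A C" "g \<in> arr C D" "h \<in> arr D C" "k \<in> arr C G" "h \<cdot> g = idt \<B> C"
  shows "k \<cdot> h \<cdot> (g \<cdot> f) = k \<cdot> f"
  using cmp4[OF assms(1-4)] assms by (simp add: cmp_idt_left)

lemma iso_morI: "\<lbrakk>f \<in> arr A C; g \<in> arr C A; g \<cdot> f = idt \<B> A; f \<cdot> g = idt \<B> C\<rbrakk> \<Longrightarrow> f \<in> iso_mor \<B> A C"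
  unfolding iso_mor_def by blast

lemma iso_morE: assumes "f \<in> iso_mor \<B> A C"
  obtains g where "f \<in> arr A C" "g \<in> arr C A" "g \<cdot> f = idt \<B> A" "f \<cdot> g = idt \<B> C" "g \<in> iso_mor \<B> C A"
  using assms unfolding iso_mor_def by blast

lemma iso_mor_arr: "f \<in> iso_mor \<B> A C \<Longrightarrow> f \<in> arr A C"
  unfolding iso_mor_def by blast

lemma iso_mor_idt: "idt \<B> A \<in> iso_mor \<B> A A"
  by (rule iso_morI[of _ _ _ "idt \<B> A"]) (simp_all add: idt_closed cmp_idt_left[OF idt_closed])

lemma iso_mor_cmp: assumes "f \<in> iso_mor \<B> A C" "g \<in> iso_mor \<B> C D" shows "g \<cdot> f \<in> iso_mor \<B> A D"
proof -
  obtain f' where f: "f \<in> arr A C" "f' \<in> arr C A" "f' \<cdot> f = idt \<B> A" "f \<cdot> f' = idt \<B> C"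
    using iso_morE[OF assms(1)]
    by metis
  obtain g' where g: "g \<in> arr C D" "g' \<in> arr D C" "g' \<cdot> g = idt \<B> C" "g \<cdot> g' = idt \<B> D"
    using iso_morE[OF assms(2)]
    by metis
  show ?thesis
    by (rule iso_morI[OF cmp_closed[OF f(1) g(1)] cmp_closed[OF g(2) f(2)]])
      (simp_all add: cmp_mid_idt[OF f(1) g(1) g(2) f(2) g(3)] f cmp_mid_idt[OF g(2) f(2) f(1) g(1) f(4)] g)
qed

lemma iso_mor_two_sided: assumes f: "f \<in> arr A C" and g: "g \<in> arr C A" "g \<cdot> f = idt \<B> A" and h: "h \<in> arr C A" "f
  \<cdot> h = idt \<B> C"
  shows "f \<in> iso_mor \<B> A C"
proof -
  have "g = g \<cdot> (f \<cdot> h)" using g h by (simp add: cmp_idt_right)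
  also have "... = h" using cmp_assoc[OF h(1) f g(1)] g h by (simp add: cmp_idt_left)
  finally show ?thesis using iso_morI[OF f g(1) g(2)] h by simp
qed

lemma isomorphicI: "\<lbrakk>f \<in> arr A C; g \<in> arr C A; g \<cdot> f = idt \<B> A; f \<cdot> g = idt \<B> C\<rbrakk> \<Longrightarrow> isomorphic \<B> A C"
  unfolding isomorphic_def using iso_morI by blast

lemma isomorphic_sym: "isomorphic \<B> A C \<Longrightarrow> isomorphic \<B> C A"
  unfolding isomorphic_def using iso_morE by blast

lemma isomorphic_trans: "\<lbrakk>isomorphic \<B> A C; isomorphic \<B> C D\<rbrakk> \<Longrightarrow> isomorphic \<B> A D"
  unfolding isomorphic_def using iso_mor_cmp by blast

lemma retractI: "\<lbrakk>i \<in> arr A C; p \<in> arr C A; p \<cdot> i = idt \<B> A\<rbrakk> \<Longrightarrow> retract \<B> A C"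
  unfolding retract_def by blast

lemma retract_refl: "retract \<B> A A"
  by (rule retractI[OF idt_closed idt_closed cmp_idt_left[OF idt_closed]])

lemma retract_trans: assumes "retract \<B> A C" "retract \<B> C D" shows "retract \<B> A D"
proof -
  obtain i p where i: "i \<in> arr A C" "p \<in> arr C A" "p \<cdot> i = idt \<B> A"
    using assms(1)
    unfolding retract_def
    by blast
  obtain j q where j: "j \<in> arr C D" "q \<in> arr D C" "q \<cdot> j = idt \<B> C"
    using assms(2)
    unfolding retract_def
    by blast
  show ?thesis
    by (rule retractI[OF cmp_closed[OF i(1) j(1)] cmp_closed[OF j(2) i(2)]])
      (simp add: cmp_mid_idt[OF i(1) j(1) j(2) i(2) j(3)] i)
qed

lemma retract_iso: "isomorphic \<B> A C \<Longrightarrow> retract \<B> A C"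
  unfolding isomorphic_def retract_def using iso_morE by (metis ex_in_conv)

lemma retract_dsum1: "retract \<B> A (A \<boxplus> C)"
  by (rule retractI[OF in1_closed pr1_closed pr1_in1])

lemma retract_dsum2: "retract \<B> C (A \<boxplus> C)"
  by (rule retractI[OF in2_closed pr2_closed pr2_in2])

lemma biprod_dsum: "biprod \<B> A C (A \<boxplus> C) (in1 \<B> A C) (pr1 \<B> A C) (in2 \<B> A C) (pr2 \<B> A C)"
  unfolding biprod_def
    by (simp add: in1_closed in2_closed pr1_closed pr2_closed pr1_in1 pr2_in2 pr1_in2 pr2_in1 in_pr_sum)

lemma biprod_swap: "biprod \<B> A C T i p j q \<Longrightarrow> biprod \<B> C A T j q i p"
  unfolding biprod_def by (auto simp: add_comm[OF cmp_closed cmp_closed])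

lemma biprod_expand_left: assumes "biprod \<B> A C T i p j q" "k \<in> arr T Z" "h \<in> arr Z' T"
  shows "k \<cdot> h = (k \<cdot> i) \<cdot> (p \<cdot> h) \<oplus>\<^bsub>Hom \<B> Z' Z\<^esub> (k \<cdot> j) \<cdot> (q \<cdot> h)"
proof -
  note b = assms(1)[unfolded biprod_def]
  have c: "i \<cdot> p \<in> arr T T" "j \<cdot> q \<in> arr T T" using b cmp_closed by auto
  have "k \<cdot> h = k \<cdot> (idt \<B> T \<cdot> h)" using assms by (simp add: cmp_idt_left)
  also have "... = k \<cdot> ((i \<cdot> p) \<cdot> h \<oplus>\<^bsub>Hom \<B> Z' T\<^esub> (j \<cdot> q) \<cdot> h)" using b cmp_add_left[OF assms(3) c] by simp
  also have "... = k \<cdot> ((i \<cdot> p) \<cdot> h) \<oplus>\<^bsub>Hom \<B> Z' Z\<^esub> k \<cdot> ((j \<cdot> q) \<cdot> h)"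
    by (rule cmp_add_right[OF cmp_closed[OF assms(3) c(1)] cmp_closed[OF assms(3) c(2)] assms(2)])
  finally show ?thesis
    using b cmp4[OF assms(3) _ _ assms(2), of p A i] cmp4[OF assms(3) _ _ assms(2), of q C j] by simp
qed

lemma biprod_mor_in: assumes b: "biprod \<B> A C T i p j q" and f: "f \<in> arr Z A" "g \<in> arr Z C"
  shows "i \<cdot> f \<oplus>\<^bsub>Hom \<B> Z T\<^esub> j \<cdot> g \<in> arr Z T" "p \<cdot> (i \<cdot> f \<oplus>\<^bsub>Hom \<B> Z T\<^esub> j \<cdot> g) = f" "q \<cdot> (i \<cdot> f \<oplus>\<^bsub>Hom \<B> Z T\<^esub> j \<cdot>
    g) = g"
proof -
  note b = b[unfolded biprod_def]
  have c: "i \<cdot> f \<in> arr Z T" "j \<cdot> g \<in> arr Z T" using b f cmp_closed by auto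
  show "i \<cdot> f \<oplus>\<^bsub>Hom \<B> Z T\<^esub> j \<cdot> g \<in> arr Z T" by (rule add_closed[OF c])
  show "p \<cdot> (i \<cdot> f \<oplus>\<^bsub>Hom \<B> Z T\<^esub> j \<cdot> g) = f"
    using b f cmp_add_right[OF c, of p A] cmp_assoc[OF f(1), of i T p A] cmp_assoc[OF f(2), of j T p A]
    by (simp add: cmp_idt_left zero_cmp add_zero)
  show "q \<cdot> (i \<cdot> f \<oplus>\<^bsub>Hom \<B> Z T\<^esub> j \<cdot> g) = g"
    using b f cmp_add_right[OF c, of q C] cmp_assoc[OF f(1), of i T q C] cmp_assoc[OF f(2), of j T q C]
    by (simp add: cmp_idt_left zero_cmp zero_add)
qed

lemma biprod_mor_out: assumes b: "biprod \<B> A C T i p j q" and f: "f \<in> arr A Z" "g \<in> arr C Z"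
  shows "f \<cdot> p \<oplus>\<^bsub>Hom \<B> T Z\<^esub> g \<cdot> q \<in> arr T Z" "(f \<cdot> p \<oplus>\<^bsub>Hom \<B> T Z\<^esub> g \<cdot> q) \<cdot> i = f" "(f \<cdot> p \<oplus>\<^bsub>Hom \<B> T Z\<^esub> g \<cdot> q) \<cdot>
    j = g"
proof -
  note b = b[unfolded biprod_def]
  have c: "f \<cdot> p \<in> arr T Z" "g \<cdot> q \<in> arr T Z" using b f cmp_closed by auto
  show "f \<cdot> p \<oplus>\<^bsub>Hom \<B> T Z\<^esub> g \<cdot> q \<in> arr T Z" by (rule add_closed[OF c])
  show "(f \<cdot> p \<oplus>\<^bsub>Hom \<B> T Z\<^esub> g \<cdot> q) \<cdot> i = f"
    using b f cmp_add_left[OF _ c, of i A] assoc_right[of i A T p A f Z] assoc_right[of i A T q C g Z]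
    by (simp add: cmp_idt_right cmp_zero add_zero)
  show "(f \<cdot> p \<oplus>\<^bsub>Hom \<B> T Z\<^esub> g \<cdot> q) \<cdot> j = g"
    using b f cmp_add_left[OF _ c, of j C] assoc_right[of j C T p A f Z] assoc_right[of j C T q C g Z]
    by (simp add: cmp_idt_right cmp_zero zero_add)
qed

lemma biprod_mor_comp: assumes b: "biprod \<B> A C T i p j q"
    and f: "f \<in> arr A Z" "g \<in> arr C Z" and h: "h \<in> arr Y A" "k \<in> arr Y C"
  shows "(f \<cdot> p \<oplus>\<^bsub>Hom \<B> T Z\<^esub> g \<cdot> q) \<cdot> (i \<cdot> h \<oplus>\<^bsub>Hom \<B> Y T\<^esub> j \<cdot> k) = f \<cdot> h \<oplus>\<^bsub>Hom \<B> Y Z\<^esub> g \<cdot> k"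
  using biprod_expand_left[OF b biprod_mor_out(1)[OF b f] biprod_mor_in(1)[OF b h]]
    biprod_mor_out(2,3)[OF b f] biprod_mor_in(2,3)[OF b h] by simp

text \<open>The column with entries \<open>h\<close>, \<open>k\<close> followed by the row with
  entries \<open>f\<close>, \<open>g\<close> is the given sum.\<close>

lemma retract_sum: assumes f: "f \<in> arr A Z" "g \<in> arr C Z" and h: "h \<in> arr Z A" "k \<in> arr Z C"
    and s: "f \<cdot> h \<oplus>\<^bsub>Hom \<B> Z Z\<^esub> g \<cdot> k = idt \<B> Z"
  shows "retract \<B> Z (A \<boxplus> C)"
  using biprod_mor_comp[OF biprod_dsum f h] biprod_mor_out(1)[OF biprod_dsum f] biprod_mor_in(1)[OF biprod_dsum
    h] s retractI
    by metis

lemma biprod_iso_dsum: assumes b: "biprod \<B> A C T i p j q" shows "isomorphic \<B> T (A \<boxplus> C)"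
proof -
  note b' = b[unfolded biprod_def]
  have p: "p \<in> arr T A" "q \<in> arr T C" "i \<in> arr A T" "j \<in> arr C T" using b' by auto
  note d = biprod_dsum[of A C]
  let ?f = "in1 \<B> A C \<cdot> p \<oplus>\<^bsub>Hom \<B> T (A \<boxplus> C)\<^esub> in2 \<B> A C \<cdot> q" and ?g = "i \<cdot> pr1 \<B> A C \<oplus>\<^bsub>Hom \<B> (A \<boxplus> C) T\<^esub> j \<cdot> pr2 \<B>
    A C"
  show ?thesis
  proof (rule isomorphicI)
    show "?f \<in> arr T (A \<boxplus> C)" by (rule biprod_mor_in(1)[OF d p(1,2)])
    show "?g \<in> arr (A \<boxplus> C) T" by (rule biprod_mor_out(1)[OF d p(3,4)])
    show "?g \<cdot> ?f = idt \<B> T" using biprod_mor_comp[OF d p(3,4) p(1,2)] b' by simp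
    show "?f \<cdot> ?g = idt \<B> (A \<boxplus> C)"
      using biprod_mor_comp[OF b in1_closed in2_closed pr1_closed pr2_closed] in_pr_sum
      by simp
  qed
qed

lemma isomorphic_biprod: assumes "isomorphic \<B> T (A \<boxplus> C)" shows "\<exists>i p j q. biprod \<B> A C T i p j q"
proof -
  obtain f where "f \<in> iso_mor \<B> T (A \<boxplus> C)" using assms unfolding isomorphic_def by blast
  then obtain g where f: "f \<in> arr T (A \<boxplus> C)" "g \<in> arr (A \<boxplus> C) T" "g \<cdot> f = idt \<B> T" "f \<cdot> g = idt \<B> (A \<boxplus> C)"
    using iso_morE
    by metis
  let ?i = "g \<cdot> in1 \<B> A C" and ?p = "pr1 \<B> A C \<cdot> f" and ?j = "g \<cdot> in2 \<B> A C" and ?q = "pr2 \<B> A C \<cdot> f"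
  have s: "?i \<cdot> ?p \<oplus>\<^bsub>Hom \<B> T T\<^esub> ?j \<cdot> ?q = g \<cdot> f" by (rule biprod_expand_left[OF biprod_dsum f(2,1), symmetric])
  have "biprod \<B> A C T ?i ?p ?j ?q" unfolding biprod_def
    using cmp_mid_idt[OF in1_closed f(2,1) pr1_closed f(4)] cmp_mid_idt[OF in1_closed f(2,1) pr2_closed f(4)]
      cmp_mid_idt[OF in2_closed f(2,1) pr1_closed f(4)] cmp_mid_idt[OF in2_closed f(2,1) pr2_closed f(4)]
      cmp_closed[OF in1_closed f(2)] cmp_closed[OF in2_closed f(2)] cmp_closed[OF f(1) pr1_closed] cmp_closed[OF
        f(1) pr2_closed]
    by (simp only: pr1_in1 pr2_in1 pr1_in2 pr2_in2 s f(3) simp_thms)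
  then show ?thesis by blast
qed

lemma retract_dsum_mono: assumes "retract \<B> A A'" "retract \<B> C C'" shows "retract \<B> (A \<boxplus> C) (A' \<boxplus> C')"
proof -
  obtain i p where i: "i \<in> arr A A'" "p \<in> arr A' A" "p \<cdot> i = idt \<B> A"
    using assms(1)
    unfolding retract_def
    by blast
  obtain j q where j: "j \<in> arr C C'" "q \<in> arr C' C" "q \<cdot> j = idt \<B> C"
    using assms(2)
    unfolding retract_def
    by blast
  note d = biprod_dsum[of A C]
  have 1: "in1 \<B> A C \<cdot> p \<cdot> (i \<cdot> pr1 \<B> A C) = in1 \<B> A C \<cdot> pr1 \<B> A C"
    by (rule cmp_mid_idt[OF pr1_closed i(1,2) in1_closed i(3)])
  have 2: "in2 \<B> A C \<cdot> q \<cdot> (j \<cdot> pr2 \<B> A C) = in2 \<B> A C \<cdot> pr2 \<B> A C"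
    by (rule cmp_mid_idt[OF pr2_closed j(1,2) in2_closed j(3)])
  show ?thesis
    by (rule retract_sum[OF cmp_closed[OF i(2) in1_closed] cmp_closed[OF j(2) in2_closed]
        cmp_closed[OF pr1_closed i(1)] cmp_closed[OF pr2_closed j(1)]]) (simp add: 1 2 in_pr_sum)
qed

text \<open>Brings an inner summand to the front: A + (A' + C') is regrouped as A' + (A + C').
  Combined with \<open>biprod_swap\<close>, this one regrouping yields the others that are
  needed.\<close>

lemma biprod_assoc: assumes b: "biprod \<B> A C T i p j q" and b': "biprod \<B> A' C' C i' p' j' q'"
  shows "biprod \<B> A' (A \<boxplus> C') T (j \<cdot> i') (p' \<cdot> q)
    (i \<cdot> pr1 \<B> A C' \<oplus>\<^bsub>Hom \<B> (A \<boxplus> C') T\<^esub> j \<cdot> j' \<cdot> pr2 \<B> A C') (in1 \<B> A C' \<cdot> p \<oplus>\<^bsub>Hom \<B> T (A \<boxplus> C')\<^esub> in2 \<B> A C' \<cdot>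
      (q' \<cdot> q))"
proof -
  note u = b[unfolded biprod_def] and u' = b'[unfolded biprod_def]
  have t: "i \<in> arr A T" "p \<in> arr T A" "j \<in> arr C T" "q \<in> arr T C" using u by auto
  have t': "i' \<in> arr A' C" "p' \<in> arr C A'" "j' \<in> arr C' C" "q' \<in> arr C C'" using u' by auto
  have c: "j \<cdot> j' \<in> arr C' T" "q' \<cdot> q \<in> arr T C'" "j \<cdot> i' \<in> arr A' T" "p' \<cdot> q \<in> arr T A'"
    using t t' cmp_closed by auto
  note d = biprod_dsum[of A C']
  let ?j = "i \<cdot> pr1 \<B> A C' \<oplus>\<^bsub>Hom \<B> (A \<boxplus> C') T\<^esub> j \<cdot> j' \<cdot> pr2 \<B> A C'"
  let ?q = "in1 \<B> A C' \<cdot> p \<oplus>\<^bsub>Hom \<B> T (A \<boxplus> C')\<^esub> in2 \<B> A C' \<cdot> (q' \<cdot> q)"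
  have jc: "?j \<in> arr (A \<boxplus> C') T" and qc: "?q \<in> arr T (A \<boxplus> C')"
    by (rule biprod_mor_out(1)[OF d t(1) c(1)], rule biprod_mor_in(1)[OF d t(2) c(2)])
  have x1: "p' \<cdot> q \<cdot> (j \<cdot> i') = idt \<B> A'" using cmp_mid_idt[OF t'(1) t(3) t(4) t'(2)] u u' by simp
  have sum: "j \<cdot> i' \<cdot> (p' \<cdot> q) \<oplus>\<^bsub>Hom \<B> T T\<^esub> ?j \<cdot> ?q = idt \<B> T"
  proof -
    have e1: "?j \<cdot> ?q = i \<cdot> p \<oplus>\<^bsub>Hom \<B> T T\<^esub> j \<cdot> j' \<cdot> (q' \<cdot> q)"
      by (rule biprod_mor_comp[OF d t(1) c(1) t(2) c(2)])
    have e2: "j \<cdot> q = j \<cdot> i' \<cdot> (p' \<cdot> q) \<oplus>\<^bsub>Hom \<B> T T\<^esub> j \<cdot> j' \<cdot> (q' \<cdot> q)"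
      by (rule biprod_expand_left[OF b' t(3,4)])
    have k: "i \<cdot> p \<in> arr T T" "j \<cdot> i' \<cdot> (p' \<cdot> q) \<in> arr T T" "j \<cdot> j' \<cdot> (q' \<cdot> q) \<in> arr T T"
      using cmp_closed t c by auto
    have "j \<cdot> i' \<cdot> (p' \<cdot> q) \<oplus>\<^bsub>Hom \<B> T T\<^esub> (i \<cdot> p \<oplus>\<^bsub>Hom \<B> T T\<^esub> j \<cdot> j' \<cdot> (q' \<cdot> q)) = i \<cdot> p \<oplus>\<^bsub>Hom \<B> T T\<^esub> (j \<cdot> i' \<cdot>
      (p' \<cdot> q) \<oplus>\<^bsub>Hom \<B> T T\<^esub> j \<cdot> j' \<cdot> (q' \<cdot> q))"
      using add_assoc[OF k(2) k(1) k(3)] add_assoc[OF k(1) k(2) k(3)] add_comm[OF k(1,2)] by simp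
    then show ?thesis using u e1 e2 by simp
  qed
  have y1: "p \<cdot> (j \<cdot> i') = zmor A' A" using assoc_right[OF t'(1) t(3,2)] u t' by (simp add: zero_cmp)
  have y2: "q' \<cdot> q \<cdot> (j \<cdot> i') = zmor A' C'" using cmp_mid_idt[OF t'(1) t(3,4) t'(4)] u u' by simp
  have z1: "p' \<cdot> q \<cdot> i = zmor A A'" using assoc_right[OF t(1,4) t'(2)] u t' by (simp add: cmp_zero)
  have z2: "p' \<cdot> q \<cdot> (j \<cdot> j') = zmor C' A'" using cmp_mid_idt[OF t'(3) t(3,4) t'(2)] u u' by simp
  have w2: "?q \<cdot> (j \<cdot> i') = zmor A' (A \<boxplus> C')"
  proof -
    have "?q \<cdot> (j \<cdot> i') = in1 \<B> A C' \<cdot> p \<cdot> (j \<cdot> i') \<oplus>\<^bsub>Hom \<B> A' (A \<boxplus> C')\<^esub> in2 \<B> A C' \<cdot> (q' \<cdot> q) \<cdot> (j \<cdot> i')"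
      by (rule cmp_add_left[OF c(3) cmp_closed[OF t(2) in1_closed] cmp_closed[OF c(2) in2_closed]])
    then show ?thesis
      using assoc_right[OF c(3) t(2) in1_closed, of C'] assoc_right[OF c(3) c(2) in2_closed, of A] y1 y2
      by (simp add: cmp_zero[OF in1_closed] cmp_zero[OF in2_closed] zero_add[OF zero_closed])
  qed
  have w1: "p' \<cdot> q \<cdot> ?j = zmor (A \<boxplus> C') A'"
  proof -
    have "p' \<cdot> q \<cdot> ?j = p' \<cdot> q \<cdot> (i \<cdot> pr1 \<B> A C') \<oplus>\<^bsub>Hom \<B> (A \<boxplus> C') A'\<^esub> p' \<cdot> q \<cdot> (j \<cdot> j' \<cdot> pr2 \<B> A C')"
      by (rule cmp_add_right[OF cmp_closed[OF pr1_closed t(1)] cmp_closed[OF pr2_closed c(1)] c(4)])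
    then show ?thesis
      using cmp_assoc[OF pr1_closed t(1) c(4), of C'] cmp_assoc[OF pr2_closed c(1) c(4), of A] z1 z2
      by (simp add: zero_cmp[OF pr1_closed] zero_cmp[OF pr2_closed] zero_add[OF zero_closed])
  qed
  have v: "?q \<cdot> ?j = idt \<B> (A \<boxplus> C')"
  proof -
    have 1: "?q \<cdot> i = in1 \<B> A C'"
    proof -
      have "q' \<cdot> q \<cdot> i = zmor A C'" using assoc_right[OF t(1,4) t'(4)] u t' by (simp add: cmp_zero)
      then show ?thesis
        using cmp_add_left[OF t(1) cmp_closed[OF t(2) in1_closed] cmp_closed[OF c(2) in2_closed]]
          assoc_right[OF t(1,2) in1_closed, of C'] assoc_right[OF t(1) c(2) in2_closed, of A] u
        by (simp add: cmp_zero[OF in2_closed] cmp_idt_right[OF in1_closed] add_zero[OF in1_closed])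
    qed
    have 2: "?q \<cdot> (j \<cdot> j') = in2 \<B> A C'"
    proof -
      have "q' \<cdot> q \<cdot> (j \<cdot> j') = idt \<B> C'" using cmp_mid_idt[OF t'(3) t(3,4) t'(4)] u u' by simp
      moreover have "p \<cdot> (j \<cdot> j') = zmor C' A" using assoc_right[OF t'(3) t(3,2)] u t' by (simp add: zero_cmp)
      ultimately show ?thesis
        using cmp_add_left[OF c(1) cmp_closed[OF t(2) in1_closed] cmp_closed[OF c(2) in2_closed]]
          assoc_right[OF c(1) t(2) in1_closed, of C'] assoc_right[OF c(1) c(2) in2_closed, of A] u
        by (simp add: cmp_zero[OF in1_closed] cmp_idt_right[OF in2_closed] zero_add[OF in2_closed])
    qed
    have "?q \<cdot> ?j = ?q \<cdot> (i \<cdot> pr1 \<B> A C') \<oplus>\<^bsub>Hom \<B> (A \<boxplus> C') (A \<boxplus> C')\<^esub> ?q \<cdot> (j \<cdot> j' \<cdot> pr2 \<B> A C')"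
      by (rule cmp_add_right[OF cmp_closed[OF pr1_closed t(1)] cmp_closed[OF pr2_closed c(1)] qc])
    then show ?thesis
      using cmp_assoc[OF pr1_closed t(1) qc] cmp_assoc[OF pr2_closed c(1) qc] 1 2 in_pr_sum
      by simp
  qed
  show ?thesis unfolding biprod_def using c jc qc x1 v w1 w2 sum by simp
qed

text \<open>In ring terms: if 1 - ba has inverse s, then 1 - ab has inverse 1 + asb. The ideal
  properties of \<open>radical\<close> and the splitting of non-radical maps rest on this.\<close>

lemma jacobson_swap: assumes a: "a \<in> arr A C" and b: "b \<in> arr C A" and u: "u \<in> iso_mor \<B> A A" and v: "v \<in> arr C
  C"
    and eu: "u \<oplus>\<^bsub>Hom \<B> A A\<^esub> b \<cdot> a = idt \<B> A" and ev: "v \<oplus>\<^bsub>Hom \<B> C C\<^esub> a \<cdot> b = idt \<B> C"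
  shows "v \<in> iso_mor \<B> C C"
proof -
  obtain s where s: "u \<in> arr A A" "s \<in> arr A A" "s \<cdot> u = idt \<B> A" "u \<cdot> s = idt \<B> A"
    using iso_morE[OF u]
    by metis
  have ba: "b \<cdot> a \<in> arr A A" and ab: "a \<cdot> b \<in> arr C C" and sb: "s \<cdot> b \<in> arr C A" and as: "a \<cdot> s \<in> arr A C"
    using a b s cmp_closed by auto
  have asb: "a \<cdot> s \<cdot> b \<in> arr C C" using as b cmp_closed by auto
  let ?w = "idt \<B> C \<oplus>\<^bsub>Hom \<B> C C\<^esub> a \<cdot> s \<cdot> b"
  have w: "?w \<in> arr C C" by (rule add_closed[OF idt_closed asb])
  \<comment> \<open>Multiplying 1 = u + ba by \<open>s\<close> on either side gives s = 1 + bas = 1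
    + sba. These two forms reduce both ab(1 + asb) and (1 + asb)ab to asb.\<close>
  have s1: "s = idt \<B> A \<oplus>\<^bsub>Hom \<B> A A\<^esub> b \<cdot> a \<cdot> s"
  proof -
    have "s = (u \<oplus>\<^bsub>Hom \<B> A A\<^esub> b \<cdot> a) \<cdot> s" using eu cmp_idt_left[OF s(2)] by simp
    then show ?thesis using cmp_add_left[OF s(2) s(1) ba] s(4) by simp
  qed
  have s2: "s = idt \<B> A \<oplus>\<^bsub>Hom \<B> A A\<^esub> s \<cdot> (b \<cdot> a)"
  proof -
    have "s = s \<cdot> (u \<oplus>\<^bsub>Hom \<B> A A\<^esub> b \<cdot> a)" using eu cmp_idt_right[OF s(2)] by simp
    then show ?thesis using cmp_add_right[OF s(1) ba s(2)] s(3) by simp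
  qed
  have abw: "a \<cdot> b \<cdot> ?w = a \<cdot> s \<cdot> b"
  proof -
    have "a \<cdot> b \<cdot> ?w = a \<cdot> b \<oplus>\<^bsub>Hom \<B> C C\<^esub> a \<cdot> b \<cdot> (a \<cdot> s \<cdot> b)"
      using cmp_add_right[OF idt_closed asb ab] cmp_idt_right[OF ab] by simp
    also have "a \<cdot> b \<cdot> (a \<cdot> s \<cdot> b) = a \<cdot> (b \<cdot> a \<cdot> s) \<cdot> b"
      using cmp4[OF b as b a] assoc_right[OF b s(2) a] cmp_assoc[OF s(2) a b] cmp_assoc[OF b cmp_closed[OF s(2)
        ba] a]
        cmp_closed[OF sb a] cmp_assoc[OF sb a b] assoc_right[OF sb a b] cmp_assoc[OF b s(2) ba]
      by (metis a ab asb b ba cmp_assoc cmp_closed s(2))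
    also have "a \<cdot> b \<oplus>\<^bsub>Hom \<B> C C\<^esub> a \<cdot> (b \<cdot> a \<cdot> s) \<cdot> b = a \<cdot> (idt \<B> A \<oplus>\<^bsub>Hom \<B> A A\<^esub> b \<cdot> a \<cdot> s) \<cdot> b"
      using cmp_add_right[OF idt_closed cmp_closed[OF s(2) ba] a] cmp_idt_right[OF a]
        cmp_add_left[OF b a cmp_closed[OF cmp_closed[OF s(2) ba] a]] by simp
    finally show ?thesis using s1 by simp
  qed
  have wab: "?w \<cdot> (a \<cdot> b) = a \<cdot> s \<cdot> b"
  proof -
    have "?w \<cdot> (a \<cdot> b) = a \<cdot> b \<oplus>\<^bsub>Hom \<B> C C\<^esub> a \<cdot> s \<cdot> b \<cdot> (a \<cdot> b)"
      using cmp_add_left[OF ab idt_closed asb] cmp_idt_left[OF ab] by simp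
    also have "a \<cdot> s \<cdot> b \<cdot> (a \<cdot> b) = a \<cdot> (s \<cdot> (b \<cdot> a)) \<cdot> b"
      using cmp4[OF b a b as] cmp_assoc[OF ba s(2) a] cmp_assoc[OF b ba as] cmp_assoc[OF b a b] by simp
    also have "a \<cdot> b \<oplus>\<^bsub>Hom \<B> C C\<^esub> a \<cdot> (s \<cdot> (b \<cdot> a)) \<cdot> b = a \<cdot> (idt \<B> A \<oplus>\<^bsub>Hom \<B> A A\<^esub> s \<cdot> (b \<cdot> a)) \<cdot> b"
      using cmp_add_right[OF idt_closed cmp_closed[OF ba s(2)] a] cmp_idt_right[OF a]
        cmp_add_left[OF b a cmp_closed[OF cmp_closed[OF ba s(2)] a]] by simp
    finally show ?thesis using s2 by simp
  qed
  have vw: "v \<cdot> ?w = idt \<B> C"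
  proof -
    have "v \<cdot> ?w \<oplus>\<^bsub>Hom \<B> C C\<^esub> a \<cdot> s \<cdot> b = idt \<B> C \<oplus>\<^bsub>Hom \<B> C C\<^esub> a \<cdot> s \<cdot> b"
      using cmp_add_left[OF w v ab] ev abw cmp_idt_left[OF w] by simp
    then show ?thesis
      using add_cancel[OF asb cmp_closed[OF w v] idt_closed] add_comm[OF asb] cmp_closed[OF w v] idt_closed
        by metis
  qed
  have wv: "?w \<cdot> v = idt \<B> C"
  proof -
    have "?w \<cdot> v \<oplus>\<^bsub>Hom \<B> C C\<^esub> a \<cdot> s \<cdot> b = idt \<B> C \<oplus>\<^bsub>Hom \<B> C C\<^esub> a \<cdot> s \<cdot> b"
      using cmp_add_right[OF v ab w] ev wab cmp_idt_right[OF w] by simp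
    then show ?thesis
      using add_cancel[OF asb cmp_closed[OF v w] idt_closed] add_comm[OF asb] cmp_closed[OF v w] idt_closed
        by metis
  qed
  show ?thesis by (rule iso_morI[OF v w wv vw])
qed

section \<open>The radical as an ideal, and objects with local endomorphism ring\<close>

lemma radical_arr: "g \<in> radical \<B> A C \<Longrightarrow> g \<in> arr A C"
  unfolding radical_def by blast

lemma radicalD: "\<lbrakk>g \<in> radical \<B> A C; k \<in> arr C A; u \<in> arr A A; u \<oplus>\<^bsub>Hom \<B> A A\<^esub> k \<cdot> g = idt \<B> A\<rbrakk> \<Longrightarrow> u \<in> iso_mor \<B> A
  A"
  unfolding radical_def by blast

lemma radical_zero: "zmor A C \<in> radical \<B> A C"
  unfolding radical_def using zero_closed cmp_zero add_zero iso_mor_idt by fastforce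

lemma radical_left: assumes g: "g \<in> radical \<B> A C" and l: "l \<in> arr C D" shows "l \<cdot> g \<in> radical \<B> A D"
  unfolding radical_def mem_Collect_eq
proof (intro conjI ballI impI)
  show "l \<cdot> g \<in> arr A D" by (rule cmp_closed[OF radical_arr[OF g] l])
  fix k u assume k: "k \<in> arr D A" and u: "u \<in> arr A A" "u \<oplus>\<^bsub>Hom \<B> A A\<^esub> k \<cdot> (l \<cdot> g) = idt \<B> A"
  show "u \<in> iso_mor \<B> A A"
    by (rule radicalD[OF g cmp_closed[OF l k] u(1)]) (simp add: assoc_right[OF radical_arr[OF g] l k] u)
qed

text \<open>The unit test at \<open>Z\<close> becomes one at \<open>A\<close>: by
  \<open>jacobson_swap\<close>, 1 - (kg)l is invertible once 1 - l(kg) is.\<close>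

lemma radical_right: assumes g: "g \<in> radical \<B> A C" and l: "l \<in> arr Z A" shows "g \<cdot> l \<in> radical \<B> Z C"
  unfolding radical_def mem_Collect_eq
proof (intro conjI ballI impI)
  note g' = radical_arr[OF g]
  show "g \<cdot> l \<in> arr Z C" by (rule cmp_closed[OF l g'])
  fix k u assume k: "k \<in> arr C Z" and u: "u \<in> arr Z Z" "u \<oplus>\<^bsub>Hom \<B> Z Z\<^esub> k \<cdot> (g \<cdot> l) = idt \<B> Z"
  have kg: "k \<cdot> g \<in> arr A Z" by (rule cmp_closed[OF g' k])
  obtain v where v: "v \<in> arr A A" "v \<oplus>\<^bsub>Hom \<B> A A\<^esub> l \<cdot> (k \<cdot> g) = idt \<B> A"
    using complement[OF cmp_closed[OF kg l] idt_closed]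
    by blast
  have "v \<in> iso_mor \<B> A A" by (rule radicalD[OF g cmp_closed[OF k l] v(1)]) (simp add: assoc_right[OF g' k l] v)
  then show "u \<in> iso_mor \<B> Z Z"
    by (rule jacobson_swap[OF kg l _ u(1) v(2)]) (simp add: assoc_right[OF l g' k] u)
qed

lemma radical_add: assumes g: "g \<in> radical \<B> A C" and h: "h \<in> radical \<B> A C" shows "g \<oplus>\<^bsub>Hom \<B> A C\<^esub> h \<in> radical \<B>
  A C"
  unfolding radical_def mem_Collect_eq
proof (intro conjI ballI impI)
  note g' = radical_arr[OF g] and h' = radical_arr[OF h]
  show "g \<oplus>\<^bsub>Hom \<B> A C\<^esub> h \<in> arr A C" by (rule add_closed[OF g' h'])
  fix k u assume k: "k \<in> arr C A" and u: "u \<in> arr A A" "u \<oplus>\<^bsub>Hom \<B> A A\<^esub> k \<cdot> (g \<oplus>\<^bsub>Hom \<B> A C\<^esub> h) = idt \<B> A"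
  have kg: "k \<cdot> g \<in> arr A A" and kh: "k \<cdot> h \<in> arr A A" using cmp_closed g' h' k by auto
  \<comment> \<open>\<open>?v\<close> is 1 - kg, hence a unit; dividing by it leaves a condition on
    \<open>h\<close> alone.\<close>
  let ?v = "u \<oplus>\<^bsub>Hom \<B> A A\<^esub> k \<cdot> h"
  have v: "?v \<in> arr A A" by (rule add_closed[OF u(1) kh])
  have "?v \<oplus>\<^bsub>Hom \<B> A A\<^esub> k \<cdot> g = idt \<B> A"
    using u(2) cmp_add_right[OF g' h' k] add_assoc[OF u(1) kh kg] add_comm[OF kg kh] by simp
  then have vi: "?v \<in> iso_mor \<B> A A" by (rule radicalD[OF g k v])
  then obtain s where s: "s \<in> arr A A" "s \<cdot> ?v = idt \<B> A" "?v \<cdot> s = idt \<B> A" "s \<in> iso_mor \<B> A A"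
    using iso_morE
    by metis
  have "s \<cdot> u \<oplus>\<^bsub>Hom \<B> A A\<^esub> s \<cdot> k \<cdot> h = idt \<B> A"
    using s(2) cmp_add_right[OF u(1) kh s(1)] cmp_assoc[OF h' k s(1)]
    by simp
  then have "s \<cdot> u \<in> iso_mor \<B> A A" by (rule radicalD[OF h cmp_closed[OF k s(1)] cmp_closed[OF u(1) s(1)]])
  then have "?v \<cdot> (s \<cdot> u) \<in> iso_mor \<B> A A" using iso_mor_cmp vi by blast
  then show "u \<in> iso_mor \<B> A A" using cmp_assoc[OF u(1) s(1) v] s(3) cmp_idt_left[OF u(1)] by simp
qed

lemma local_objD: "\<lbrakk>local_obj \<B> A; f \<in> arr A A; g \<in> arr A A; f \<oplus>\<^bsub>Hom \<B> A A\<^esub> g = idt \<B> A\<rbrakk> \<Longrightarrow> f \<in> iso_mor \<B> A A \<or> g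
  \<in> iso_mor \<B> A A"
  unfolding local_obj_def by blast

lemma local_obj_nonzero: "local_obj \<B> A \<Longrightarrow> idt \<B> A \<noteq> zmor A A"
  unfolding local_obj_def by blast

text \<open>If 1 - kg is not a unit over \<open>T\<close>, then by \<open>jacobson_swap\<close> 1 -
  gk is not a unit over \<open>A\<close>. Locality makes gk a unit, so \<open>g\<close> has a
  section.\<close>

lemma local_obj_not_radical: assumes A: "local_obj \<B> A" and g: "g \<in> arr T A" "g \<notin> radical \<B> T A"
  shows "\<exists>l\<in>arr A T. g \<cdot> l = idt \<B> A"
proof -
  obtain k u where k: "k \<in> arr A T" "u \<in> arr T T" "u \<oplus>\<^bsub>Hom \<B> T T\<^esub> k \<cdot> g = idt \<B> T" "u \<notin> iso_mor \<B> T T"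
    using g unfolding radical_def by blast
  have gk: "g \<cdot> k \<in> arr A A" by (rule cmp_closed[OF k(1) g(1)])
  obtain v where v: "v \<in> arr A A" "v \<oplus>\<^bsub>Hom \<B> A A\<^esub> g \<cdot> k = idt \<B> A" using complement[OF gk idt_closed] by blast
  have "v \<notin> iso_mor \<B> A A" using jacobson_swap[OF k(1) g(1) _ k(2) v(2) k(3)] k(4) by blast
  then have "g \<cdot> k \<in> iso_mor \<B> A A" using local_objD[OF A v(1) gk v(2)] by blast
  then obtain s where s: "s \<in> arr A A" "g \<cdot> k \<cdot> s = idt \<B> A" using iso_morE by metis
  show ?thesis using cmp_closed[OF s(1) k(1)] cmp_assoc[OF s(1) k(1) g(1)] s(2) by auto
qed

lemma idempotent_compl: assumes e: "e \<in> arr A A" "e \<cdot> e = e" and g: "g \<in> arr A A" "g \<oplus>\<^bsub>Hom \<B> A A\<^esub> e = idt \<B> A"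
  shows "e \<cdot> g = zmor A A" "g \<cdot> e = zmor A A" "g \<cdot> g = g"
proof -
  have "e \<cdot> g \<oplus>\<^bsub>Hom \<B> A A\<^esub> e = e" using cmp_add_right[OF g(1) e(1) e(1)] g(2) e cmp_idt_right[OF e(1)] by simp
  then show *: "e \<cdot> g = zmor A A"
    using zero_unique[OF e(1) _ cmp_closed[OF g(1) e(1)]] add_comm[OF e(1) cmp_closed[OF g(1) e(1)]]
    by simp
  have "g \<cdot> e \<oplus>\<^bsub>Hom \<B> A A\<^esub> e = e" using cmp_add_left[OF e(1) g(1) e(1)] g(2) e cmp_idt_left[OF e(1)] by simp
  then show "g \<cdot> e = zmor A A"
    using zero_unique[OF e(1) _ cmp_closed[OF e(1) g(1)]] add_comm[OF e(1) cmp_closed[OF e(1) g(1)]]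
    by simp
  have "g = (g \<oplus>\<^bsub>Hom \<B> A A\<^esub> e) \<cdot> g" using g cmp_idt_left by simp
  also have "... = g \<cdot> g" using cmp_add_left[OF g(1) g(1) e(1)] * add_zero[OF cmp_closed[OF g(1) g(1)]] by simp
  finally show "g \<cdot> g = g" by simp
qed

lemma idempotent_iso: assumes e: "e \<in> iso_mor \<B> A A" "e \<cdot> e = e" shows "e = idt \<B> A"
proof -
  obtain s where s: "e \<in> arr A A" "s \<in> arr A A" "s \<cdot> e = idt \<B> A" using iso_morE[OF e(1)] by metis
  then show ?thesis using cmp_assoc[OF s(1,1,2)] e(2) cmp_idt_left[OF s(1)] by simp
qed

lemma local_obj_idempotent: assumes A: "local_obj \<B> A" and e: "e \<in> arr A A" "e \<cdot> e = e"
  shows "e = zmor A A \<or> e = idt \<B> A"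
proof -
  obtain g where g: "g \<in> arr A A" "g \<oplus>\<^bsub>Hom \<B> A A\<^esub> e = idt \<B> A" using complement[OF e(1) idt_closed] by blast
  note i = idempotent_compl[OF e g]
  consider "e \<in> iso_mor \<B> A A" | "g \<in> iso_mor \<B> A A" using local_objD[OF A g(1) e(1) g(2)] by blast
  then show ?thesis
  proof cases
    case 1 then show ?thesis using idempotent_iso e by blast
  next
    case 2 then have "g = idt \<B> A" using idempotent_iso i by blast
    then show ?thesis using i(1) cmp_idt_right[OF e(1)] by simp
  qed
qed

text \<open>The idempotent \<open>i \<cdot> p\<close> of a local object is 0 or 1, and 0 would force
  the identity of \<open>A\<close> to vanish.\<close>

lemma local_obj_retract_iso: assumes C: "local_obj \<B> C" and A: "idt \<B> A \<noteq> zmor A A"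
    and i: "i \<in> arr A C" "p \<in> arr C A" "p \<cdot> i = idt \<B> A"
  shows "i \<cdot> p = idt \<B> C"
proof -
  have ip: "i \<cdot> p \<in> arr C C" by (rule cmp_closed[OF i(2,1)])
  have "i \<cdot> p \<cdot> (i \<cdot> p) = i \<cdot> p" by (rule cmp_mid_idt[OF i(2,1,2,1,3)])
  then consider "i \<cdot> p = zmor C C" | "i \<cdot> p = idt \<B> C" using local_obj_idempotent[OF C ip] by blast
  then show ?thesis
  proof cases
    case 1
    have "p \<cdot> i = p \<cdot> (i \<cdot> p \<cdot> i)" using assoc_right[OF i(1,2,1)] i(3) cmp_idt_right[OF i(1)] by simp
    then have "idt \<B> A = zmor A A" using 1 i zero_cmp[OF i(1)] cmp_zero[OF i(2)] by simp
    then show ?thesis using A by simp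
  qed
qed

lemma local_obj_retract_isomorphic: "\<lbrakk>local_obj \<B> C; idt \<B> A \<noteq> zmor A A; retract \<B> A C\<rbrakk> \<Longrightarrow> isomorphic \<B> A C"
  unfolding retract_def using local_obj_retract_iso isomorphicI by metis

lemma local_obj_split: assumes C: "local_obj \<B> C" and i: "i \<in> arr C Z" "p \<in> arr Z C" and e: "p \<cdot> i \<in> iso_mor \<B> C
  C"
  shows "retract \<B> C Z"
proof -
  obtain s where s: "s \<in> arr C C" "s \<cdot> (p \<cdot> i) = idt \<B> C" using iso_morE[OF e] by metis
  show ?thesis by (rule retractI[OF i(1) cmp_closed[OF i(2) s(1)]]) (simp add: assoc_right[OF i s(1)] s(2))
qed

lemma local_obj_retract_dsum: assumes Z: "local_obj \<B> Z" and r: "retract \<B> Z (A \<boxplus> C)" shows "retract \<B> Z A \<or>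
  retract \<B> Z C"
proof -
  obtain i p where i: "i \<in> arr Z (A \<boxplus> C)" "p \<in> arr (A \<boxplus> C) Z" "p \<cdot> i = idt \<B> Z"
    using r
    unfolding retract_def
    by blast
  have c: "pr1 \<B> A C \<cdot> i \<in> arr Z A" "pr2 \<B> A C \<cdot> i \<in> arr Z C" "p \<cdot> in1 \<B> A C \<in> arr A Z" "p \<cdot> in2 \<B> A C \<in> arr C
    Z"
    using i by (auto intro: arr_intros)
  have "p \<cdot> in1 \<B> A C \<cdot> (pr1 \<B> A C \<cdot> i) \<oplus>\<^bsub>Hom \<B> Z Z\<^esub> p \<cdot> in2 \<B> A C \<cdot> (pr2 \<B> A C \<cdot> i) = idt \<B> Z"
    using biprod_expand_left[OF biprod_dsum i(2,1)] i(3) by simp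
  then have "p \<cdot> in1 \<B> A C \<cdot> (pr1 \<B> A C \<cdot> i) \<in> iso_mor \<B> Z Z \<or> p \<cdot> in2 \<B> A C \<cdot> (pr2 \<B> A C \<cdot> i) \<in> iso_mor \<B> Z Z"
    by (rule local_objD[OF Z cmp_closed[OF c(1,3)] cmp_closed[OF c(2,4)]])
  then show ?thesis using local_obj_split[OF Z c(1,3)] local_obj_split[OF Z c(2,4)] by blast
qed

lemma local_obj_iso_transport: assumes A: "local_obj \<B> A" and i: "isomorphic \<B> A C" shows "local_obj \<B> C"
proof -
  obtain f where "f \<in> iso_mor \<B> A C" using i unfolding isomorphic_def by blast
  then obtain g where f: "f \<in> arr A C" "g \<in> arr C A" "g \<cdot> f = idt \<B> A" "f \<cdot> g = idt \<B> C" "f \<in> iso_mor \<B> A C" "g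
    \<in> iso_mor \<B> C A"
    using iso_morE by metis
  have reflect: "h \<in> iso_mor \<B> C C" if h: "h \<in> arr C C" "g \<cdot> h \<cdot> f \<in> iso_mor \<B> A A" for h
  proof -
    have gh: "g \<cdot> h \<in> arr C A" by (rule cmp_closed[OF h(1) f(2)])
    have "f \<cdot> (g \<cdot> h \<cdot> f) \<cdot> g = h"
      using assoc_right[OF f(2,1) gh] cmp_assoc[OF cmp_closed[OF f(1) gh] f(1)] f cmp_assoc[OF h(1) f(2,1)]
        cmp_idt_right[OF gh]
        cmp_idt_left[OF h(1)] cmp_assoc[OF f(2) cmp_closed[OF f(1) gh] f(1)] by simp
    then show ?thesis using iso_mor_cmp[OF f(6) iso_mor_cmp[OF h(2) f(5)]] by simp
  qed
  have "idt \<B> C \<noteq> zmor C C"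
  proof
    assume "idt \<B> C = zmor C C"
    then have "f = zmor A C" using cmp_idt_left[OF f(1)] zero_cmp[OF f(1)] by metis
    then have "idt \<B> A = zmor A A" using f(3) cmp_zero[OF f(2)] by simp
    then show False using local_obj_nonzero[OF A] by simp
  qed
  moreover have "h \<in> iso_mor \<B> C C \<or> k \<in> iso_mor \<B> C C" if h: "h \<in> arr C C" "k \<in> arr C C" "h \<oplus>\<^bsub>Hom \<B> C C\<^esub> k =
    idt \<B> C" for h k
  proof -
    have gh: "g \<cdot> h \<in> arr C A" "g \<cdot> k \<in> arr C A" using cmp_closed h f by auto
    have "g \<cdot> h \<cdot> f \<oplus>\<^bsub>Hom \<B> A A\<^esub> g \<cdot> k \<cdot> f = g \<cdot> (h \<oplus>\<^bsub>Hom \<B> C C\<^esub> k) \<cdot> f"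
      using cmp_add_right[OF h(1,2) f(2)] cmp_add_left[OF f(1) gh] by simp
    then have "g \<cdot> h \<cdot> f \<oplus>\<^bsub>Hom \<B> A A\<^esub> g \<cdot> k \<cdot> f = idt \<B> A" using h(3) f cmp_idt_right[OF f(2)] by simp
    then have "g \<cdot> h \<cdot> f \<in> iso_mor \<B> A A \<or> g \<cdot> k \<cdot> f \<in> iso_mor \<B> A A"
      by (rule local_objD[OF A cmp_closed[OF f(1) gh(1)] cmp_closed[OF f(1) gh(2)]])
    then show ?thesis using reflect h by blast
  qed
  ultimately show ?thesis unfolding local_obj_def by blast
qed

text \<open>\<open>k \<cdot> h\<close> is the sum of its passages through the local summands of
  \<open>T\<close>, and \<open>radical\<close> is closed under sums, so one passage is not radical.
  \<open>biprod_assoc\<close> moves that summand to the front, leaving a complement with one local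
  summand fewer.\<close>

lemma local_decomp_select:
  "\<lbrakk>local_decomp \<B> n T; h \<in> arr Z T; k \<in> arr T Z'; k \<cdot> h \<notin> radical \<B> Z Z'\<rbrakk> \<Longrightarrow>
    \<exists>m A C i p j q. n = Suc m \<and> biprod \<B> A C T i p j q \<and> local_obj \<B> A \<and> local_decomp \<B> m C \<and> k \<cdot> i \<cdot> (p \<cdot> h) \<notin>
      radical \<B> Z Z'"
proof (induction n arbitrary: T h k)
  case 0
  then have "h = zmor Z T" using cmp_idt_left[OF 0(2)] zero_cmp[OF 0(2)] by simp
  then show ?case using 0 cmp_zero[OF 0(3)] radical_zero by simp
next
  case (Suc n)
  obtain A C i p j q where d: "biprod \<B> A C T i p j q" "local_obj \<B> A" "local_decomp \<B> n C"
    using Suc.prems(1)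
    by auto
  have t: "i \<in> arr A T" "p \<in> arr T A" "j \<in> arr C T" "q \<in> arr T C" using d(1)[unfolded biprod_def] by auto
  show ?case
  proof (cases "k \<cdot> i \<cdot> (p \<cdot> h) \<in> radical \<B> Z Z'")
    case False then show ?thesis using d by blast
  next
    case True
    have "k \<cdot> j \<cdot> (q \<cdot> h) \<notin> radical \<B> Z Z'"
      using Suc.prems(4) radical_add[OF True] biprod_expand_left[OF d(1) Suc.prems(3,2)] by metis
    from Suc.IH[OF d(3) cmp_closed[OF Suc.prems(2) t(4)] cmp_closed[OF t(3) Suc.prems(3)] this]
    obtain m A' C' i' p' j' q' where e: "n = Suc m" "biprod \<B> A' C' C i' p' j' q'" "local_obj \<B> A'"
      "local_decomp \<B> m C'"
      "k \<cdot> j \<cdot> i' \<cdot> (p' \<cdot> (q \<cdot> h)) \<notin> radical \<B> Z Z'" by blast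
    have t': "i' \<in> arr A' C" "p' \<in> arr C A'" using e(2)[unfolded biprod_def] by auto
    have "local_decomp \<B> (Suc m) (A \<boxplus> C')" unfolding local_decomp.simps using biprod_dsum d(2) e(4) by blast
    moreover have "k \<cdot> (j \<cdot> i') \<cdot> (p' \<cdot> q \<cdot> h) \<notin> radical \<B> Z Z'"
      using e(5) cmp_assoc[OF t'(1) t(3) Suc.prems(3)] cmp_assoc[OF Suc.prems(2) t(4) t'(2)] by simp
    ultimately show ?thesis using biprod_assoc[OF d(1) e(2)] e(1,3) by blast
  qed
qed

end

section \<open>Krull--Schmidt decompositions and approximations\<close>

text \<open>Closure under retracts is checked on a single composite, without naming a complement.
  The main use is \<open>add_cl_least\<close>: to prove that all of add U lies in such a class, it
  is enough to look at U.\<close>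

definition addclosed :: "('k, 'o, 'm, 'e) excat \<Rightarrow> 'o set \<Rightarrow> bool"
  where "addclosed \<B> T \<longleftrightarrow> zob \<B> \<in> T \<and> (\<forall>A\<in>T. \<forall>C\<in>T. A \<boxplus>\<^bsub>\<B>\<^esub> C \<in> T) \<and> (\<forall>A C. C \<in> T \<longrightarrow> retract \<B> A C \<longrightarrow> A \<in> T)"

definition right_approx :: "('k, 'o, 'm, 'e) excat \<Rightarrow> 'o set \<Rightarrow> 'o \<Rightarrow> 'o \<Rightarrow> 'm \<Rightarrow> bool"
  where "right_approx \<B> \<T> T X f \<longleftrightarrow> T \<in> \<T> \<and> f \<in> mor \<B> T X \<and>
    (\<forall>T'\<in>\<T>. \<forall>g\<in>mor \<B> T' X. \<exists>h\<in>mor \<B> T' T. f \<cdot>\<^bsub>\<B>\<^esub> h = g)"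

definition left_approx :: "('k, 'o, 'm, 'e) excat \<Rightarrow> 'o set \<Rightarrow> 'o \<Rightarrow> 'o \<Rightarrow> 'm \<Rightarrow> bool"
  where "left_approx \<B> \<T> X T g \<longleftrightarrow> T \<in> \<T> \<and> g \<in> mor \<B> X T \<and>
    (\<forall>T'\<in>\<T>. \<forall>f\<in>mor \<B> X T'. \<exists>h\<in>mor \<B> T T'. h \<cdot>\<^bsub>\<B>\<^esub> g = f)"

context linear_category
begin

lemma zob_null: "idt \<B> (zob \<B>) = zmor (zob \<B>) (zob \<B>)"
  using idt_closed[of "zob \<B>"] zob_terminal by auto

lemma addclosed_retract: "\<lbrakk>addclosed \<B> T; C \<in> T; retract \<B> A C\<rbrakk> \<Longrightarrow> A \<in> T"
  unfolding addclosed_def by blast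

lemma addclosed_dsum: "\<lbrakk>addclosed \<B> T; A \<in> T; C \<in> T\<rbrakk> \<Longrightarrow> A \<boxplus> C \<in> T"
  unfolding addclosed_def by blast

lemma addclosed_biprod: "\<lbrakk>addclosed \<B> T; biprod \<B> A C D i p j q; A \<in> T; C \<in> T\<rbrakk> \<Longrightarrow> D \<in> T"
  using biprod_iso_dsum retract_iso addclosed_retract addclosed_dsum by blast

lemma null_retract: "idt \<B> A = zmor A A \<Longrightarrow> retract \<B> A C"
  by (rule retractI[OF zero_closed zero_closed]) (simp add: cmp_zero[OF zero_closed])

lemma null_mor: assumes "idt \<B> A = zmor A A" shows "f \<in> arr A C \<Longrightarrow> f = zmor A C" "g \<in> arr C A \<Longrightarrow> g = zmor C A"
  using assms cmp_idt_right[of f A C] cmp_zero[of f A C A] cmp_idt_left[of g C A] zero_cmp[of g C A A] by auto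

lemma addclosed_null: "\<lbrakk>addclosed \<B> T; idt \<B> A = zmor A A\<rbrakk> \<Longrightarrow> A \<in> T"
  using addclosed_retract null_retract addclosed_def by metis

lemma biprod_zob: "biprod \<B> A (zob \<B>) A (idt \<B> A) (idt \<B> A) (zmor (zob \<B>) A) (zmor A (zob \<B>))"
  unfolding biprod_def using zob_null by (simp add: idt_closed zero_closed cmp_idt_left[OF idt_closed]
    cmp_zero[OF zero_closed] cmp_idt_left[OF zero_closed] cmp_idt_right[OF zero_closed] add_zero[OF idt_closed])

lemma summand_retract: assumes "summand \<B> X Z" shows "retract \<B> X Z"
  using assms retract_trans[OF retract_dsum1 retract_iso[OF isomorphic_sym]] unfolding summand_def by blast

lemma dsum_list_closed: "\<lbrakk>addclosed \<B> T; set As \<subseteq> T\<rbrakk> \<Longrightarrow> dsum_list \<B> As \<in> T"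
  by (induction As) (auto simp: dsum_list_def addclosed_def)

lemma add_cl_least: assumes T: "addclosed \<B> T" "U \<in> T" shows "add_cl \<B> U \<subseteq> T"
proof
  fix X assume "X \<in> add_cl \<B> U"
  then obtain n where "retract \<B> X (dsum_list \<B> (replicate n U))"
    unfolding add_cl_def
    using summand_retract
    by blast
  moreover have "dsum_list \<B> (replicate n U) \<in> T" by (rule dsum_list_closed[OF T(1)]) (use T(2) in auto)
  ultimately show "X \<in> T" using addclosed_retract[OF T(1)] by blast
qed

lemma zero_object_iff: "zero_object \<B> A \<longleftrightarrow> idt \<B> A = zmor A A"
proof
  assume "zero_object \<B> A"
  then have "isomorphic \<B> A (zob \<B>)" unfolding zero_object_def .
  then obtain i p where i: "i \<in> arr A (zob \<B>)" "p \<in> arr (zob \<B>) A" "p \<cdot> i = idt \<B> A"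
    using retract_iso
    unfolding retract_def
    by blast
  then have "i = zmor A (zob \<B>)" using zob_terminal by auto
  then show "idt \<B> A = zmor A A" using i cmp_zero[OF i(2)] by metis
next
  assume a: "idt \<B> A = zmor A A"
  show "zero_object \<B> A" unfolding zero_object_def
    using a zob_null isomorphicI[OF zero_closed zero_closed, of "zob \<B>" A] cmp_zero[OF zero_closed]
      isomorphic_sym
      by metis
qed

lemma local_decomp_iso: assumes "isomorphic \<B> T T'" "local_decomp \<B> n T" shows "local_decomp \<B> n T'"
proof (cases n)
  case 0
  have "T' \<in> {A. idt \<B> A = zmor A A}"
    using assms 0 zero_object_iff isomorphic_trans[OF isomorphic_sym[OF assms(1)]]
      unfolding zero_object_def
      by auto
  then show ?thesis using 0 by simp
next
  case (Suc m)
  then obtain A C i p j q where d: "biprod \<B> A C T i p j q" "local_obj \<B> A" "local_decomp \<B> m C"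
    using assms(2)
    by auto
  have "isomorphic \<B> T' (A \<boxplus> C)"
    using biprod_iso_dsum[OF d(1)] isomorphic_sym[OF assms(1)] isomorphic_trans
    by blast
  then obtain i p j q where "biprod \<B> A C T' i p j q" using isomorphic_biprod by blast
  then show ?thesis using d(2,3) unfolding Suc local_decomp.simps by blast
qed

lemma local_decomp_dsum_list: "\<forall>A\<in>set As. local_obj \<B> A \<Longrightarrow> local_decomp \<B> (length As) (dsum_list \<B> As)"
proof (induction As)
  case Nil
  show ?case using zob_null by (simp add: dsum_list_def)
next
  case (Cons A As)
  then have "local_decomp \<B> (length As) (dsum_list \<B> As)" "local_obj \<B> A" by auto
  then show ?case
    using biprod_dsum[of A "dsum_list \<B> As"]
    unfolding dsum_list_def foldr.simps o_def list.size local_decomp.simps add_0_right add_Suc_right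
    by blast
qed

lemma local_decomp_closed: "\<lbrakk>local_decomp \<B> n D; addclosed \<B> T; \<And>A. \<lbrakk>local_obj \<B> A; retract \<B> A D\<rbrakk> \<Longrightarrow> A \<in> T\<rbrakk> \<Longrightarrow> D
  \<in> T"
proof (induction n arbitrary: D)
  case 0
  then show ?case using addclosed_null by simp
next
  case (Suc n)
  obtain A C i p j q where d: "biprod \<B> A C D i p j q" "local_obj \<B> A" "local_decomp \<B> n C"
    using Suc.prems(1)
    by auto
  have r: "retract \<B> A D" "retract \<B> C D" using d(1) unfolding biprod_def retract_def by auto
  have "C \<in> T" by (rule Suc.IH[OF d(3) Suc.prems(2)]) (use Suc.prems(3) retract_trans[OF _ r(2)] in blast)
  then show ?case using addclosed_biprod[OF Suc.prems(2) d(1)] Suc.prems(3)[OF d(2) r(1)] by blast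
qed

text \<open>\<open>add_cl_least\<close> is applied to the class of all \<open>T\<close> such that
  \<open>A\<close> is a retract of \<open>U\<close> if it is one of \<open>T\<close>; locality of
  \<open>A\<close> gives closure under direct sums.\<close>

lemma local_obj_retract_add_cl: assumes A: "local_obj \<B> A" "A \<in> add_cl \<B> U" shows "retract \<B> A U"
proof -
  have z: "retract \<B> A U" if r: "retract \<B> A (zob \<B>)"
  proof -
    obtain i p where "i \<in> arr A (zob \<B>)" "p \<in> arr (zob \<B>) A" "p \<cdot> i = idt \<B> A"
      using r
      unfolding retract_def
      by blast
    then have "idt \<B> A = zmor A A" using zob_terminal cmp_zero by (metis singletonD)
    then show "retract \<B> A U" by (rule null_retract)
  qed
  have "addclosed \<B> {T. retract \<B> A T \<longrightarrow> retract \<B> A U}"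
    unfolding addclosed_def using z local_obj_retract_dsum[OF A(1)] retract_trans by blast
  then have "add_cl \<B> U \<subseteq> {T. retract \<B> A T \<longrightarrow> retract \<B> A U}" by (rule add_cl_least) simp
  then show ?thesis using A(2) retract_refl by blast
qed

lemma indecomposableI: assumes n: "idt \<B> Y \<noteq> zmor Y Y"
    and e: "\<And>e. \<lbrakk>e \<in> arr Y Y; e \<cdot> e = e\<rbrakk> \<Longrightarrow> e = zmor Y Y \<or> e = idt \<B> Y"
  shows "indecomposable \<B> Y"
  unfolding indecomposable_def zero_object_iff
proof (intro conjI allI impI n)
  fix A C assume "isomorphic \<B> Y (A \<boxplus> C)"
  then obtain i p j q where b: "biprod \<B> A C Y i p j q" using isomorphic_biprod by blast
  note b = b[unfolded biprod_def]
  then have t: "i \<in> arr A Y" "p \<in> arr Y A" "p \<cdot> i = idt \<B> A" "j \<in> arr C Y" "q \<in> arr Y C" "q \<cdot> j = idt \<B> C" "p \<cdot>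
    j = zmor C A"
    by auto
  have "i \<cdot> p = zmor Y Y \<or> i \<cdot> p = idt \<B> Y"
    by (rule e[OF cmp_closed[OF t(2,1)] cmp_mid_idt[OF t(2,1,2,1,3)]])
  then show "idt \<B> A = zmor A A \<or> idt \<B> C = zmor C C"
  proof
    assume "i \<cdot> p = zmor Y Y"
    then have "idt \<B> A = p \<cdot> (zmor Y Y \<cdot> i)" using assoc_right[OF t(1,2,1)] t cmp_idt_right[OF t(1)] by simp
    then show ?thesis using zero_cmp[OF t(1)] cmp_zero[OF t(2)] by simp
  next
    assume "i \<cdot> p = idt \<B> Y"
    then have "idt \<B> C = q \<cdot> (i \<cdot> p \<cdot> j)" using t cmp_idt_left[OF t(4)] by simp
    then have "idt \<B> C = q \<cdot> (i \<cdot> zmor C A)" using assoc_right[OF t(4,2,1)] t by simp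
    then show ?thesis using cmp_zero[OF t(1)] cmp_zero[OF t(5)] by simp
  qed
qed

lemma local_obj_indecomposable: "local_obj \<B> A \<Longrightarrow> indecomposable \<B> A"
  using indecomposableI local_obj_nonzero local_obj_idempotent by blast

lemma indecomposable_local_obj: assumes X: "indecomposable \<B> X" and d: "local_decomp \<B> n X" shows "local_obj \<B>
  X"
proof (cases n)
  case 0
  then show ?thesis using X d unfolding indecomposable_def zero_object_iff by simp
next
  case (Suc m)
  then obtain A C i p j q where d: "biprod \<B> A C X i p j q" "local_obj \<B> A" using d by auto
  then have C: "idt \<B> C = zmor C C"
    using biprod_iso_dsum[OF d(1)] X local_obj_nonzero[OF d(2)]
      unfolding indecomposable_def zero_object_iff
      by blast
  note b = d(1)[unfolded biprod_def]
  then have "j = zmor C X" "j \<cdot> q \<in> arr X X" using null_mor[OF C] cmp_closed by auto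
  then have "i \<cdot> p = idt \<B> X"
    using b zero_cmp[of q X C X] add_zero[of "i \<cdot> p" X X] cmp_closed[of p X A i X]
    by simp
  then have "isomorphic \<B> A X" using b isomorphicI by blast
  then show ?thesis using local_obj_iso_transport d(2) by blast
qed

lemma local_nc_ring_local_obj: assumes "local_nc_ring (End_ring \<B> A)" shows "local_obj \<B> A"
proof -
  have u: "Units (End_ring \<B> A) = iso_mor \<B> A A"
    unfolding Units_def End_ring_def iso_mor_def by auto
  show ?thesis unfolding local_obj_def
  proof (intro conjI ballI impI)
    show "idt \<B> A \<noteq> zmor A A" using assms unfolding local_nc_ring_def End_ring_def by simp
    fix f g assume f: "f \<in> arr A A" "g \<in> arr A A" "f \<oplus>\<^bsub>Hom \<B> A A\<^esub> g = idt \<B> A"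
    show "f \<in> iso_mor \<B> A A \<or> g \<in> iso_mor \<B> A A"
    proof (rule ccontr)
      assume "\<not> ?thesis"
      then have "f \<in> carrier (End_ring \<B> A) - Units (End_ring \<B> A)" "g \<in> carrier (End_ring \<B> A) - Units
        (End_ring \<B> A)"
        using f u by (auto simp: End_ring_def)
      then have "f \<oplus>\<^bsub>End_ring \<B> A\<^esub> g \<notin> Units (End_ring \<B> A)" using assms unfolding local_nc_ring_def by blast
      then show False using f(3) iso_mor_idt[of A] u by (simp add: End_ring_def)
    qed
  qed
qed

lemma krull_schmidt_local_decomp: assumes "krull_schmidt \<B>" shows "\<exists>n. local_decomp \<B> n A"
proof -
  obtain As where "isomorphic \<B> A (dsum_list \<B> As)" "\<forall>X\<in>set As. local_obj \<B> X"
    using assms local_nc_ring_local_obj unfolding krull_schmidt_def by blast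
  then show ?thesis using local_decomp_iso[OF isomorphic_sym] local_decomp_dsum_list by blast
qed

lemma radical_cancel: assumes f: "f \<in> arr A C" and g: "g \<in> radical \<B> A C" and s: "f \<oplus>\<^bsub>Hom \<B> A C\<^esub> g \<in> radical \<B> A
  C" shows "f \<in> radical \<B> A C"
proof -
  note g' = radical_arr[OF g]
  \<comment> \<open>\<open>n\<close> is minus the identity of \<open>C\<close>, so that
    \<open>n \<cdot> g\<close> cancels \<open>g\<close>.\<close>
  obtain n where n: "n \<in> arr C C" "n \<oplus>\<^bsub>Hom \<B> C C\<^esub> idt \<B> C = zmor C C"
    using complement[OF idt_closed zero_closed]
    by blast
  have ng: "n \<cdot> g \<in> arr A C" by (rule cmp_closed[OF g' n(1)])
  have "n \<cdot> g \<oplus>\<^bsub>Hom \<B> A C\<^esub> g = zmor A C"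
    using cmp_add_left[OF g' n(1) idt_closed] n(2) zero_cmp[OF g'] cmp_idt_left[OF g']
    by simp
  then have "f \<oplus>\<^bsub>Hom \<B> A C\<^esub> g \<oplus>\<^bsub>Hom \<B> A C\<^esub> n \<cdot> g = f"
    using add_assoc[OF f g' ng] add_comm[OF g' ng] add_zero[OF f]
    by simp
  then show ?thesis using radical_add[OF s radical_left[OF g n(1)]] by simp
qed

lemma local_obj_iso_not_radical: assumes X: "local_obj \<B> X" and f: "f \<in> iso_mor \<B> X X" shows "f \<notin> radical \<B> X X"
proof
  assume r: "f \<in> radical \<B> X X"
  obtain s where s: "s \<in> arr X X" "s \<cdot> f = idt \<B> X" using iso_morE[OF f] by metis
  have "zmor X X \<in> iso_mor \<B> X X"
    using radicalD[OF r s(1) zero_closed] s(2) zero_add[OF idt_closed] by simp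
  then obtain t where "t \<in> arr X X" "t \<cdot> zmor X X = idt \<B> X" using iso_morE by metis
  then show False using local_obj_nonzero[OF X] cmp_zero by simp
qed

lemma local_obj_not_radical_iso: assumes X: "local_obj \<B> X" and A: "local_obj \<B> A" and f: "f \<in> arr A X" "f \<notin>
  radical \<B> A X" shows "f \<in> iso_mor \<B> A X"
proof -
  obtain l where l: "l \<in> arr X A" "f \<cdot> l = idt \<B> X" using local_obj_not_radical[OF X f] by blast
  then show ?thesis
    using iso_morI[OF f(1) l(1) local_obj_retract_iso[OF A local_obj_nonzero[OF X] l(1) f(1) l(2)]]
    by simp
qed

lemma local_obj_through_radical: assumes X: "local_obj \<B> X" and n: "\<not> retract \<B> X A" and u: "u \<in> arr X A" and p:
  "p \<in> arr A X"
  shows "p \<cdot> u \<in> radical \<B> X X"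
  using local_obj_split[OF X u p] local_obj_not_radical_iso[OF X X cmp_closed[OF u p]] n by blast

lemma dsum_list_retract: assumes X: "local_obj \<B> X"
  shows "\<lbrakk>\<forall>A\<in>set As. local_obj \<B> A; retract \<B> X (dsum_list \<B> As)\<rbrakk> \<Longrightarrow> \<exists>C\<in>set As. isomorphic \<B> X C"
proof (induction As)
  case Nil
  then have "retract \<B> X (zob \<B>)" by (simp add: dsum_list_def)
  then have "idt \<B> X = zmor X X" using zob_terminal cmp_zero unfolding retract_def by (metis singletonD)
  then show ?case using local_obj_nonzero[OF X] by simp
next
  case (Cons C Cs)
  then have "retract \<B> X C \<or> retract \<B> X (dsum_list \<B> Cs)"
    using local_obj_retract_dsum[OF X]
    by (simp add: dsum_list_def)
  then show ?case using Cons local_obj_retract_isomorphic[OF _ local_obj_nonzero[OF X]] by auto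
qed

text \<open>Modulo the radical, maps between X and the sum see only the copies of X in the list,
  with entries in the skew field End X / rad. The hypotheses give a triangular 2 x 2 matrix with
  invertible diagonal, hence two independent copies, whereas a list without repetition has at most
  one.\<close>

lemma dsum_list_multiplicity:
  assumes X: "local_obj \<B> X"
  shows "\<lbrakk>\<forall>A\<in>set As. local_obj \<B> A; sorted_wrt (\<lambda>A C. \<not> isomorphic \<B> A C) As;
    p1 \<in> arr (dsum_list \<B> As) X; p2 \<in> arr (dsum_list \<B> As) X; u1 \<in> arr X (dsum_list \<B> As); u2 \<in> arr X (dsum_list
      \<B> As);
    p1 \<cdot> u1 \<notin> radical \<B> X X; p2 \<cdot> u2 \<notin> radical \<B> X X; p2 \<cdot> u1 \<in> radical \<B> X X\<rbrakk> \<Longrightarrow> False"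
proof (induction As arbitrary: p1 p2 u1 u2)
  case Nil
  then have "idt \<B> (dsum_list \<B> []) = zmor (dsum_list \<B> []) (dsum_list \<B> [])"
    unfolding dsum_list_def using zob_null by simp
  then have "p1 = zmor (dsum_list \<B> []) X" using null_mor Nil by blast
  then show ?case using Nil zero_cmp radical_zero by metis
next
  case (Cons A As)
  let ?D = "dsum_list \<B> As"
  have D: "dsum_list \<B> (A # As) = A \<boxplus> ?D" by (simp add: dsum_list_def)
  note pr = Cons.prems[unfolded D]
  have A: "local_obj \<B> A" using pr by simp
  let ?i = "in1 \<B> A ?D" and ?j = "in2 \<B> A ?D" and ?p = "pr1 \<B> A ?D" and ?q = "pr2 \<B> A ?D"
  have ex: "p \<cdot> u = p \<cdot> ?i \<cdot> (?p \<cdot> u) \<oplus>\<^bsub>Hom \<B> X X\<^esub> p \<cdot> ?j \<cdot> (?q \<cdot> u)" if "p \<in> arr (A \<boxplus> ?D) X" "u \<in> arr X (A \<boxplus>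
    ?D)" for p u
    using biprod_expand_left[OF biprod_dsum that] .
  have t: "p1 \<cdot> ?i \<in> arr A X" "p2 \<cdot> ?i \<in> arr A X" "p1 \<cdot> ?j \<in> arr ?D X" "p2 \<cdot> ?j \<in> arr ?D X"
    "?p \<cdot> u1 \<in> arr X A" "?p \<cdot> u2 \<in> arr X A" "?q \<cdot> u1 \<in> arr X ?D" "?q \<cdot> u2 \<in> arr X ?D"
    using cmp_closed[OF in1_closed pr(3)] cmp_closed[OF in1_closed pr(4)] cmp_closed[OF in2_closed pr(3)]
      cmp_closed[OF in2_closed pr(4)]
      cmp_closed[OF pr(5) pr1_closed] cmp_closed[OF pr(6) pr1_closed] cmp_closed[OF pr(5) pr2_closed]
        cmp_closed[OF pr(6) pr2_closed]
    by simp_all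
  show ?case
  proof (cases "isomorphic \<B> X A")
    case True
    have "\<not> retract \<B> X ?D"
    proof
      assume r: "retract \<B> X ?D"
      have "\<forall>C\<in>set As. \<not> isomorphic \<B> A C" using pr(2) by simp
      moreover have "\<exists>C\<in>set As. isomorphic \<B> X C" using dsum_list_retract[OF X _ r] pr(1) by simp
      ultimately show False using True isomorphic_trans isomorphic_sym by blast
    qed
    then have r: "p \<cdot> ?j \<cdot> (?q \<cdot> u) \<in> radical \<B> X X" if "p \<in> arr (A \<boxplus> ?D) X" "u \<in> arr X (A \<boxplus> ?D)" for p u
      using local_obj_through_radical[OF X _ cmp_closed[OF that(2) pr2_closed] cmp_closed[OF in2_closed
        that(1)]]
        by blast
    have "p1 \<cdot> ?i \<cdot> (?p \<cdot> u1) \<notin> radical \<B> X X" using ex[of p1 u1] pr(3,5,7) radical_add r[of p1 u1] by metis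
    then have a: "?p \<cdot> u1 \<notin> radical \<B> X A" using radical_left t(1) by blast
    have "p2 \<cdot> ?i \<cdot> (?p \<cdot> u2) \<notin> radical \<B> X X" using ex[of p2 u2] pr(4,6,8) radical_add r[of p2 u2] by metis
    then have b: "p2 \<cdot> ?i \<notin> radical \<B> A X" using radical_right t(6) by blast
    \<comment> \<open>With one copy only, the components of \<open>u1\<close> and \<open>p2\<close>
      at it are isomorphisms, and so is their composite. It is also radical, because
      \<open>p2 \<cdot> u1\<close> and the passage through the rest are.\<close>
    have "p2 \<cdot> ?i \<cdot> (?p \<cdot> u1) \<in> iso_mor \<B> X X"
      using iso_mor_cmp[OF local_obj_not_radical_iso[OF A X t(5) a] local_obj_not_radical_iso[OF X A t(2) b]] .
    moreover have "p2 \<cdot> ?i \<cdot> (?p \<cdot> u1) \<in> radical \<B> X X"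
      using radical_cancel[OF cmp_closed[OF t(5,2)] r[OF pr(4,5)]] ex[OF pr(4,5)] pr(9) by simp
    ultimately show False using local_obj_iso_not_radical[OF X] by blast
  next
    case False
    then have "\<not> retract \<B> X A" using local_obj_retract_isomorphic[OF A local_obj_nonzero[OF X]] by blast
    then have r: "p \<cdot> ?i \<cdot> (?p \<cdot> u) \<in> radical \<B> X X" if "p \<in> arr (A \<boxplus> ?D) X" "u \<in> arr X (A \<boxplus> ?D)" for p u
      using local_obj_through_radical[OF X _ cmp_closed[OF that(2) pr1_closed] cmp_closed[OF in1_closed
        that(1)]]
        by blast
    have 1: "p1 \<cdot> ?j \<cdot> (?q \<cdot> u1) \<notin> radical \<B> X X"
      using ex[OF pr(3,5)] radical_add[OF r[OF pr(3,5)]] pr(7)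
      by metis
    have 2: "p2 \<cdot> ?j \<cdot> (?q \<cdot> u2) \<notin> radical \<B> X X"
      using ex[OF pr(4,6)] radical_add[OF r[OF pr(4,6)]] pr(8)
      by metis
    have 3: "p2 \<cdot> ?j \<cdot> (?q \<cdot> u1) \<in> radical \<B> X X"
      using ex[OF pr(4,5)] radical_cancel[OF cmp_closed[OF t(7,4)] r[OF pr(4,5)]] pr(9)
        add_comm[OF cmp_closed[OF t(5,2)] cmp_closed[OF t(7,4)]] by simp
    show False
      by (rule Cons.IH[OF _ _ t(3,4,7,8) 1 2 3]) (use pr(1,2) in auto)
  qed
qed

text \<open>\<open>M\<close> would contain two independent copies of \<open>X\<close>, one inside
  \<open>U\<close> and the given one; their inclusions and projections are the four maps of
  \<open>dsum_list_multiplicity\<close>.\<close>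

lemma basic_no_repeat: assumes ks: "krull_schmidt \<B>" and M: "basic \<B> M" "isomorphic \<B> M (U \<boxplus> X)" and X:
  "local_obj \<B> X"
  shows "\<not> retract \<B> X U"
proof
  assume "retract \<B> X U"
  then obtain i p where i: "i \<in> arr X U" "p \<in> arr U X" "p \<cdot> i = idt \<B> X" unfolding retract_def by blast
  obtain As where As: "isomorphic \<B> M (dsum_list \<B> As)" "\<forall>A\<in>set As. indecomposable \<B> A" "sorted_wrt (\<lambda>A C. \<not>
    isomorphic \<B> A C) As"
    using M(1) unfolding basic_def by blast
  have l: "\<forall>A\<in>set As. local_obj \<B> A"
    using As(2) krull_schmidt_local_decomp[OF ks] indecomposable_local_obj
    by blast
  let ?D = "dsum_list \<B> As"
  have "isomorphic \<B> ?D (U \<boxplus> X)" using isomorphic_trans[OF isomorphic_sym[OF As(1)] M(2)] .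
  then obtain a b c d where B: "biprod \<B> U X ?D a b c d" using isomorphic_biprod by blast
  note B' = B[unfolded biprod_def]
  then have t: "a \<in> arr U ?D" "b \<in> arr ?D U" "c \<in> arr X ?D" "d \<in> arr ?D X" by auto
  have one: "idt \<B> X \<notin> radical \<B> X X" using local_obj_iso_not_radical[OF X iso_mor_idt] .
  have "p \<cdot> b \<cdot> (a \<cdot> i) = idt \<B> X" using cmp_mid_idt[OF i(1) t(1,2) i(2)] B' i by simp
  moreover have "d \<cdot> c = idt \<B> X" using B' by simp
  moreover have "d \<cdot> (a \<cdot> i) = zmor X X" using cmp_assoc[OF i(1) t(1,4)] B' zero_cmp[OF i(1)] by simp
  ultimately show False
    using dsum_list_multiplicity[OF X l As(3) cmp_closed[OF t(2) i(2)] t(4) cmp_closed[OF i(1) t(1)] t(3)] one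
      radical_zero
      by simp
qed

section \<open>Existence of minimal approximations\<close>

lemma right_approxD: "\<lbrakk>right_approx \<B> \<T> T X f; T' \<in> \<T>; g \<in> arr T' X\<rbrakk> \<Longrightarrow> \<exists>h\<in>arr T' T. f \<cdot> h = g"
  unfolding right_approx_def by blast

lemma smult_Hom_closed: "\<lbrakk>c \<in> carrier K; f \<in> arr A C\<rbrakk> \<Longrightarrow> c \<odot>\<^bsub>Hom \<B> A C\<^esub> f \<in> arr A C"
  using module.smult_closed[OF module_Hom] .

text \<open>\<open>V\<close> contains one copy of \<open>U\<close> for each element of
  \<open>S\<close>, and \<open>\<psi>\<close> has the elements of \<open>S\<close> as entries; a
  linear combination is reached through scalar multiples of the identity of
  \<open>U\<close>.\<close>

lemma span_factors:
  assumes V: "addclosed \<B> \<T>" "U \<in> \<T>" and S: "finite S" "S \<subseteq> arr U D"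
  shows "\<exists>V\<in>\<T>. \<exists>\<psi>\<in>arr V D. \<forall>c\<in>S \<rightarrow> carrier K. \<exists>h\<in>arr U V.
    \<psi> \<cdot> h = finsum (Hom \<B> U D) (\<lambda>s. c s \<odot>\<^bsub>Hom \<B> U D\<^esub> s) S"
  using S
proof (induction S)
  case empty
  interpret H: abelian_group "Hom \<B> U D" by (rule Hom_abelian_group)
  show ?case
  proof (intro bexI ballI)
    show "zmor (zob \<B>) D \<cdot> zmor U (zob \<B>) = finsum (Hom \<B> U D) (\<lambda>s. c s \<odot>\<^bsub>Hom \<B> U D\<^esub> s) {}" for c
      using zero_cmp[OF zero_closed] H.finsum_empty by simp
    show "zob \<B> \<in> \<T>" using V unfolding addclosed_def by blast
  qed (rule zero_closed)+
next
  case (insert s S)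
  interpret H: abelian_group "Hom \<B> U D" by (rule Hom_abelian_group)
  obtain V \<psi> where I: "V \<in> \<T>" "\<psi> \<in> arr V D" "\<forall>c\<in>S \<rightarrow> carrier K. \<exists>h\<in>arr U V.
    \<psi> \<cdot> h = finsum (Hom \<B> U D) (\<lambda>s. c s \<odot>\<^bsub>Hom \<B> U D\<^esub> s) S" using insert by auto
  have s: "s \<in> arr U D" using insert by simp
  note d = biprod_dsum[of V U]
  let ?psi = "\<psi> \<cdot> pr1 \<B> V U \<oplus>\<^bsub>Hom \<B> (V \<boxplus> U) D\<^esub> s \<cdot> pr2 \<B> V U"
  show ?case
  proof (rule bexI, rule bexI, rule ballI)
    show "V \<boxplus> U \<in> \<T>" by (rule addclosed_dsum[OF V(1) I(1) V(2)])
    show "?psi \<in> arr (V \<boxplus> U) D" by (rule biprod_mor_out(1)[OF d I(2) s])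
    fix c assume c: "c \<in> insert s S \<rightarrow> carrier K"
    then obtain h where h: "h \<in> arr U V" "\<psi> \<cdot> h = finsum (Hom \<B> U D) (\<lambda>s. c s \<odot>\<^bsub>Hom \<B> U D\<^esub> s) S"
      using I(3)
      by auto
    have cs: "c s \<in> carrier K" "(\<lambda>s. c s \<odot>\<^bsub>Hom \<B> U D\<^esub> s) \<in> S \<rightarrow> arr U D"
      using c insert.prems by (auto intro!: smult_Hom_closed)
    let ?k = "c s \<odot>\<^bsub>Hom \<B> U U\<^esub> idt \<B> U"
    have k: "?k \<in> arr U U" by (rule smult_Hom_closed[OF cs(1) idt_closed])
    have "s \<cdot> ?k = c s \<odot>\<^bsub>Hom \<B> U D\<^esub> s" using cmp_smult_right[OF cs(1) idt_closed s] cmp_idt_right[OF s] by simp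
    then have "?psi \<cdot> (in1 \<B> V U \<cdot> h \<oplus>\<^bsub>Hom \<B> U (V \<boxplus> U)\<^esub> in2 \<B> V U \<cdot> ?k) = \<psi> \<cdot> h \<oplus>\<^bsub>Hom \<B> U D\<^esub> c s \<odot>\<^bsub>Hom \<B> U D\<^esub> s"
      using biprod_mor_comp[OF d I(2) s h(1) k] by simp
    also have "... = c s \<odot>\<^bsub>Hom \<B> U D\<^esub> s \<oplus>\<^bsub>Hom \<B> U D\<^esub> finsum (Hom \<B> U D) (\<lambda>s. c s \<odot>\<^bsub>Hom \<B> U D\<^esub> s) S"
      using add_comm[OF cmp_closed[OF h(1) I(2)] smult_Hom_closed[OF cs(1) s]] h(2) by simp
    also have "... = finsum (Hom \<B> U D) (\<lambda>s. c s \<odot>\<^bsub>Hom \<B> U D\<^esub> s) (insert s S)"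
      by (rule H.finsum_insert[OF insert(1,2) cs(2) smult_Hom_closed[OF cs(1) s], symmetric])
    finally show "\<exists>h\<in>arr U (V \<boxplus> U). ?psi \<cdot> h = finsum (Hom \<B> U D) (\<lambda>s. c s \<odot>\<^bsub>Hom \<B> U D\<^esub> s) (insert s S)"
      using biprod_mor_in(1)[OF d h(1) k] by blast
  qed
qed

lemma hom_generated:
  assumes V: "addclosed \<B> \<T>" "U \<in> \<T>" and f: "finite_dim K (Hom \<B> U D)"
  shows "\<exists>V\<in>\<T>. \<exists>\<psi>\<in>arr V D. \<forall>g\<in>arr U D. \<exists>h\<in>arr U V. \<psi> \<cdot> h = g"
proof -
  obtain S where S: "finite S" "S \<subseteq> arr U D"
    "\<forall>v\<in>arr U D. \<exists>c\<in>S \<rightarrow> carrier K. v = finsum (Hom \<B> U D) (\<lambda>s. c s \<odot>\<^bsub>Hom \<B> U D\<^esub> s) S"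
    using f unfolding finite_dim_def by blast
  obtain V \<psi> where h: "V \<in> \<T>" "\<psi> \<in> arr V D" "\<forall>c\<in>S \<rightarrow> carrier K. \<exists>h\<in>arr U V.
    \<psi> \<cdot> h = finsum (Hom \<B> U D) (\<lambda>s. c s \<odot>\<^bsub>Hom \<B> U D\<^esub> s) S"
    using span_factors[OF V S(1,2)] by blast
  show ?thesis
  proof (intro bexI[OF _ h(1)] bexI[OF _ h(2)] ballI)
    fix g assume "g \<in> arr U D"
    then obtain c where "c \<in> S \<rightarrow> carrier K" "g = finsum (Hom \<B> U D) (\<lambda>s. c s \<odot>\<^bsub>Hom \<B> U D\<^esub> s) S"
      using S(3) by blast
    then show "\<exists>h\<in>arr U V. \<psi> \<cdot> h = g" using h(3) by simp
  qed
qed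

text \<open>By this and its dual a lifting property need only be checked on generators, of add U or
  of the subcategory \<open>calR\<close>. Projectivity is an intersection of such classes.\<close>

lemma factor_class_addclosed:
  assumes \<psi>: "\<psi> \<in> arr V D"
  shows "addclosed \<B> {T. \<forall>g\<in>arr T D. \<exists>h\<in>arr T V. \<psi> \<cdot> h = g}"
  unfolding addclosed_def
proof (intro conjI ballI allI impI; simp only: mem_Collect_eq; (intro ballI)?)
  fix g assume "g \<in> arr (zob \<B>) D"
  then show "\<exists>h\<in>arr (zob \<B>) V. \<psi> \<cdot> h = g"
    using zob_initial[of D] zero_closed[of "zob \<B>" V] cmp_zero[OF \<psi>]
    by (metis singletonD)
next
  fix A C g assume a: "\<forall>g\<in>arr A D. \<exists>h\<in>arr A V. \<psi> \<cdot> h = g" "\<forall>g\<in>arr C D. \<exists>h\<in>arr C V. \<psi> \<cdot> h = g" "g \<in> arr (A \<boxplus> C)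
    D"
  obtain h where h: "h \<in> arr A V" "\<psi> \<cdot> h = g \<cdot> in1 \<B> A C" using a(1) cmp_closed[OF in1_closed a(3)] by blast
  obtain k where k: "k \<in> arr C V" "\<psi> \<cdot> k = g \<cdot> in2 \<B> A C" using a(2) cmp_closed[OF in2_closed a(3)] by blast
  note d = biprod_dsum[of A C]
  let ?l = "h \<cdot> pr1 \<B> A C \<oplus>\<^bsub>Hom \<B> (A \<boxplus> C) V\<^esub> k \<cdot> pr2 \<B> A C"
  have "\<psi> \<cdot> ?l = g \<cdot> in1 \<B> A C \<cdot> pr1 \<B> A C \<oplus>\<^bsub>Hom \<B> (A \<boxplus> C) D\<^esub> g \<cdot> in2 \<B> A C \<cdot> pr2 \<B> A C"
    using cmp_add_right[OF cmp_closed[OF pr1_closed h(1)] cmp_closed[OF pr2_closed k(1)] \<psi>]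
      cmp_assoc[OF pr1_closed h(1) \<psi>, of C] cmp_assoc[OF pr2_closed k(1) \<psi>, of A] h(2) k(2) by simp
  also have "... = g"
    using biprod_expand_left[OF d a(3) idt_closed] cmp_idt_right[OF a(3)] cmp_idt_right[OF pr1_closed]
      cmp_idt_right[OF pr2_closed]
    by simp
  finally show "\<exists>h\<in>arr (A \<boxplus> C) V. \<psi> \<cdot> h = g" using biprod_mor_out(1)[OF d h(1) k(1)] by blast
next
  fix A C g assume a: "\<forall>g\<in>arr C D. \<exists>h\<in>arr C V. \<psi> \<cdot> h = g" "retract \<B> A C" "g \<in> arr A D"
  obtain i p where i: "i \<in> arr A C" "p \<in> arr C A" "p \<cdot> i = idt \<B> A" using a(2) unfolding retract_def by blast
  obtain h where h: "h \<in> arr C V" "\<psi> \<cdot> h = g \<cdot> p" using a(1) cmp_closed[OF i(2) a(3)] by blast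
  have "\<psi> \<cdot> (h \<cdot> i) = g"
    using cmp_assoc[OF i(1) h(1) \<psi>] h(2) assoc_right[OF i(1,2) a(3)] i(3) cmp_idt_right[OF a(3)]
    by simp
  then show "\<exists>h\<in>arr A V. \<psi> \<cdot> h = g" using cmp_closed[OF i(1) h(1)] by blast
qed

lemma right_approx_add_cl: assumes V: "addclosed \<B> (add_cl \<B> U)" "U \<in> add_cl \<B> U" and f: "finite_dim K (Hom \<B> U
  D)"
  shows "\<exists>V \<psi>. right_approx \<B> (add_cl \<B> U) V D \<psi>"
proof -
  obtain V \<psi> where h: "V \<in> add_cl \<B> U" "\<psi> \<in> arr V D" "\<forall>g\<in>arr U D. \<exists>h\<in>arr U V. \<psi> \<cdot> h = g"
    using hom_generated[OF V f] by blast
  have "add_cl \<B> U \<subseteq> {T. \<forall>g\<in>arr T D. \<exists>h\<in>arr T V. \<psi> \<cdot> h = g}"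
    by (rule add_cl_least[OF factor_class_addclosed[OF h(2)]]) (use h(3) in simp)
  then show ?thesis using h unfolding right_approx_def by blast
qed

text \<open>A right approximation with the least number of local summands is right minimal: an endomorphism \<open>h\<close> of its
  source \<open>T\<close> over the target with \<open>1 - h\<close> not in \<open>radical\<close> would split off a summand of \<open>T\<close> on which the
  approximation is redundant.\<close>

lemma minimal_right_approx:
  assumes V: "addclosed \<B> \<T>" and local_decomp_exists: "\<And>A. \<exists>n. local_decomp \<B> n A" and ex: "\<exists>T f. right_approx \<B>
    \<T> T X f"
  shows "\<exists>T f. right_approx \<B> \<T> T X f \<and> (\<forall>h\<in>arr T T. f \<cdot> h = f \<longrightarrow> h \<in> iso_mor \<B> T T)"
proof -
  define P where "P n \<longleftrightarrow> (\<exists>T f. right_approx \<B> \<T> T X f \<and> local_decomp \<B> n T)" for n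
  have "\<exists>n. P n" using ex local_decomp_exists unfolding P_def by blast
  then have "P (LEAST n. P n)" by (rule LeastI_ex)
  then obtain T f where T: "right_approx \<B> \<T> T X f" "local_decomp \<B> (LEAST n. P n) T" unfolding P_def by blast
  have f: "f \<in> arr T X" "T \<in> \<T>" using T(1) unfolding right_approx_def by auto
  have "h \<in> iso_mor \<B> T T" if h: "h \<in> arr T T" "f \<cdot> h = f" for h
  proof (rule ccontr)
    assume n: "h \<notin> iso_mor \<B> T T"
    obtain g where g: "g \<in> arr T T" "g \<oplus>\<^bsub>Hom \<B> T T\<^esub> h = idt \<B> T" using complement[OF h(1) idt_closed] by blast
    have "f \<cdot> g \<oplus>\<^bsub>Hom \<B> T X\<^esub> f = f"
      using cmp_add_right[OF g(1) h(1) f(1)] g(2) h(2) cmp_idt_right[OF f(1)]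
      by simp
    then have fg: "f \<cdot> g = zmor T X"
      using zero_unique[OF f(1) _ cmp_closed[OF g(1) f(1)]] add_comm[OF cmp_closed[OF g(1) f(1)] f(1)]
      by simp
    \<comment> \<open>\<open>g\<close> is 1 - h; were it radical, \<open>h\<close> would be a
      unit.\<close>
    have "idt \<B> T \<cdot> g \<notin> radical \<B> T T"
      using radicalD[OF _ idt_closed h(1), of g] n g add_comm[OF g(1) h(1)] cmp_idt_left[OF g(1)] by auto
    from local_decomp_select[OF T(2) g(1) idt_closed this]
    obtain m A C i p j q where d: "(LEAST n. P n) = Suc m" "biprod \<B> A C T i p j q" "local_obj \<B> A"
      "local_decomp \<B> m C"
      "idt \<B> T \<cdot> i \<cdot> (p \<cdot> g) \<notin> radical \<B> T T" by blast
    have b: "i \<in> arr A T" "p \<in> arr T A" "j \<in> arr C T" "q \<in> arr T C" using d(2)[unfolded biprod_def] by auto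
    have "p \<cdot> g \<notin> radical \<B> T A"
      using radical_left[of "p \<cdot> g" T A "idt \<B> T \<cdot> i" T] d(5) cmp_closed[OF b(1) idt_closed]
      by blast
    then obtain l where l: "l \<in> arr A T" "p \<cdot> g \<cdot> l = idt \<B> A"
      using local_obj_not_radical[OF d(3) cmp_closed[OF g(1) b(2)]]
      by blast
    \<comment> \<open>\<open>?x\<close> maps \<open>A\<close> into \<open>T\<close> with f x = 0 and
      component 1 along \<open>i\<close>. Hence f i = - f j (q x), so \<open>f\<close> factors
      through its restriction to the complement \<open>C\<close>.\<close>
    let ?x = "g \<cdot> l"
    have x: "?x \<in> arr A T" "p \<cdot> ?x = idt \<B> A" "f \<cdot> ?x = zmor A X"
      using cmp_closed[OF l(1) g(1)] assoc_right[OF l(1) g(1) b(2)] l(2) cmp_assoc[OF l(1) g(1) f(1)] fg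
        zero_cmp[OF l(1)]
        by auto
    have qx: "q \<cdot> ?x \<in> arr A C" and fj: "f \<cdot> j \<in> arr C X" and fi: "f \<cdot> i \<in> arr A X"
      using cmp_closed x(1) b f by auto
    have rel: "f \<cdot> i \<oplus>\<^bsub>Hom \<B> A X\<^esub> f \<cdot> j \<cdot> (q \<cdot> ?x) = zmor A X"
      using biprod_expand_left[OF d(2) f(1) x(1)] x(2,3) cmp_idt_right[OF fi] by simp
    have C: "C \<in> \<T>" using addclosed_retract[OF V f(2)] b(3,4) d(2) unfolding retract_def biprod_def by blast
    have fact: "\<exists>k\<in>arr T C. f = f \<cdot> j \<cdot> k"
    proof -
      obtain y where y: "y \<in> arr A C" "y \<oplus>\<^bsub>Hom \<B> A C\<^esub> q \<cdot> ?x = zmor A C"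
        using complement[OF qx zero_closed]
        by blast
      have e: "f \<cdot> i = f \<cdot> j \<cdot> y"
      proof (rule add_cancel[of _ A X])
        show "f \<cdot> j \<cdot> (q \<cdot> ?x) \<in> arr A X" "f \<cdot> i \<in> arr A X" "f \<cdot> j \<cdot> y \<in> arr A X"
          using cmp_closed qx fj fi y
          by auto
        have "f \<cdot> j \<cdot> y \<oplus>\<^bsub>Hom \<B> A X\<^esub> f \<cdot> j \<cdot> (q \<cdot> ?x) = zmor A X"
          using cmp_add_right[OF y(1) qx fj] y(2) cmp_zero[OF fj]
          by simp
        then show "f \<cdot> j \<cdot> (q \<cdot> ?x) \<oplus>\<^bsub>Hom \<B> A X\<^esub> f \<cdot> i = f \<cdot> j \<cdot> (q \<cdot> ?x) \<oplus>\<^bsub>Hom \<B> A X\<^esub> f \<cdot> j \<cdot> y"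
          using rel add_comm[OF cmp_closed[OF qx fj] fi] add_comm[OF cmp_closed[OF qx fj] cmp_closed[OF y(1)
            fj]]
            by simp
      qed
      have yp: "y \<cdot> p \<in> arr T C" by (rule cmp_closed[OF b(2) y(1)])
      have "f = f \<cdot> i \<cdot> p \<oplus>\<^bsub>Hom \<B> T X\<^esub> f \<cdot> j \<cdot> q"
        using biprod_expand_left[OF d(2) f(1) idt_closed] cmp_idt_right[OF f(1)] cmp_idt_right[OF b(2)]
          cmp_idt_right[OF b(4)]
          by simp
      also have "... = f \<cdot> j \<cdot> (y \<cdot> p \<oplus>\<^bsub>Hom \<B> T C\<^esub> q)"
        using cmp_add_right[OF yp b(4) fj] cmp_assoc[OF b(2) y(1) fj] e by simp
      finally show ?thesis using add_closed[OF yp b(4)] by blast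
    qed
    then obtain k where k: "k \<in> arr T C" "f = f \<cdot> j \<cdot> k" by blast
    have "right_approx \<B> \<T> C X (f \<cdot> j)" unfolding right_approx_def
    proof (intro conjI ballI C fj)
      fix T' t assume "T' \<in> \<T>" "t \<in> arr T' X"
      then obtain h where h: "h \<in> arr T' T" "f \<cdot> h = t" using T(1) unfolding right_approx_def by blast
      have "f \<cdot> j \<cdot> (k \<cdot> h) = t" using cmp_assoc[OF h(1) k(1) fj] k(2) h(2) by simp
      then show "\<exists>h\<in>arr T' C. f \<cdot> j \<cdot> h = t" using cmp_closed[OF h(1) k(1)] by blast
    qed
    then have "P m" using d(4) unfolding P_def by blast
    then have "(LEAST n. P n) \<le> m" by (rule Least_le)
    then show False using d(1) by simp
  qed
  then show ?thesis using T(1) by blast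
qed

end

section \<open>The opposite category\<close>

text \<open>The summands of a direct sum are swapped, so that the split sequence \<open>A \<rightarrow> A \<boxplus> C \<rightarrow> C\<close> goes to a split
  sequence of the same form.\<close>

definition op_cat :: "('k, 'o, 'm, 'e) excat \<Rightarrow> ('k, 'o, 'm, 'e) excat"
  where "op_cat \<B> = \<lparr>Hom = \<lambda>A C. Hom \<B> C A, cmp = \<lambda>g f. cmp \<B> f g, idt = idt \<B>, zob = zob \<B>,
    dsum = \<lambda>A C. dsum \<B> C A, in1 = \<lambda>A C. pr2 \<B> C A, in2 = \<lambda>A C. pr1 \<B> C A,
    pr1 = \<lambda>A C. in2 \<B> C A, pr2 = \<lambda>A C. in1 \<B> C A,
    Ext = \<lambda>C A. Ext \<B> A C, push = pull \<B>, pull = push \<B>,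
    rlz = \<lambda>C A \<delta>. {(y, M, x). (x, M, y) \<in> rlz \<B> A C \<delta>}\<rparr>"

lemma op_cat_simps [simp]:
  "Hom (op_cat \<B>) A C = Hom \<B> C A" "cmp (op_cat \<B>) g f = cmp \<B> f g" "idt (op_cat \<B>) = idt \<B>" "zob (op_cat \<B>) =
    zob \<B>"
  "dsum (op_cat \<B>) A C = dsum \<B> C A" "in1 (op_cat \<B>) A C = pr2 \<B> C A" "in2 (op_cat \<B>) A C = pr1 \<B> C A"
  "pr1 (op_cat \<B>) A C = in2 \<B> C A" "pr2 (op_cat \<B>) A C = in1 \<B> C A" "Ext (op_cat \<B>) C A = Ext \<B> A C"
  "push (op_cat \<B>) = pull \<B>" "pull (op_cat \<B>) = push \<B>"
  unfolding op_cat_def by simp_all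

lemma op_cat_rlz: "(y, M, x) \<in> rlz (op_cat \<B>) C A \<delta> \<longleftrightarrow> (x, M, y) \<in> rlz \<B> A C \<delta>"
  unfolding op_cat_def by simp

lemma op_cat_iso_mor: "iso_mor (op_cat \<B>) A C = iso_mor \<B> C A"
  unfolding iso_mor_def by auto

lemma op_cat_retract: "retract (op_cat \<B>) A C = retract \<B> A C"
  unfolding retract_def by auto

lemma op_cat_biprod: "biprod (op_cat \<B>) A C T i p j q = biprod \<B> A C T p i q j"
  unfolding biprod_def by auto

lemma op_cat_local_obj: "local_obj (op_cat \<B>) A = local_obj \<B> A"
  unfolding local_obj_def op_cat_iso_mor by simp

lemma op_cat_local_decomp: "local_decomp (op_cat \<B>) n T = local_decomp \<B> n T"
proof (induction n arbitrary: T)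
  case (Suc n)
  show ?case unfolding local_decomp.simps op_cat_local_obj Suc op_cat_biprod by blast
qed simp

lemma op_cat_addclosed: "addclosed (op_cat \<B>) T = addclosed \<B> T"
  unfolding addclosed_def op_cat_retract by auto

lemma op_cat_right_approx: "right_approx (op_cat \<B>) \<T> T X f = left_approx \<B> \<T> X T f"
  unfolding right_approx_def left_approx_def by simp

context linear_category
begin

lemma linear_category_op_cat: "linear_category K (op_cat \<B>)"
  by (rule linear_category.intro)
    (simp_all add: field_K module_Hom idt_closed cmp_closed cmp_assoc cmp_idt_left cmp_idt_right cmp_add_right
      cmp_add_left
      cmp_smult_right cmp_smult_left zob_terminal zob_initial in1_closed in2_closed pr1_closed pr2_closed
      pr1_in1 pr2_in2 pr1_in2 pr2_in1 in_pr_sum add_comm[OF cmp_closed[OF pr2_closed in2_closed] cmp_closed[OF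
        pr1_closed in1_closed]])

lemma minimal_left_approx:
  assumes V: "addclosed \<B> \<T>" and local_decomp_exists: "\<And>A. \<exists>n. local_decomp \<B> n A" and ex: "\<exists>T f. left_approx \<B>
    \<T> X T f"
  shows "\<exists>T f. left_approx \<B> \<T> X T f \<and> (\<forall>h\<in>arr T T. h \<cdot> f = f \<longrightarrow> h \<in> iso_mor \<B> T T)"
  using linear_category.minimal_right_approx[OF linear_category_op_cat, of \<T> X] V local_decomp_exists ex
  by (simp add: op_cat_addclosed op_cat_local_decomp op_cat_right_approx op_cat_iso_mor)

lemma cofactor_class_addclosed:
  "\<psi> \<in> arr D V \<Longrightarrow> addclosed \<B> {T. \<forall>g\<in>arr D T. \<exists>h\<in>arr V T. h \<cdot> \<psi> = g}"
  using linear_category.factor_class_addclosed[OF linear_category_op_cat, of \<psi> V D]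
    by (simp add: op_cat_addclosed)

lemma left_approx_add_cl: assumes V: "addclosed \<B> (add_cl \<B> U)" "U \<in> add_cl \<B> U" and f: "finite_dim K (Hom \<B> D
  U)"
  shows "\<exists>V \<psi>. left_approx \<B> (add_cl \<B> U) D V \<psi>"
proof -
  obtain V \<psi> where h: "V \<in> add_cl \<B> U" "\<psi> \<in> arr D V" "\<forall>g\<in>arr D U. \<exists>h\<in>arr V U. h \<cdot> \<psi> = g"
    using linear_category.hom_generated[OF linear_category_op_cat, of "add_cl \<B> U" U D] V f
      by (auto simp: op_cat_addclosed)
  have "add_cl \<B> U \<subseteq> {T. \<forall>g\<in>arr D T. \<exists>h\<in>arr V T. h \<cdot> \<psi> = g}"
    by (rule add_cl_least[OF cofactor_class_addclosed[OF h(2)]]) (use h(3) in simp)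
  then show ?thesis using h unfolding left_approx_def by blast
qed

end

section \<open>Exact sequences of an extriangulated category\<close>

context linear_category
begin

lemma seq_equiv_op_cat: "((y, M, x), (y', M', x')) \<in> seq_equiv (op_cat \<B>) A C \<longleftrightarrow> ((x, M, y), (x', M', y')) \<in>
  seq_equiv \<B> C A"
proof -
  have *: "b \<cdot> x' = x \<and> y \<cdot> b = y' \<longleftrightarrow> d \<cdot> x = x' \<and> y' \<cdot> d = y"
    if "x \<in> arr C M" "y \<in> arr M A" "x' \<in> arr C M'" "y' \<in> arr M' A"
      "b \<in> arr M' M" "d \<in> arr M M'" "d \<cdot> b = idt \<B> M'" "b \<cdot> d = idt \<B> M" for b d
    using that cmp_assoc[of x' C M' b M d M'] cmp_assoc[of x C M d M' b M] assoc_right[of b M' M d M' y' A]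
      assoc_right[of d M M' b M y A]
    by (auto simp: cmp_idt_left cmp_idt_right)
  have "(\<exists>b\<in>iso_mor \<B> M' M. b \<cdot> x' = x \<and> y \<cdot> b = y') \<longleftrightarrow> (\<exists>d\<in>iso_mor \<B> M M'. d \<cdot> x = x' \<and> y' \<cdot> d = y)"
    if "x \<in> arr C M" "y \<in> arr M A" "x' \<in> arr C M'" "y' \<in> arr M' A"
    using *[OF that] iso_morE by metis
  then show ?thesis unfolding seq_equiv_def seqs_def op_cat_iso_mor by auto
qed

end

lemma op_cat_etri: "etri (op_cat \<B>) A x M y C \<delta> = etri \<B> C y M x A \<delta>"
  unfolding etri_def op_cat_rlz by simp

context extriangulated_category
begin

lemma equiv_seq_equiv: "equiv (seqs \<B> A C) (seq_equiv \<B> A C)"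
proof (rule equivI)
  show "seq_equiv \<B> A C \<subseteq> seqs \<B> A C \<times> seqs \<B> A C" unfolding seq_equiv_def by auto
  show "refl_on (seqs \<B> A C) (seq_equiv \<B> A C)"
  proof (rule refl_onI)
    fix s assume "s \<in> seqs \<B> A C"
    then show "(s, s) \<in> seq_equiv \<B> A C" unfolding seq_equiv_def seqs_def
      using iso_mor_idt cmp_idt_left cmp_idt_right by fastforce
  qed
  show "sym (seq_equiv \<B> A C)"
  proof (rule symI)
    fix s t assume "(s, t) \<in> seq_equiv \<B> A C"
    then obtain x M y x' M' y' b where s: "s = (x, M, y)" "t = (x', M', y')" "s \<in> seqs \<B> A C" "t \<in> seqs \<B> A C"
      "b \<in> iso_mor \<B> M M'" "b \<cdot> x = x'" "y' \<cdot> b = y" unfolding seq_equiv_def by auto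
    then have t: "x \<in> arr A M" "y' \<in> arr M' C" by (auto simp: seqs_def)
    obtain d where d: "b \<in> arr M M'" "d \<in> arr M' M" "d \<cdot> b = idt \<B> M" "b \<cdot> d = idt \<B> M'" "d \<in> iso_mor \<B> M' M"
      using iso_morE[OF s(5)]
      by metis
    have "d \<cdot> x' = x" using cmp_assoc[OF t(1) d(1,2)] d(3) s(6) cmp_idt_left[OF t(1)] by simp
    moreover have "y \<cdot> d = y'" using assoc_right[OF d(2,1) t(2)] d(4) s(7) cmp_idt_right[OF t(2)] by simp
    ultimately show "(t, s) \<in> seq_equiv \<B> A C" using s d(5) unfolding seq_equiv_def by auto
  qed
  show "trans (seq_equiv \<B> A C)"
  proof (rule transI)
    fix s t u assume "(s, t) \<in> seq_equiv \<B> A C" "(t, u) \<in> seq_equiv \<B> A C"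
    then obtain x M y x' M' y' x'' M'' y'' b d where s: "s = (x, M, y)" "t = (x', M', y')" "u = (x'', M'', y'')"
      "s \<in> seqs \<B> A C" "u \<in> seqs \<B> A C" "b \<in> iso_mor \<B> M M'" "b \<cdot> x = x'" "y' \<cdot> b = y"
      "d \<in> iso_mor \<B> M' M''" "d \<cdot> x' = x''" "y'' \<cdot> d = y'" unfolding seq_equiv_def by auto
    then have t: "x \<in> arr A M" "y'' \<in> arr M'' C" by (auto simp: seqs_def)
    have "d \<cdot> b \<cdot> x = x''" using assoc_right[OF t(1) iso_mor_arr[OF s(6)] iso_mor_arr[OF s(9)]] s by simp
    moreover have "y'' \<cdot> (d \<cdot> b) = y"
      using cmp_assoc[OF iso_mor_arr[OF s(6)] iso_mor_arr[OF s(9)] t(2)] s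
      by simp
    ultimately show "(s, u) \<in> seq_equiv \<B> A C" using s iso_mor_cmp[OF s(6,9)] unfolding seq_equiv_def by auto
  qed
qed

lemma etri_arr: assumes "etri \<B> A x M y C \<delta>" shows "x \<in> arr A M" "y \<in> arr M C" "\<delta> \<in> ext \<B> C A"
proof -
  have "\<delta> \<in> ext \<B> C A" "(x, M, y) \<in> rlz \<B> C A \<delta>" using assms unfolding etri_def by auto
  then have "(x, M, y) \<in> seqs \<B> A C" using in_quotient_imp_subset[OF equiv_seq_equiv rlz_class] by blast
  then show "x \<in> arr A M" "y \<in> arr M C" "\<delta> \<in> ext \<B> C A" using \<open>\<delta> \<in> ext \<B> C A\<close> unfolding seqs_def by auto
qed

lemma etri_exists: assumes "\<delta> \<in> ext \<B> C A" shows "\<exists>x M y. etri \<B> A x M y C \<delta>"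
  using in_quotient_imp_non_empty[OF equiv_seq_equiv rlz_class[OF assms]] assms unfolding etri_def by auto

lemma etri_unique: assumes "etri \<B> A x M y C \<delta>" "etri \<B> A x' M' y' C \<delta>"
  shows "\<exists>b\<in>iso_mor \<B> M M'. b \<cdot> x = x' \<and> y' \<cdot> b = y"
proof -
  have "\<delta> \<in> ext \<B> C A" "(x, M, y) \<in> rlz \<B> C A \<delta>" "(x', M', y') \<in> rlz \<B> C A \<delta>"
    using assms
    unfolding etri_def
    by auto
  then have "((x, M, y), (x', M', y')) \<in> seq_equiv \<B> A C"
    using in_quotient_imp_in_rel[OF equiv_seq_equiv rlz_class]
    by blast
  then show ?thesis unfolding seq_equiv_def by auto
qed

lemma etri_iso: assumes e: "etri \<B> A x M y C \<delta>" and b: "b \<in> iso_mor \<B> M M'" "b \<cdot> x = x'" and y': "y' \<in> arr M' C"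
  "y' \<cdot> b = y"
  shows "etri \<B> A x' M' y' C \<delta>"
proof -
  have d: "\<delta> \<in> ext \<B> C A" "(x, M, y) \<in> rlz \<B> C A \<delta>" using e unfolding etri_def by auto
  have "((x, M, y), (x', M', y')) \<in> seq_equiv \<B> A C"
    unfolding seq_equiv_def seqs_def
      using etri_arr[OF e] b y' cmp_closed[OF etri_arr(1)[OF e] iso_mor_arr[OF b(1)]]
      by auto
  then have "(x', M', y') \<in> rlz \<B> C A \<delta>"
    using in_quotient_imp_closed[OF equiv_seq_equiv rlz_class[OF d(1)] d(2)]
    by blast
  then show ?thesis using d(1) unfolding etri_def by simp
qed

section \<open>Extension groups, duality and the exact sequences of a triangle\<close>

lemma ext_ag: "abelian_group (Ext \<B> C A)" by (rule abelian_group_Ext)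

lemma ext_zero: "zext C A \<in> ext \<B> C A"
  by (rule abelian_monoid.zero_closed[OF abelian_group.axioms(1)[OF ext_ag]])

lemma ext_add: "\<lbrakk>f \<in> ext \<B> C A; g \<in> ext \<B> C A\<rbrakk> \<Longrightarrow> f \<oplus>\<^bsub>Ext \<B> C A\<^esub> g \<in> ext \<B> C A"
  by (rule abelian_monoid.a_closed[OF abelian_group.axioms(1)[OF ext_ag]])

lemma ext_comm: "\<lbrakk>f \<in> ext \<B> C A; g \<in> ext \<B> C A\<rbrakk> \<Longrightarrow> f \<oplus>\<^bsub>Ext \<B> C A\<^esub> g = g \<oplus>\<^bsub>Ext \<B> C A\<^esub> f"
  by (rule abelian_monoid.a_comm[OF abelian_group.axioms(1)[OF ext_ag]])

lemma ext_add_zero: "f \<in> ext \<B> C A \<Longrightarrow> f \<oplus>\<^bsub>Ext \<B> C A\<^esub> (zext C A) = f"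
  by (rule abelian_monoid.r_zero[OF abelian_group.axioms(1)[OF ext_ag]])

lemma ext_zero_add: "f \<in> ext \<B> C A \<Longrightarrow> (zext C A) \<oplus>\<^bsub>Ext \<B> C A\<^esub> f = f"
  by (rule abelian_monoid.l_zero[OF abelian_group.axioms(1)[OF ext_ag]])

lemma ext_assoc: "\<lbrakk>f \<in> ext \<B> C A; g \<in> ext \<B> C A; h \<in> ext \<B> C A\<rbrakk> \<Longrightarrow> f \<oplus>\<^bsub>Ext \<B> C A\<^esub> g \<oplus>\<^bsub>Ext \<B> C A\<^esub> h = f \<oplus>\<^bsub>Ext \<B> C
  A\<^esub> (g \<oplus>\<^bsub>Ext \<B> C A\<^esub> h)"
  by (rule abelian_monoid.a_assoc[OF abelian_group.axioms(1)[OF ext_ag]])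

lemma ext_compl: assumes "f \<in> ext \<B> C A" "g \<in> ext \<B> C A"
  obtains h where "h \<in> ext \<B> C A" "h \<oplus>\<^bsub>Ext \<B> C A\<^esub> f = g"
proof
  interpret H: abelian_group "Ext \<B> C A" by (rule ext_ag)
  show "g \<oplus>\<^bsub>Ext \<B> C A\<^esub> (\<ominus>\<^bsub>Ext \<B> C A\<^esub> f) \<in> ext \<B> C A" using assms by (intro H.a_closed H.a_inv_closed)
  show "g \<oplus>\<^bsub>Ext \<B> C A\<^esub> (\<ominus>\<^bsub>Ext \<B> C A\<^esub> f) \<oplus>\<^bsub>Ext \<B> C A\<^esub> f = g"
    using assms H.a_assoc[OF assms(2) H.a_inv_closed[OF assms(1)] assms(1)] H.l_neg[OF assms(1)] H.r_zero
      by metis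
qed

lemma ext_zero_unique: assumes "f \<in> ext \<B> C A" "f \<oplus>\<^bsub>Ext \<B> C A\<^esub> g = f" "g \<in> ext \<B> C A" shows "g = zext C A"
proof -
  obtain n where n: "n \<in> ext \<B> C A" "n \<oplus>\<^bsub>Ext \<B> C A\<^esub> f = zext C A" using ext_compl[OF assms(1) ext_zero] by blast
  then show ?thesis using ext_assoc[OF n(1) assms(1,3)] assms(2) ext_zero_add[OF assms(3)] by simp
qed

lemma push_zero: assumes a: "a \<in> arr A A'" shows "push \<B> a (zext C A) = zext C A'"
  using ext_zero_unique[OF push_closed[OF a ext_zero] _ push_closed[OF a ext_zero]] push_add[OF a ext_zero
    ext_zero]
    ext_add_zero[OF ext_zero] by simp

lemma pull_zero: assumes c: "c \<in> arr C' C" shows "pull \<B> c (zext C A) = zext C' A"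
  using ext_zero_unique[OF pull_closed[OF c ext_zero] _ pull_closed[OF c ext_zero]] pull_add[OF c ext_zero
    ext_zero]
    ext_add_zero[OF ext_zero] by simp

lemma zero_push: assumes d: "\<delta> \<in> ext \<B> C A" shows "push \<B> (zmor A A') \<delta> = zext C A'"
  using ext_zero_unique[OF push_closed[OF zero_closed d] _ push_closed[OF zero_closed d]]
    push_add_mor[OF zero_closed zero_closed d] add_zero[OF zero_closed] by simp

lemma zero_pull: assumes d: "\<delta> \<in> ext \<B> C A" shows "pull \<B> (zmor C' C) \<delta> = zext C' A"
  using ext_zero_unique[OF pull_closed[OF zero_closed d] _ pull_closed[OF zero_closed d]]
    pull_add_mor[OF zero_closed zero_closed d] add_zero[OF zero_closed] by simp

lemma etri_split: "etri \<B> A (in1 \<B> A C) (A \<boxplus> C) (pr2 \<B> A C) C (zext C A)"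
  unfolding etri_def using rlz_zero ext_zero by blast

text \<open>The axioms come in dual pairs, so most cases exchange two of them. Only the realisations
  need work: an inverse isomorphism reverses an equivalence of sequences, and the swapped summands
  of \<open>op_cat\<close> must match the two terms of \<open>dsum_mor\<close> and
  \<open>dsum_ext\<close>.\<close>

lemma extriangulated_category_op_cat: "extriangulated_category K (op_cat \<B>)"
proof -
  show ?thesis
  proof (intro extriangulated_category.intro extriangulated_category_axioms.intro linear_category_op_cat, unfold
    op_cat_simps op_cat_etri, goal_cases)
    case (1 C A) show ?case by (rule abelian_group_Ext)
  next
    case 2 then show ?case by (rule pull_closed)
  next
    case 3 then show ?case by (rule push_closed)
  next
    case 4 then show ?case by (rule pull_add)
  next
    case 5 then show ?case by (rule push_add)
  next
    case 6 then show ?case by (rule pull_idt)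
  next
    case 7 then show ?case by (rule push_idt)
  next
    case 8 then show ?case by (rule pull_cmp)
  next
    case 9 then show ?case by (rule push_cmp)
  next
    case (10 a A A' c C' C \<delta>) then show ?case using push_pull[of c C C' a A' A \<delta>] by simp
  next
    case 11 then show ?case by (rule pull_add_mor)
  next
    case 12 then show ?case by (rule push_add_mor)
  next
    case (13 \<delta> C A)
    then obtain s where s: "s \<in> seqs \<B> C A" "rlz \<B> A C \<delta> = seq_equiv \<B> C A `` {s}"
      using rlz_class
      by (meson quotientE)
    obtain x M y where xy: "s = (x, M, y)" by (cases s) auto
    have "rlz (op_cat \<B>) C A \<delta> = seq_equiv (op_cat \<B>) A C `` {(y, M, x)}"
      using s xy seq_equiv_op_cat by (auto simp: op_cat_rlz)
    moreover have "(y, M, x) \<in> seqs (op_cat \<B>) A C" using s xy unfolding seqs_def by auto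
    ultimately show ?case by (simp add: quotientI)
  next
    case (14 A x M y C \<delta> A' x' M' y' C' \<delta>' a c)
    then show ?case using rlz_morphism[OF 14(2,1,4,3)] by metis
  next
    case (15 A C) show ?case unfolding op_cat_rlz by (rule rlz_zero)
  next
    case (16 A x M y C \<delta> A' x' M' y' C' \<delta>')
    note t = etri_arr[OF 16(1)] and t' = etri_arr[OF 16(2)]
    have m: "dsum_mor (op_cat \<B>) A A' M M' x x' = dsum_mor \<B> M' M A' A x' x"
      unfolding dsum_mor_def op_cat_simps
      using add_comm[OF cmp_closed[OF cmp_closed[OF pr2_closed t(2)] in2_closed] cmp_closed[OF cmp_closed[OF
        pr1_closed t'(2)] in1_closed]]
        cmp_assoc[OF pr2_closed t(2) in2_closed] cmp_assoc[OF pr1_closed t'(2) in1_closed] by simp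
    have n: "dsum_mor (op_cat \<B>) M M' C C' y y' = dsum_mor \<B> C' C M' M y' y"
      unfolding dsum_mor_def op_cat_simps
      using add_comm[OF cmp_closed[OF cmp_closed[OF pr2_closed t(1)] in2_closed] cmp_closed[OF cmp_closed[OF
        pr1_closed t'(1)] in1_closed]]
        cmp_assoc[OF pr2_closed t(1) in2_closed] cmp_assoc[OF pr1_closed t'(1) in1_closed] by simp
    have e: "dsum_ext (op_cat \<B>) C C' A A' \<delta> \<delta>' = dsum_ext \<B> A' A C' C \<delta>' \<delta>"
      unfolding dsum_ext_def op_cat_simps
      using push_pull[OF in2_closed pr2_closed t(3)] push_pull[OF in1_closed pr1_closed t'(3)]
        ext_comm[OF pull_closed[OF pr2_closed push_closed[OF in2_closed t(3)]] pull_closed[OF pr1_closed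
          push_closed[OF in1_closed t'(3)]]]
      by simp
    show ?case unfolding op_cat_rlz m n e by (rule rlz_dsum[OF 16(2,1)])
  next
    case (17 A x M y C \<delta> A' x' M' y' C' \<delta>' a b)
    then show ?case using ET3_op[OF 17(2,1,4,3)] by metis
  next
    case (18 A x M y C \<delta> A' x' M' y' C' \<delta>' b c)
    then show ?case using ET3[OF 18(2,1,4,3)] by metis
  next
    case (19 A f M f' D \<delta> g C g' F \<delta>')
    then show ?case by (rule ET4_op)
  next
    case (20 D f' M f A \<delta> F g' C g \<delta>')
    then show ?case by (rule ET4)
  qed
qed

text \<open>Comparison with the split triangle A -> A + 0 -> 0 by \<open>ET3\<close> makes
  \<open>y \<cdot> x\<close> factor through the zero object.\<close>

lemma tri_cmp: assumes e: "etri \<B> A x M y C \<delta>" shows "y \<cdot> x = zmor A C"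
proof -
  note t = etri_arr[OF e]
  have "\<exists>c\<in>arr (zob \<B>) C. c \<cdot> pr2 \<B> A (zob \<B>) = y \<cdot> (x \<cdot> pr1 \<B> A (zob \<B>)) \<and> push \<B> (idt \<B> A) (zext (zob \<B>) A) =
    pull \<B> c \<delta>"
    by (rule ET3[OF etri_split e idt_closed cmp_closed[OF pr1_closed t(1)]])
      (simp add: cmp_idt_right[OF t(1)] assoc_right[OF in1_closed pr1_closed t(1)] pr1_in1)
  then obtain c where "c \<in> arr (zob \<B>) C" "c \<cdot> pr2 \<B> A (zob \<B>) = y \<cdot> (x \<cdot> pr1 \<B> A (zob \<B>))" by blast
  then have z: "y \<cdot> (x \<cdot> pr1 \<B> A (zob \<B>)) = zmor (A \<boxplus> zob \<B>) C"
    using zob_initial zero_cmp[OF pr2_closed]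
    by (metis singletonD)
  have "y \<cdot> x = y \<cdot> (x \<cdot> (pr1 \<B> A (zob \<B>) \<cdot> in1 \<B> A (zob \<B>)))" using pr1_in1 cmp_idt_right[OF t(1)] by simp
  also have "... = y \<cdot> (x \<cdot> pr1 \<B> A (zob \<B>)) \<cdot> in1 \<B> A (zob \<B>)"
    using cmp_assoc[OF in1_closed pr1_closed t(1)] cmp_assoc[OF in1_closed cmp_closed[OF pr1_closed t(1)] t(2)]
      by simp
  finally show ?thesis using z zero_cmp[OF in1_closed] by simp
qed

text \<open>The map \<open>x\<close> and the inclusion of M in M + 0 form a square, which completes
  to a morphism of triangles whose third map ends at the zero object.\<close>

lemma tri_push_self: assumes e: "etri \<B> A x M y C \<delta>" shows "push \<B> x \<delta> = zext C M"
proof -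
  note t = etri_arr[OF e]
  have "\<exists>c\<in>arr C (zob \<B>). c \<cdot> y = pr2 \<B> M (zob \<B>) \<cdot> in1 \<B> M (zob \<B>) \<and> push \<B> x \<delta> = pull \<B> c (zext (zob \<B>) M)"
    by (rule ET3[OF e etri_split t(1) in1_closed]) simp
  then show ?thesis using pull_zero by auto
qed

lemma tri_ker: assumes e: "etri \<B> A x M y C \<delta>" and f: "f \<in> arr Z M" "y \<cdot> f = zmor Z C" shows "\<exists>a\<in>arr Z A. x \<cdot> a
  = f"
proof -
  note t = etri_arr[OF e]
  have "\<exists>a\<in>arr Z A. x \<cdot> a = f \<cdot> pr1 \<B> Z (zob \<B>) \<cdot> in1 \<B> Z (zob \<B>) \<and> push \<B> a (zext (zob \<B>) Z) = pull \<B> (zmor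
    (zob \<B>) C) \<delta>"
    by (rule ET3_op[OF etri_split e cmp_closed[OF pr1_closed f(1)] zero_closed])
      (simp add: cmp_assoc[OF pr1_closed f(1) t(2)] f(2) zero_cmp[OF pr1_closed] zero_cmp[OF pr2_closed])
  moreover have "f \<cdot> pr1 \<B> Z (zob \<B>) \<cdot> in1 \<B> Z (zob \<B>) = f"
    using assoc_right[OF in1_closed pr1_closed f(1)] pr1_in1 cmp_idt_right[OF f(1)] by simp
  ultimately show ?thesis by auto
qed

text \<open>The pair (a, 0) is a morphism from \<open>\<delta>\<close> to the split extension of 0
  by \<open>Z\<close>; a middle map realising it, projected to \<open>Z\<close>, is the required
  \<open>b\<close>.\<close>

lemma tri_extend: assumes e: "etri \<B> A x M y C \<delta>" and a: "a \<in> arr A Z" "push \<B> a \<delta> = zext C Z" shows "\<exists>b\<in>arr M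
  Z. b \<cdot> x = a"
proof -
  note t = etri_arr[OF e]
  have "\<exists>b\<in>arr M (Z \<boxplus> zob \<B>). b \<cdot> x = in1 \<B> Z (zob \<B>) \<cdot> a \<and> pr2 \<B> Z (zob \<B>) \<cdot> b = zmor C (zob \<B>) \<cdot> y"
    by (rule rlz_morphism[OF e etri_split a(1) zero_closed]) (simp add: a(2) pull_zero[OF zero_closed])
  then obtain b where b: "b \<in> arr M (Z \<boxplus> zob \<B>)" "b \<cdot> x = in1 \<B> Z (zob \<B>) \<cdot> a" by blast
  have "pr1 \<B> Z (zob \<B>) \<cdot> b \<cdot> x = a"
    using assoc_right[OF t(1) b(1) pr1_closed] b(2) cmp_assoc[OF a(1) in1_closed pr1_closed, of "zob \<B>"] pr1_in1
      cmp_idt_left[OF a(1)]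
      by simp
  then show ?thesis using cmp_closed[OF b(1) pr1_closed] by blast
qed

text \<open>Realise \<open>\<epsilon>\<close> by A -> G -> Z. As \<open>x\<close> kills
  \<open>\<epsilon>\<close>, it extends along A -> G, and \<open>ET3\<close> supplies the third map
  \<open>c\<close>.\<close>

lemma tri_ext_ker_push: assumes e: "etri \<B> A x M y C \<delta>" and d: "\<epsilon> \<in> ext \<B> Z A" "push \<B> x \<epsilon> = zext Z M"
  shows "\<exists>c\<in>arr Z C. \<epsilon> = pull \<B> c \<delta>"
proof -
  note t = etri_arr[OF e]
  obtain u G v where g: "etri \<B> A u G v Z \<epsilon>" using etri_exists[OF d(1)] by blast
  obtain b where b: "b \<in> arr G M" "b \<cdot> u = x" using tri_extend[OF g t(1) d(2)] by blast
  have "\<exists>c\<in>arr Z C. c \<cdot> v = y \<cdot> b \<and> push \<B> (idt \<B> A) \<epsilon> = pull \<B> c \<delta>"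
    by (rule ET3[OF g e idt_closed b(1)]) (simp add: b(2) cmp_idt_right[OF t(1)])
  then show ?thesis using push_idt[OF d(1)] by auto
qed

end

context extriangulated_category
begin

lemma tri_pull_self: "etri \<B> A x M y C \<delta> \<Longrightarrow> pull \<B> y \<delta> = zext M A"
  using extriangulated_category.tri_push_self[OF extriangulated_category_op_cat, of C y M x A \<delta>]
    by (simp add: op_cat_etri)

lemma tri_coker: "\<lbrakk>etri \<B> A x M y C \<delta>; f \<in> arr M Z; f \<cdot> x = zmor A Z\<rbrakk> \<Longrightarrow> \<exists>a\<in>arr C Z. a \<cdot> y = f"
  using extriangulated_category.tri_ker[OF extriangulated_category_op_cat, of C y M x A \<delta> f Z]
    by (simp add: op_cat_etri)

lemma tri_lift: "\<lbrakk>etri \<B> A x M y C \<delta>; c \<in> arr Z C; pull \<B> c \<delta> = zext Z A\<rbrakk> \<Longrightarrow> \<exists>b\<in>arr Z M. y \<cdot> b = c"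
  using extriangulated_category.tri_extend[OF extriangulated_category_op_cat, of C y M x A \<delta> c Z]
    by (simp add: op_cat_etri)

lemma tri_ext_ker_pull: "\<lbrakk>etri \<B> A x M y C \<delta>; \<epsilon> \<in> ext \<B> C Z; pull \<B> y \<epsilon> = zext M Z\<rbrakk> \<Longrightarrow> \<exists>a\<in>arr A Z. \<epsilon> = push \<B> a
  \<delta>"
  using extriangulated_category.tri_ext_ker_push[OF extriangulated_category_op_cat, of C y M x A \<delta> \<epsilon> Z]
    by (simp add: op_cat_etri)

text \<open>\<open>ET4\<close>, applied to the triangle and a realisation of
  \<open>\<epsilon>\<close>, yields C -> E -> Z with class \<open>push \<B> y \<epsilon>\<close>,
  which splits. The class over E, pulled back along a section, is the required preimage.\<close>

lemma tri_ext_mid_push: assumes e: "etri \<B> A x M y C \<delta>" and d: "\<epsilon> \<in> ext \<B> Z M" "push \<B> y \<epsilon> = zext Z C"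
  shows "\<exists>\<epsilon>'\<in>ext \<B> Z A. \<epsilon> = push \<B> x \<epsilon>'"
proof -
  note t = etri_arr[OF e]
  obtain g G g' where g: "etri \<B> M g G g' Z \<epsilon>" using etri_exists[OF d(1)] by blast
  obtain E a b h \<delta>' where h: "a \<in> arr C E" "b \<in> arr E Z" "etri \<B> C a E b Z (push \<B> y \<epsilon>)" "push \<B> x \<delta>' = pull \<B> b
    \<epsilon>"
    "etri \<B> A (g \<cdot> x) G h E \<delta>'" using ET4[OF e g] by blast
  obtain s where s: "s \<in> arr Z E" "b \<cdot> s = idt \<B> Z"
    using tri_lift[OF h(3) idt_closed] d(2) pull_zero[OF idt_closed] by auto
  note t' = etri_arr[OF h(5)]
  have "\<epsilon> = pull \<B> s (pull \<B> b \<epsilon>)" using pull_cmp[OF h(2) s(1) d(1)] s(2) pull_idt[OF d(1)] by simp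
  also have "... = push \<B> x (pull \<B> s \<delta>')" using h(4) push_pull[OF t(1) s(1) t'(3)] by simp
  finally show ?thesis using pull_closed[OF s(1) t'(3)] by blast
qed

end

context extriangulated_category
begin

lemma tri_ext_mid_pull: "\<lbrakk>etri \<B> A x M y C \<delta>; \<epsilon> \<in> ext \<B> M Z; pull \<B> x \<epsilon> = zext A Z\<rbrakk> \<Longrightarrow> \<exists>\<epsilon>'\<in>ext \<B> C Z. \<epsilon> = pull \<B>
  y \<epsilon>'"
  using extriangulated_category.tri_ext_mid_push[OF extriangulated_category_op_cat, of C y M x A \<delta> \<epsilon> Z]
    by (simp add: op_cat_etri)

lemma etri_zero_iso: assumes "etri \<B> A x M y C (zext C A)" shows "isomorphic \<B> M (A \<boxplus> C)"
  using etri_unique[OF assms etri_split] unfolding isomorphic_def by blast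

lemma biprod_etri: assumes b: "biprod \<B> A C T i p j q" shows "etri \<B> A i T q C (zext C A)"
proof -
  note b' = b[unfolded biprod_def]
  have p: "p \<in> arr T A" "q \<in> arr T C" "i \<in> arr A T" "j \<in> arr C T" using b' by auto
  note d = biprod_dsum[of A C]
  let ?f = "in1 \<B> A C \<cdot> p \<oplus>\<^bsub>Hom \<B> T (A \<boxplus> C)\<^esub> in2 \<B> A C \<cdot> q" and ?g = "i \<cdot> pr1 \<B> A C \<oplus>\<^bsub>Hom \<B> (A \<boxplus> C) T\<^esub> j \<cdot> pr2 \<B>
    A C"
  note f = biprod_mor_in[OF d p(1,2)] and g = biprod_mor_out[OF d p(3,4)]
  have "?g \<cdot> ?f = idt \<B> T" using biprod_mor_comp[OF d p(3,4) p(1,2)] b' by simp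
  moreover have "?f \<cdot> ?g = idt \<B> (A \<boxplus> C)"
    using biprod_mor_comp[OF b in1_closed in2_closed pr1_closed pr2_closed] in_pr_sum
    by simp
  ultimately have iso: "?g \<in> iso_mor \<B> (A \<boxplus> C) T" using iso_morI[OF g(1) f(1)] by simp
  have "q \<cdot> ?g = q \<cdot> i \<cdot> pr1 \<B> A C \<oplus>\<^bsub>Hom \<B> (A \<boxplus> C) C\<^esub> q \<cdot> j \<cdot> pr2 \<B> A C"
    using cmp_add_right[OF cmp_closed[OF pr1_closed p(3)] cmp_closed[OF pr2_closed p(4)] p(2)]
      cmp_assoc[OF pr1_closed p(3,2)] cmp_assoc[OF pr2_closed p(4,2)] by simp
  then have "q \<cdot> ?g = pr2 \<B> A C"
    using b' zero_cmp[OF pr1_closed] cmp_idt_left[OF pr2_closed] zero_add[OF pr2_closed]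
    by simp
  then show ?thesis by (rule etri_iso[OF etri_split iso g(2) p(2)])
qed

text \<open>Equivalence of sequences fixes both end terms, so transport along an isomorphism of the
  third term needs an argument. The comparison maps \<open>b\<close> and \<open>d\<close> are
  inverse to each other up to endomorphisms fixing both ends, and those are units.\<close>

lemma etri_base_iso: assumes e: "etri \<B> A x M y C \<delta>" and c: "c \<in> arr C C'" "c' \<in> arr C' C" "c' \<cdot> c = idt \<B> C" "c
  \<cdot> c' = idt \<B> C'"
  shows "etri \<B> A x M (c \<cdot> y) C' (pull \<B> c' \<delta>)"
proof -
  note t = etri_arr[OF e]
  obtain x' M' y' where e': "etri \<B> A x' M' y' C' (pull \<B> c' \<delta>)"
    using etri_exists[OF pull_closed[OF c(2) t(3)]]
    by blast
  note t' = etri_arr[OF e']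
  obtain b where b: "b \<in> arr M M'" "b \<cdot> x = x'" "y' \<cdot> b = c \<cdot> y"
    using rlz_morphism[OF e e' idt_closed c(1)] pull_cmp[OF c(2,1) t(3)] c(3) pull_idt[OF t(3)] push_idt[OF
      t(3)] cmp_idt_right[OF t'(1)]
      by auto
  obtain d where d: "d \<in> arr M' M" "d \<cdot> x' = x" "y \<cdot> d = c' \<cdot> y'"
    using rlz_morphism[OF e' e idt_closed c(2)] push_idt[OF t'(3)] cmp_idt_right[OF t(1)] by auto
  \<comment> \<open>Such an \<open>h\<close> is 1 - n with n u = 0 and v n = 0. Then n factors
    through \<open>v\<close>, so n n = 0 and 1 + n is the inverse of \<open>h\<close>.\<close>
  have nil: "h \<in> iso_mor \<B> N N" if e: "etri \<B> A u N v D \<xi>" and h: "h \<in> arr N N" "h \<cdot> u = u" "v \<cdot> h = v" for h N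
    u v D \<xi>
  proof -
    note t = etri_arr[OF e]
    obtain n where n: "n \<in> arr N N" "n \<oplus>\<^bsub>Hom \<B> N N\<^esub> h = idt \<B> N" using complement[OF h(1) idt_closed] by blast
    have nu: "n \<cdot> u \<in> arr A N" and vn: "v \<cdot> n \<in> arr N D" using cmp_closed n t by auto
    have "n \<cdot> u \<oplus>\<^bsub>Hom \<B> A N\<^esub> u = u"
      using cmp_add_left[OF t(1) n(1) h(1)] n(2) h(2) cmp_idt_left[OF t(1)]
      by simp
    then have 1: "n \<cdot> u = zmor A N" using zero_unique[OF t(1) _ nu] add_comm[OF nu t(1)] by simp
    have "v \<cdot> n \<oplus>\<^bsub>Hom \<B> N D\<^esub> v = v"
      using cmp_add_right[OF n(1) h(1) t(2)] n(2) h(3) cmp_idt_right[OF t(2)]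
      by simp
    then have 2: "v \<cdot> n = zmor N D" using zero_unique[OF t(2) _ vn] add_comm[OF vn t(2)] by simp
    obtain k where k: "k \<in> arr D N" "k \<cdot> v = n" using tri_coker[OF e n(1) 1] by blast
    have nn: "n \<cdot> n = zmor N N" using assoc_right[OF n(1) t(2) k(1)] k(2) 2 cmp_zero[OF k(1)] by simp
    have "h \<cdot> n = n"
      using cmp_add_left[OF n(1) n(1) h(1)] n(2) nn cmp_idt_left[OF n(1)] zero_add[OF cmp_closed[OF n(1) h(1)]]
      by simp
    moreover have "n \<cdot> h = n"
      using cmp_add_right[OF n(1) h(1) n(1)] n(2) nn cmp_idt_right[OF n(1)] zero_add[OF cmp_closed[OF h(1)
        n(1)]]
      by simp
    ultimately have "h \<cdot> (idt \<B> N \<oplus>\<^bsub>Hom \<B> N N\<^esub> n) = idt \<B> N" "(idt \<B> N \<oplus>\<^bsub>Hom \<B> N N\<^esub> n) \<cdot> h = idt \<B> N"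
      using cmp_add_right[OF idt_closed n(1) h(1)] cmp_add_left[OF h(1) idt_closed n(1)] cmp_idt_right[OF h(1)]
        cmp_idt_left[OF h(1)]
        n(2) add_comm[OF n(1) h(1)] by auto
    then show ?thesis using iso_morI[OF h(1) add_closed[OF idt_closed n(1)]] by simp
  qed
  have db: "d \<cdot> b \<in> iso_mor \<B> M M"
  proof (rule nil[OF e cmp_closed[OF b(1) d(1)]])
    show "d \<cdot> b \<cdot> x = x" using assoc_right[OF t(1) b(1) d(1)] b d by simp
    show "y \<cdot> (d \<cdot> b) = y"
      using cmp_assoc[OF b(1) d(1) t(2)] d(3) assoc_right[OF b(1) t'(2) c(2)] b(3) cmp_assoc[OF t(2) c(1,2)]
        c(3) cmp_idt_left[OF t(2)]
      by simp
  qed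
  have bd: "b \<cdot> d \<in> iso_mor \<B> M' M'"
  proof (rule nil[OF e' cmp_closed[OF d(1) b(1)]])
    show "b \<cdot> d \<cdot> x' = x'" using assoc_right[OF t'(1) d(1) b(1)] b d by simp
    show "y' \<cdot> (b \<cdot> d) = y'"
      using cmp_assoc[OF d(1) b(1) t'(2)] b(3) assoc_right[OF d(1) t(2) c(1)] d(3) cmp_assoc[OF t'(2) c(2,1)]
        c(4) cmp_idt_left[OF t'(2)]
      by simp
  qed
  obtain s where s: "s \<in> arr M M" "s \<cdot> (d \<cdot> b) = idt \<B> M" using iso_morE[OF db] by metis
  obtain r where r: "r \<in> arr M' M'" "b \<cdot> d \<cdot> r = idt \<B> M'" using iso_morE[OF bd] by metis
  have "b \<in> iso_mor \<B> M M'"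
    by (rule iso_mor_two_sided[OF b(1) cmp_closed[OF d(1) s(1)] _ cmp_closed[OF r(1) d(1)]])
      (simp_all add: assoc_right[OF b(1) d(1) s(1)] s(2) cmp_assoc[OF r(1) d(1) b(1)] r(2))
  then obtain b' where b': "b' \<in> iso_mor \<B> M' M" "b' \<in> arr M' M" "b' \<cdot> b = idt \<B> M" "b \<cdot> b' = idt \<B> M'"
    using iso_morE
    by metis
  have "b' \<cdot> x' = x" using cmp_assoc[OF t(1) b(1) b'(2)] b(2) b'(3) cmp_idt_left[OF t(1)] by simp
  moreover have "c \<cdot> y \<cdot> b' = y'"
    using assoc_right[OF b'(2) b(1) t'(2)] b(3) b'(4) cmp_idt_right[OF t'(2)]
    by simp
  ultimately show ?thesis by (rule etri_iso[OF e' b'(1) _ cmp_closed[OF t(2) c(1)]])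
qed

text \<open>\<open>ET4\<close> for the split A -> T -> A' and T -> M -> C produces a triangle A -> M
  -> E, and uniqueness of realisations identifies E with \<open>B\<close>. Its class is read off by
  applying \<open>p\<close> to the relation for its pushout along \<open>i\<close>.\<close>

lemma pullback_half:
  assumes e: "etri \<B> T u M v C \<nu>" and b: "biprod \<B> A A' T i p j q" and e2: "etri \<B> A' x B y C (push \<B> q \<nu>)"
  shows "\<exists>m h. etri \<B> A m M h B (pull \<B> y (push \<B> p \<nu>))"
proof -
  note b' = b[unfolded biprod_def]
  have bt: "i \<in> arr A T" "p \<in> arr T A" "q \<in> arr T A'" using b' by auto
  note t = etri_arr[OF e] and t2 = etri_arr[OF e2]
  obtain E d w h \<delta> where E: "d \<in> arr A' E" "w \<in> arr E C" "h \<in> arr M E"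
    "etri \<B> A (u \<cdot> i) M h E \<delta>" "etri \<B> A' d E w C (push \<B> q \<nu>)" "push \<B> i \<delta> = pull \<B> w \<nu>"
    using ET4[OF biprod_etri[OF b] e] by blast
  obtain k where k: "k \<in> iso_mor \<B> E B" "k \<cdot> d = x" "y \<cdot> k = w" using etri_unique[OF E(5) e2] by blast
  obtain k' where k': "k \<in> arr E B" "k' \<in> arr B E" "k' \<cdot> k = idt \<B> E" "k \<cdot> k' = idt \<B> B"
    using iso_morE[OF k(1)]
    by metis
  note te = etri_arr[OF E(4)]
  have "\<delta> = push \<B> p (push \<B> i \<delta>)" using push_cmp[OF bt(1,2) te(3)] b' push_idt[OF te(3)] by simp
  then have "\<delta> = pull \<B> w (push \<B> p \<nu>)" using E(6) push_pull[OF bt(2) E(2) t(3)] by simp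
  then have "pull \<B> k' \<delta> = pull \<B> (w \<cdot> k') (push \<B> p \<nu>)"
    using pull_cmp[OF E(2) k'(2) push_closed[OF bt(2) t(3)]]
    by simp
  moreover have "w \<cdot> k' = y" using assoc_right[OF k'(2,1) t2(2)] k(3) k'(4) cmp_idt_right[OF t2(2)] by simp
  ultimately show ?thesis using etri_base_iso[OF E(4) k'] by auto
qed

text \<open>Nakaoka--Palu, Proposition 3.15.\<close>

lemma pullback_square:
  assumes e1: "etri \<B> A x B y C \<delta>" and e2: "etri \<B> A' x' B' y' C \<delta>'"
  shows "\<exists>M m h m' h'. etri \<B> A m M h B' (pull \<B> y' \<delta>) \<and> etri \<B> A' m' M h' B (pull \<B> y \<delta>')"
proof -
  note t1 = etri_arr[OF e1] and t2 = etri_arr[OF e2]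
  let ?T = "A \<boxplus> A'"
  let ?a = "push \<B> (in1 \<B> A A') \<delta>" and ?b = "push \<B> (in2 \<B> A A') \<delta>'"
  \<comment> \<open>\<open>?n\<close> has components \<open>\<delta>\<close> and
    \<open>\<delta>'\<close>; its middle term is the pullback, seen over either factor.\<close>
  let ?n = "?a \<oplus>\<^bsub>Ext \<B> C ?T\<^esub> ?b"
  have ab: "?a \<in> ext \<B> C ?T" "?b \<in> ext \<B> C ?T"
    using push_closed[OF in1_closed t1(3)] push_closed[OF in2_closed t2(3)]
    by auto
  have 1: "push \<B> (pr1 \<B> A A') ?n = \<delta>"
    using push_add[OF pr1_closed ab] push_cmp[OF in1_closed pr1_closed t1(3)] push_cmp[OF in2_closed pr1_closed
      t2(3)]
      pr1_in1 pr1_in2 push_idt[OF t1(3)] zero_push[OF t2(3)] ext_add_zero[OF t1(3)] by simp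
  have 2: "push \<B> (pr2 \<B> A A') ?n = \<delta>'"
    using push_add[OF pr2_closed ab] push_cmp[OF in1_closed pr2_closed t1(3)] push_cmp[OF in2_closed pr2_closed
      t2(3)]
      pr2_in1 pr2_in2 push_idt[OF t2(3)] zero_push[OF t1(3)] ext_zero_add[OF t2(3)] by simp
  obtain u M v where e: "etri \<B> ?T u M v C ?n" using etri_exists[OF ext_add[OF ab]] by blast
  show ?thesis
    using pullback_half[OF e biprod_dsum, of x' B' y'] pullback_half[OF e biprod_swap[OF biprod_dsum], of x B y]
      e1 e2
      unfolding 1 2
      by blast
qed

end

context extriangulated_category
begin

lemma pushout_square:
  assumes "etri \<B> A x B y C \<delta>" and "etri \<B> A x' B' y' C' \<delta>'"
  shows "\<exists>M m h m' h'. etri \<B> B' m M h C (push \<B> x' \<delta>) \<and> etri \<B> B m' M h' C' (push \<B> x \<delta>')"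
  using extriangulated_category.pullback_square[OF extriangulated_category_op_cat, of C y B x A \<delta> C' y' B' x'
    \<delta>'] assms
  unfolding op_cat_etri op_cat_simps by blast

lemma inflation_cmp: assumes "inflation \<B> A M f" "inflation \<B> M C g" shows "inflation \<B> A C (g \<cdot> f)"
proof -
  obtain f' D \<delta> where f: "etri \<B> A f M f' D \<delta>" using assms(1) unfolding inflation_def by blast
  obtain g' F \<delta>' where g: "etri \<B> M g C g' F \<delta>'" using assms(2) unfolding inflation_def by blast
  show ?thesis using ET4[OF f g] unfolding inflation_def by blast
qed

text \<open>If a self-map of an extension \<open>\<delta>\<close> over \<open>1\<close> on the first term factors through \<open>C'\<close>, the difference of its
  third component and the identity factors through the middle term.\<close>

lemma third_term_retract:
  assumes e: "etri \<B> A x M y C \<delta>" and \<delta>': "\<delta>' \<in> ext \<B> C' A'"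
    and a: "a \<in> arr A A'" "a' \<in> arr A' A" "a' \<cdot> a = idt \<B> A" and c: "c \<in> arr C C'" "c' \<in> arr C' C"
    and m: "push \<B> a \<delta> = pull \<B> c \<delta>'" "push \<B> a' \<delta>' = pull \<B> c' \<delta>"
  shows "retract \<B> C (C' \<boxplus> M)"
proof -
  note t = etri_arr[OF e]
  have cc: "c' \<cdot> c \<in> arr C C" by (rule cmp_closed[OF c])
  have "\<delta> = push \<B> a' (pull \<B> c \<delta>')" using m(1) push_cmp[OF a(1,2) t(3)] a(3) push_idt[OF t(3)] by simp
  also have "... = pull \<B> (c' \<cdot> c) \<delta>" using push_pull[OF a(2) c(1) \<delta>'] m(2) pull_cmp[OF c(2,1) t(3)] by simp
  finally have 1: "pull \<B> (c' \<cdot> c) \<delta> = \<delta>" by simp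
  obtain n where n: "n \<in> arr C C" "n \<oplus>\<^bsub>Hom \<B> C C\<^esub> c' \<cdot> c = idt \<B> C" using complement[OF cc idt_closed] by blast
  have nd: "pull \<B> n \<delta> \<in> ext \<B> C A" by (rule pull_closed[OF n(1) t(3)])
  have "pull \<B> n \<delta> \<oplus>\<^bsub>Ext \<B> C A\<^esub> \<delta> = \<delta>" using pull_add_mor[OF n(1) cc t(3)] n(2) 1 pull_idt[OF t(3)] by simp
  then have "pull \<B> n \<delta> = zext C A" using ext_zero_unique[OF t(3) _ nd] ext_comm[OF nd t(3)] by simp
  then obtain s where s: "s \<in> arr C M" "y \<cdot> s = n" using tri_lift[OF e n(1)] by blast
  show ?thesis
    by (rule retract_sum[OF c(2) t(2) c(1) s(1)]) (use n s(2) add_comm[OF n(1) cc] in simp)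
qed

section \<open>Vanishing of extensions, projectives, and consequences of (WIC)\<close>

lemma Ext_vanishes_iff: "Ext_vanishes \<B> C A \<longleftrightarrow> (\<forall>\<delta>\<in>ext \<B> C A. \<delta> = zext C A)"
  unfolding Ext_vanishes_def using ext_zero[of C A] by auto

lemma Ext_vanishesD: "\<lbrakk>Ext_vanishes \<B> C A; \<delta> \<in> ext \<B> C A\<rbrakk> \<Longrightarrow> \<delta> = zext C A"
  unfolding Ext_vanishes_iff by blast

lemma ext_biprod_expand: assumes b: "biprod \<B> A C T i p j q" and d: "\<delta> \<in> ext \<B> T Z"
  shows "\<delta> = pull \<B> p (pull \<B> i \<delta>) \<oplus>\<^bsub>Ext \<B> T Z\<^esub> pull \<B> q (pull \<B> j \<delta>)"
proof -
  note b' = b[unfolded biprod_def]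
  then have t: "i \<in> arr A T" "p \<in> arr T A" "j \<in> arr C T" "q \<in> arr T C" by auto
  have "\<delta> = pull \<B> (i \<cdot> p \<oplus>\<^bsub>Hom \<B> T T\<^esub> j \<cdot> q) \<delta>" using b' pull_idt[OF d] by simp
  then show ?thesis
    using pull_add_mor[OF cmp_closed[OF t(2,1)] cmp_closed[OF t(4,3)] d] pull_cmp[OF t(1,2) d] pull_cmp[OF
      t(3,4) d]
    by simp
qed

text \<open>For \<open>a\<close> the identity the condition is the vanishing of E(Z, A). The general
  form is needed for the map \<open>\<eta>\<close> in the description of N * [R].\<close>

lemma push_kill_addclosed: assumes a: "a \<in> arr A C" shows "addclosed \<B> {Z. \<forall>\<epsilon>\<in>ext \<B> Z A. push \<B> a \<epsilon> = zext Z C}"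
  unfolding addclosed_def mem_Collect_eq
proof (intro conjI ballI allI impI; (unfold mem_Collect_eq)?)
  fix \<epsilon> assume k: "\<epsilon> \<in> ext \<B> (zob \<B>) A"
  have "\<epsilon> = zext (zob \<B>) A" using zob_null pull_idt[OF k] zero_pull[OF k] by metis
  then show "push \<B> a \<epsilon> = zext (zob \<B>) C" using push_zero[OF a] by simp
next
  fix D F \<epsilon> assume h: "\<forall>\<epsilon>\<in>ext \<B> D A. push \<B> a \<epsilon> = zext D C" "\<forall>\<epsilon>\<in>ext \<B> F A. push \<B> a \<epsilon> = zext F C" "\<epsilon> \<in> ext \<B> (D
    \<boxplus> F) A"
  have "pull \<B> (in1 \<B> D F) (push \<B> a \<epsilon>) = zext D C" "pull \<B> (in2 \<B> D F) (push \<B> a \<epsilon>) = zext F C"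
    using h push_pull[OF a in1_closed h(3)] push_pull[OF a in2_closed h(3)] pull_closed[OF in1_closed h(3)]
      pull_closed[OF in2_closed h(3)]
      by metis+
  then show "push \<B> a \<epsilon> = zext (D \<boxplus> F) C"
    using ext_biprod_expand[OF biprod_dsum push_closed[OF a h(3)]] pull_zero[OF pr1_closed] pull_zero[OF
      pr2_closed] ext_add_zero[OF ext_zero]
      by metis
next
  fix D F \<epsilon> assume h: "\<forall>\<epsilon>\<in>ext \<B> F A. push \<B> a \<epsilon> = zext F C" "retract \<B> D F" "\<epsilon> \<in> ext \<B> D A"
  obtain i p where i: "i \<in> arr D F" "p \<in> arr F D" "p \<cdot> i = idt \<B> D" using h(2) unfolding retract_def by blast
  have "\<epsilon> = pull \<B> i (pull \<B> p \<epsilon>)" using pull_cmp[OF i(2,1) h(3)] i(3) pull_idt[OF h(3)] by simp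
  then have "push \<B> a \<epsilon> = pull \<B> i (push \<B> a (pull \<B> p \<epsilon>))"
    using push_pull[OF a i(1) pull_closed[OF i(2) h(3)]]
    by simp
  then show "push \<B> a \<epsilon> = zext D C" using h(1) pull_closed[OF i(2) h(3)] pull_zero[OF i(1)] by simp
qed

lemma Ext_vanishes_left_addclosed: "addclosed \<B> {C. Ext_vanishes \<B> C A}"
proof -
  have "{C. Ext_vanishes \<B> C A} = {Z. \<forall>\<epsilon>\<in>ext \<B> Z A. push \<B> (idt \<B> A) \<epsilon> = zext Z A}"
    unfolding Ext_vanishes_iff using push_idt by auto
  then show ?thesis using push_kill_addclosed[OF idt_closed] by simp
qed

lemma projective_Ext: assumes P: "P \<in> projectives \<B>" shows "Ext_vanishes \<B> P A"
  unfolding Ext_vanishes_iff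
proof
  fix \<delta> assume d: "\<delta> \<in> ext \<B> P A"
  obtain x M y where e: "etri \<B> A x M y P \<delta>" using etri_exists[OF d] by blast
  then have "deflation \<B> M P y" unfolding deflation_def by blast
  then obtain s where s: "s \<in> arr P M" "y \<cdot> s = idt \<B> P" using P idt_closed unfolding projectives_def by blast
  have "\<delta> = pull \<B> s (pull \<B> y \<delta>)" using pull_cmp[OF etri_arr(2)[OF e] s(1) d] s(2) pull_idt[OF d] by simp
  then show "\<delta> = zext P A" using tri_pull_self[OF e] pull_zero[OF s(1)] by simp
qed

lemma projectives_addclosed: "addclosed \<B> (projectives \<B>)"
proof -
  have "projectives \<B> = (\<Inter>(M, D, y)\<in>{(M, D, y). deflation \<B> M D y}. {T. \<forall>g\<in>arr T D. \<exists>h\<in>arr T M. y \<cdot> h = g})"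
    unfolding projectives_def by auto
  moreover have "addclosed \<B> (\<Inter>(M, D, y)\<in>{(M, D, y). deflation \<B> M D y}. {T. \<forall>g\<in>arr T D. \<exists>h\<in>arr T M. y \<cdot> h =
    g})"
  proof -
    have "addclosed \<B> {T. \<forall>g\<in>arr T D. \<exists>h\<in>arr T M. y \<cdot> h = g}" if d: "deflation \<B> M D y" for M D y
    proof -
      have "y \<in> arr M D" using d etri_arr unfolding deflation_def by blast
      then show ?thesis by (rule factor_class_addclosed)
    qed
    then show ?thesis unfolding addclosed_def by (auto split: prod.splits) blast+
  qed
  ultimately show ?thesis by simp
qed

end

lemma op_cat_Ext_vanishes: "Ext_vanishes (op_cat \<B>) C A = Ext_vanishes \<B> A C"
  unfolding Ext_vanishes_def by simp

lemma op_cat_deflation: "deflation (op_cat \<B>) M C y = inflation \<B> C M y"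
  unfolding deflation_def inflation_def op_cat_etri by blast

lemma op_cat_projectives: "projectives (op_cat \<B>) = injectives \<B>"
  unfolding projectives_def injectives_def op_cat_deflation by auto

context extriangulated_category
begin

lemma Ext_vanishes_right_addclosed: "addclosed \<B> {A. Ext_vanishes \<B> C A}"
  using extriangulated_category.Ext_vanishes_left_addclosed[OF extriangulated_category_op_cat]
    by (simp add: op_cat_addclosed op_cat_Ext_vanishes)

lemma injective_Ext: "I \<in> injectives \<B> \<Longrightarrow> Ext_vanishes \<B> A I"
  using extriangulated_category.projective_Ext[OF extriangulated_category_op_cat]
    by (simp add: op_cat_projectives op_cat_Ext_vanishes)

lemma deflationI: "etri \<B> A x M y C \<delta> \<Longrightarrow> deflation \<B> M C y"
  unfolding deflation_def by blast

lemma inflationI: "etri \<B> A x M y C \<delta> \<Longrightarrow> inflation \<B> A M x"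
  unfolding inflation_def by blast

text \<open>The identity p i is an inflation, so (WIC) makes \<open>i\<close> one. Its class dies
  under \<open>i\<close>, hence under p i = 1, and the triangle splits.\<close>

lemma WIC_retract_summand: assumes W: "WIC \<B>" and r: "retract \<B> X Z" shows "summand \<B> X Z"
proof -
  obtain i p where i: "i \<in> arr X Z" "p \<in> arr Z X" "p \<cdot> i = idt \<B> X" using r unfolding retract_def by blast
  have "etri \<B> X (idt \<B> X) X (zmor X (zob \<B>)) (zob \<B>) (zext (zob \<B>) X)" by (rule biprod_etri[OF biprod_zob])
  then have "inflation \<B> X X (p \<cdot> i)" using inflationI i(3) by simp
  then have "inflation \<B> X Z i" using W i(1,2) unfolding WIC_def by blast
  then obtain y C \<delta> where e: "etri \<B> X i Z y C \<delta>" unfolding inflation_def by blast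
  note t = etri_arr[OF e]
  have "\<delta> = push \<B> p (push \<B> i \<delta>)" using push_cmp[OF i(1,2) t(3)] i(3) push_idt[OF t(3)] by simp
  then have "\<delta> = zext C X" using tri_push_self[OF e] push_zero[OF i(2)] by simp
  then show ?thesis using e etri_zero_iso unfolding summand_def by blast
qed

text \<open>Since retracts are summands, \<open>add_cl\<close> consists of the retracts of powers of
  \<open>U\<close>; closure under sums then only requires that direct sums of two lists combine into
  one.\<close>

lemma WIC_add_cl: assumes W: "WIC \<B>" shows "addclosed \<B> (add_cl \<B> U)" "U \<in> add_cl \<B> U"
proof -
  have eq: "add_cl \<B> U = {X. \<exists>n. retract \<B> X (dsum_list \<B> (replicate n U))}"
    unfolding add_cl_def using WIC_retract_summand[OF W] summand_retract by blast
  have app: "retract \<B> (dsum_list \<B> As \<boxplus> dsum_list \<B> Bs) (dsum_list \<B> (As @ Bs))" for As Bs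
  proof (induction As)
    case Nil
    let ?D = "dsum_list \<B> Bs"
    have "pr1 \<B> (zob \<B>) ?D = zmor (zob \<B> \<boxplus> ?D) (zob \<B>)" using null_mor(2)[OF zob_null] pr1_closed by blast
    then have "in2 \<B> (zob \<B>) ?D \<cdot> pr2 \<B> (zob \<B>) ?D = idt \<B> (zob \<B> \<boxplus> ?D)"
      using in_pr_sum[of "zob \<B>" ?D] cmp_zero[OF in1_closed] zero_add[OF cmp_closed[OF pr2_closed in2_closed]]
        by simp
    then have "retract \<B> (zob \<B> \<boxplus> ?D) ?D" using retractI[OF pr2_closed in2_closed] by blast
    then show ?case by (simp add: dsum_list_def)
  next
    case (Cons A As)
    let ?D = "dsum_list \<B> As" and ?F = "dsum_list \<B> Bs"
    have "retract \<B> ((A \<boxplus> ?D) \<boxplus> ?F) (A \<boxplus> (?D \<boxplus> ?F))"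
      using biprod_iso_dsum[OF biprod_swap[OF biprod_assoc[OF biprod_swap[OF biprod_dsum] biprod_dsum]]]
        retract_iso
        biprod_iso_dsum[OF biprod_assoc[OF biprod_swap[OF biprod_dsum[of "A \<boxplus> ?D" ?F]] biprod_dsum[of A ?D]]]
        retract_trans retract_dsum_mono[OF retract_refl, of "?F \<boxplus> ?D" "?D \<boxplus> ?F" A] biprod_iso_dsum[OF
          biprod_swap[OF biprod_dsum[of ?D ?F]]] isomorphic_sym
          by meson
    then show ?case
      using retract_trans[OF _ retract_dsum_mono[OF retract_refl Cons]]
      by (simp add: dsum_list_def)
  qed
  show "addclosed \<B> (add_cl \<B> U)" unfolding addclosed_def eq mem_Collect_eq
  proof (intro conjI ballI allI impI; (unfold mem_Collect_eq)?)
    show "\<exists>n. retract \<B> (zob \<B>) (dsum_list \<B> (replicate n U))"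
      using null_retract[OF zob_null] by blast
  next
    fix A C assume "\<exists>n. retract \<B> A (dsum_list \<B> (replicate n U))" "\<exists>n. retract \<B> C (dsum_list \<B> (replicate n
      U))"
    then obtain m n where "retract \<B> A (dsum_list \<B> (replicate m U))" "retract \<B> C (dsum_list \<B> (replicate n
      U))"
      by blast
    then have "retract \<B> (A \<boxplus> C) (dsum_list \<B> (replicate (m + n) U))"
      using retract_trans[OF retract_dsum_mono app] by (simp add: replicate_add)
    then show "\<exists>n. retract \<B> (A \<boxplus> C) (dsum_list \<B> (replicate n U))" by blast
  next
    fix A C assume "\<exists>n. retract \<B> C (dsum_list \<B> (replicate n U))" "retract \<B> A C"
    then show "\<exists>n. retract \<B> A (dsum_list \<B> (replicate n U))" using retract_trans by blast
  qed
  have "retract \<B> U (dsum_list \<B> (replicate 1 U))" using retract_dsum1 by (simp add: dsum_list_def)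
  then show "U \<in> add_cl \<B> U" unfolding eq by blast
qed

end

context linear_category
begin

lemma dsum_exchange: "isomorphic \<B> ((A \<boxplus> C) \<boxplus> (D \<boxplus> F)) ((A \<boxplus> D) \<boxplus> (C \<boxplus> F))"
  using biprod_iso_dsum[OF biprod_swap[OF biprod_assoc[OF biprod_assoc[OF biprod_swap[OF biprod_dsum]
    biprod_dsum]
    biprod_swap[OF biprod_assoc[OF biprod_swap[OF biprod_dsum] biprod_dsum]]]]] .

text \<open>Each local summand of \<open>T\<close> is a retract of \<open>A\<close> or of
  \<open>P\<close>, which sorts the decomposition into two parts. Since \<open>calR\<close> is
  defined by isomorphisms with such sums, this is what closes it under retracts.\<close>

lemma local_decomp_retract_dsum:
  "\<lbrakk>local_decomp \<B> n T; addclosed \<B> \<A>; addclosed \<B> \<P>; A \<in> \<A>; P \<in> \<P>; retract \<B> T (A \<boxplus> P)\<rbrakk> \<Longrightarrow>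
    \<exists>A'\<in>\<A>. \<exists>P'\<in>\<P>. isomorphic \<B> T (A' \<boxplus> P')"
proof (induction n arbitrary: T)
  case 0
  then have "T \<in> \<A>" using addclosed_null by simp
  moreover have "biprod \<B> T (zob \<B>) T (idt \<B> T) (idt \<B> T) (zmor (zob \<B>) T) (zmor T (zob \<B>))"
    by (rule biprod_zob)
  moreover have "zob \<B> \<in> \<P>" using 0 unfolding addclosed_def by blast
  ultimately show ?case using biprod_iso_dsum by blast
next
  case (Suc n)
  obtain B C i p j q where d: "biprod \<B> B C T i p j q" "local_obj \<B> B" "local_decomp \<B> n C"
    using Suc.prems(1)
    by auto
  have r: "retract \<B> B T" "retract \<B> C T" using d(1) unfolding biprod_def retract_def by auto
  obtain A' P' where A: "A' \<in> \<A>" "P' \<in> \<P>" "isomorphic \<B> C (A' \<boxplus> P')"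
    using Suc.IH[OF d(3) Suc.prems(2-5) retract_trans[OF r(2) Suc.prems(6)]] by blast
  obtain i' p' j' q' where b: "biprod \<B> A' P' C i' p' j' q'" using isomorphic_biprod[OF A(3)] by blast
  consider "retract \<B> B A" | "retract \<B> B P"
    using local_obj_retract_dsum[OF d(2) retract_trans[OF r(1) Suc.prems(6)]]
    by blast
  then show ?case
  proof cases
    case 1
    then have "B \<in> \<A>" using addclosed_retract Suc.prems by blast
    then have "B \<boxplus> A' \<in> \<A>" using addclosed_dsum Suc.prems(2) A(1) by blast
    then show ?thesis
      using biprod_iso_dsum[OF biprod_swap[OF biprod_assoc[OF d(1) biprod_swap[OF b]]]] A(2)
      by blast
  next
    case 2
    then have "B \<in> \<P>" using addclosed_retract Suc.prems by blast
    then have "B \<boxplus> P' \<in> \<P>" using addclosed_dsum Suc.prems(3) A(2) by blast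
    then show ?thesis using biprod_iso_dsum[OF biprod_assoc[OF d(1) b]] A(1) by blast
  qed
qed

end

section \<open>Extensions relative to \<open>R\<close>\<close>

locale relative_setting = extriangulated_category K \<B>
  for K :: "'k ring" and \<B> :: "('k, 'o, 'm, 'e) excat" (structure) +
  fixes R :: 'o
  assumes hf: "hom_finite K \<B>" and ks: "krull_schmidt \<B>"
    and ep: "enough_projectives \<B>" and ei: "enough_injectives \<B>" and wic: "WIC \<B>"
    and rigid: "rigid \<B> R" and R_projectives: "P \<in> projectives \<B> \<Longrightarrow> Ext_vanishes \<B> R P"
begin

section \<open>The subcategory \<open>\<R>\<close> and its relative extensions\<close>

abbreviation Add where "Add U \<equiv> add_cl \<B> U"
abbreviation \<R> where "\<R> \<equiv> calR \<B> R"
abbreviation \<H> where "\<H> \<equiv> calH \<B> R"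
abbreviation \<P> where "\<P> \<equiv> projectives \<B>"

lemmas add_addclosed = WIC_add_cl(1)[OF wic]
lemmas add_self = WIC_add_cl(2)[OF wic]

lemma finite_dim_Hom: "finite_dim K (Hom \<B> A C)"
  using hf unfolding hom_finite_def by blast

lemma local_decomp_exists: "\<exists>n. local_decomp \<B> n A"
  by (rule krull_schmidt_local_decomp[OF ks])

lemma zob_add: "zob \<B> \<in> Add U"
  using add_addclosed unfolding addclosed_def by blast

lemma zob_projective: "zob \<B> \<in> \<P>"
  using projectives_addclosed unfolding addclosed_def by blast

lemma calR_iff: "T \<in> \<R> \<longleftrightarrow> (\<exists>A\<in>Add R. \<exists>P\<in>\<P>. retract \<B> T (A \<boxplus> P))"
proof
  assume "T \<in> \<R>"
  then show "\<exists>A\<in>Add R. \<exists>P\<in>\<P>. retract \<B> T (A \<boxplus> P)" unfolding calR_def using retract_iso by blast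
next
  assume "\<exists>A\<in>Add R. \<exists>P\<in>\<P>. retract \<B> T (A \<boxplus> P)"
  then obtain A P where A: "A \<in> Add R" "P \<in> \<P>" "retract \<B> T (A \<boxplus> P)" by blast
  obtain n where "local_decomp \<B> n T" using local_decomp_exists by blast
  then show "T \<in> \<R>"
    unfolding calR_def
    using local_decomp_retract_dsum[OF _ add_addclosed projectives_addclosed A]
    by blast
qed

lemma calR_least: assumes T: "addclosed \<B> T" "R \<in> T" "\<P> \<subseteq> T" shows "\<R> \<subseteq> T"
proof
  fix Q assume "Q \<in> \<R>"
  then obtain A P where "A \<in> Add R" "P \<in> \<P>" "retract \<B> Q (A \<boxplus> P)" unfolding calR_iff by blast
  then show "Q \<in> T"
    using add_cl_least[OF T(1,2)] T(3) addclosed_dsum[OF T(1)] addclosed_retract[OF T(1)]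
    by blast
qed

lemma calR_addclosed: "addclosed \<B> \<R>"
  unfolding addclosed_def
proof (intro conjI ballI allI impI)
  show "zob \<B> \<in> \<R>" unfolding calR_iff using zob_add zob_projective retract_dsum1 by blast
next
  fix A C assume "A \<in> \<R>" "C \<in> \<R>"
  then obtain A1 P1 A2 P2 where A: "A1 \<in> Add R" "P1 \<in> \<P>" "retract \<B> A (A1 \<boxplus> P1)" "A2 \<in> Add R" "P2 \<in> \<P>" "retract
    \<B> C (A2 \<boxplus> P2)"
    unfolding calR_iff by blast
  have "retract \<B> ((A1 \<boxplus> P1) \<boxplus> (A2 \<boxplus> P2)) ((A1 \<boxplus> A2) \<boxplus> (P1 \<boxplus> P2))"
    using dsum_exchange by (rule retract_iso)
  then show "A \<boxplus> C \<in> \<R>" unfolding calR_iff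
    using retract_trans[OF retract_dsum_mono[OF A(3,6)]] addclosed_dsum[OF add_addclosed A(1,4)]
      addclosed_dsum[OF projectives_addclosed A(2,5)]
      by blast
next
  fix A C assume "C \<in> \<R>" "retract \<B> A C"
  then show "A \<in> \<R>" unfolding calR_iff using retract_trans by blast
qed

lemma R_calR: "R \<in> \<R>"
  unfolding calR_iff using add_self zob_projective retract_dsum1 by blast

lemma projectives_calR: "\<P> \<subseteq> \<R>"
proof
  fix P assume "P \<in> \<P>"
  then show "P \<in> \<R>" unfolding calR_iff using zob_add retract_dsum2 by blast
qed

lemma calR_calR: assumes "C \<in> \<R>" "A \<in> \<R>" shows "Ext_vanishes \<B> C A"
proof -
  have "\<R> \<subseteq> {A. Ext_vanishes \<B> R A}"
    by (rule calR_least[OF Ext_vanishes_right_addclosed]) (use rigid R_projectives in \<open>auto simp: rigid_def\<close>)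
  then have "\<R> \<subseteq> {C. Ext_vanishes \<B> C A}"
    by (intro calR_least[OF Ext_vanishes_left_addclosed]) (use assms projective_Ext in auto)
  then show ?thesis using assms by blast
qed

definition syzygies :: "'o set"
  where "syzygies = {W. \<exists>P\<in>\<P>. \<exists>Q\<in>\<R>. \<exists>u v \<rho>. etri \<B> W u P v Q \<rho>}"

text \<open>On \<open>\<H>\<close> these are the extensions pulled back from \<open>\<R>\<close> (\<open>rel_ext_calR\<close> and \<open>rel_ext_factor\<close>).\<close>

definition rel_ext :: "'o \<Rightarrow> 'o \<Rightarrow> 'e set"
  where "rel_ext C A = {\<delta> \<in> ext \<B> C A. \<forall>W\<in>syzygies. \<forall>t\<in>arr W C. pull \<B> t \<delta> = zext W A}"

definition rel_vanishes :: "'o \<Rightarrow> 'o \<Rightarrow> bool"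
  where "rel_vanishes C A \<longleftrightarrow> (\<forall>\<delta>\<in>rel_ext C A. \<delta> = zext C A)"

lemma rel_vanishesD: "\<lbrakk>rel_vanishes C A; \<delta> \<in> rel_ext C A\<rbrakk> \<Longrightarrow> \<delta> = zext C A"
  unfolding rel_vanishes_def by blast

lemma rel_ext_ext: "\<delta> \<in> rel_ext C A \<Longrightarrow> \<delta> \<in> ext \<B> C A"
  unfolding rel_ext_def by blast

lemma rel_ext_syzygies: "\<lbrakk>\<delta> \<in> rel_ext C A; W \<in> syzygies; t \<in> arr W C\<rbrakk> \<Longrightarrow> pull \<B> t \<delta> = zext W A"
  unfolding rel_ext_def by blast

lemma rel_ext_push: assumes d: "\<delta> \<in> rel_ext C A" and a: "a \<in> arr A A'" shows "push \<B> a \<delta> \<in> rel_ext C A'"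
  unfolding rel_ext_def using push_closed[OF a rel_ext_ext[OF d]] push_pull[OF a _ rel_ext_ext[OF d], symmetric]
    rel_ext_syzygies[OF d] push_zero[OF a] by simp

lemma rel_ext_pull: assumes d: "\<delta> \<in> rel_ext C A" and c: "c \<in> arr C' C" shows "pull \<B> c \<delta> \<in> rel_ext C' A"
  unfolding rel_ext_def using pull_closed[OF c rel_ext_ext[OF d]] pull_cmp[OF c _ rel_ext_ext[OF d], symmetric]
    rel_ext_syzygies[OF d] cmp_closed[OF _ c] by simp

text \<open>A map from a syzygy W to Q extends to the projective P, because objects of
  \<open>\<R>\<close> have no extensions with each other; so the class restricted to W passes
  through E(P, A) = 0.\<close>

lemma rel_ext_calR: assumes Q: "Q \<in> \<R>" and c: "c \<in> arr C Q" and k: "\<kappa> \<in> ext \<B> Q A"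
  shows "pull \<B> c \<kappa> \<in> rel_ext C A"
  unfolding rel_ext_def
proof (intro CollectI conjI ballI)
  show "pull \<B> c \<kappa> \<in> ext \<B> C A" by (rule pull_closed[OF c k])
  fix W t assume W: "W \<in> syzygies" and t: "t \<in> arr W C"
  obtain P Q' u v \<rho> where e: "P \<in> \<P>" "Q' \<in> \<R>" "etri \<B> W u P v Q' \<rho>" using W unfolding syzygies_def by blast
  note te = etri_arr[OF e(3)]
  have ct: "c \<cdot> t \<in> arr W Q" by (rule cmp_closed[OF t c])
  obtain b where b: "b \<in> arr P Q" "b \<cdot> u = c \<cdot> t"
    using tri_extend[OF e(3) ct Ext_vanishesD[OF calR_calR[OF e(2) Q] push_closed[OF ct te(3)]]] by blast
  have "pull \<B> t (pull \<B> c \<kappa>) = pull \<B> u (pull \<B> b \<kappa>)"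
    using pull_cmp[OF c t k] pull_cmp[OF b(1) te(1) k] b(2) by simp
  then show "pull \<B> t (pull \<B> c \<kappa>) = zext W A"
    using Ext_vanishesD[OF projective_Ext[OF e(1)] pull_closed[OF b(1) k]] pull_zero[OF te(1)] by simp
qed

lemma rel_ext_of_calR: "\<lbrakk>Q \<in> \<R>; \<kappa> \<in> ext \<B> Q A\<rbrakk> \<Longrightarrow> \<kappa> \<in> rel_ext Q A"
  using rel_ext_calR[OF _ idt_closed] pull_idt by metis

text \<open>Take C -> Q -> Q' with Q, Q' in \<open>\<R>\<close> and pull back along a deflation from
  a projective P to Q'. The pullback is C + P on one side, since P is projective, and an extension
  of Q by a syzygy on the other.\<close>

lemma calH_presentation: assumes C: "C \<in> \<H>"
  shows "\<exists>W P M m r w v Q \<kappa>. W \<in> syzygies \<and> P \<in> \<P> \<and> Q \<in> \<R> \<and> m \<in> arr C M \<and> r \<in> arr M C \<and> r \<cdot> m = idt \<B> C \<and>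
    isomorphic \<B> M (C \<boxplus> P) \<and> etri \<B> W w M v Q \<kappa>"
proof -
  obtain Q Q' x y \<rho> where e: "Q \<in> \<R>" "Q' \<in> \<R>" "etri \<B> C x Q y Q' \<rho>" using C unfolding calH_def by blast
  obtain W u P v \<rho>' where w: "P \<in> \<P>" "etri \<B> W u P v Q' \<rho>'" using ep unfolding enough_projectives_def by blast
  have W: "W \<in> syzygies" unfolding syzygies_def using w e by blast
  obtain M m h m' h' where s: "etri \<B> C m M h P (pull \<B> v \<rho>)" "etri \<B> W m' M h' Q (pull \<B> y \<rho>')"
    using pullback_square[OF e(3) w(2)] by blast
  have z: "pull \<B> v \<rho> = zext P C" using Ext_vanishesD[OF projective_Ext[OF w(1)] etri_arr(3)[OF s(1)]] .
  obtain r where "r \<in> arr M C" "r \<cdot> m = idt \<B> C"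
    using tri_extend[OF s(1) idt_closed] z push_zero[OF idt_closed] by auto
  then show ?thesis using W w(1) e(1) etri_arr(1)[OF s(1)] etri_zero_iso[OF s(1)[unfolded z]] s(2) by blast
qed

text \<open>Carried over to C + P, the class dies on the syzygy W and so comes from Q by exactness;
  restricting back to C gives the factorisation.\<close>

lemma rel_ext_factor: assumes C: "C \<in> \<H>" and d: "\<delta> \<in> rel_ext C A"
  shows "\<exists>Q\<in>\<R>. \<exists>c\<in>arr C Q. \<exists>\<kappa>\<in>ext \<B> Q A. \<delta> = pull \<B> c \<kappa>"
proof -
  obtain W P M m r w v Q \<kappa>' where p: "W \<in> syzygies" "Q \<in> \<R>" "m \<in> arr C M" "r \<in> arr M C" "r \<cdot> m = idt \<B> C" "etri
    \<B> W w M v Q \<kappa>'"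
    using calH_presentation[OF C] by blast
  note t = etri_arr[OF p(6)] and d' = rel_ext_ext[OF d]
  have "pull \<B> w (pull \<B> r \<delta>) = zext W A" using rel_ext_syzygies[OF rel_ext_pull[OF d p(4)] p(1) t(1)] .
  then obtain \<kappa> where k: "\<kappa> \<in> ext \<B> Q A" "pull \<B> r \<delta> = pull \<B> v \<kappa>"
    using tri_ext_mid_pull[OF p(6) pull_closed[OF p(4) d']]
    by blast
  have "\<delta> = pull \<B> m (pull \<B> r \<delta>)" using pull_cmp[OF p(4,3) d'] p(5) pull_idt[OF d'] by simp
  then have "\<delta> = pull \<B> (v \<cdot> m) \<kappa>" using k pull_cmp[OF t(2) p(3) k(1)] by simp
  then show ?thesis using p(2) k(1) cmp_closed[OF p(3) t(2)] by blast
qed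

text \<open>Objects of \<open>\<R>\<close> are thus relatively injective over \<open>\<H>\<close>,
  which is what allows maps into them to be extended.\<close>

lemma rel_vanishes_calR: assumes "C \<in> \<H>" "Q \<in> \<R>" shows "rel_vanishes C Q"
  unfolding rel_vanishes_def
proof
  fix \<delta> assume "\<delta> \<in> rel_ext C Q"
  then obtain Q' c \<kappa> where "Q' \<in> \<R>" "c \<in> arr C Q'" "\<kappa> \<in> ext \<B> Q' Q" "\<delta> = pull \<B> c \<kappa>"
    using rel_ext_factor[OF assms(1)]
    by blast
  then show "\<delta> = zext C Q" using Ext_vanishesD[OF calR_calR[OF _ assms(2)]] pull_zero by metis
qed

text \<open>Every class over Q is a pushout of a syzygy sequence along some W -> C. As
  \<open>\<delta>\<close> is relative, this map lifts to \<open>B\<close>, and the lift gives the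
  preimage.\<close>

lemma Ext_calR_onto: assumes e: "etri \<B> A x B y C \<delta>" and d: "\<delta> \<in> rel_ext C A" and Q: "Q \<in> \<R>" and k: "\<epsilon> \<in> ext \<B> Q
  C"
  shows "\<exists>\<epsilon>'\<in>ext \<B> Q B. push \<B> y \<epsilon>' = \<epsilon>"
proof -
  note t = etri_arr[OF e]
  obtain W u P v \<rho> where w: "P \<in> \<P>" "etri \<B> W u P v Q \<rho>" using ep unfolding enough_projectives_def by blast
  note tw = etri_arr[OF w(2)]
  have W: "W \<in> syzygies" unfolding syzygies_def using w Q by blast
  obtain a where a: "a \<in> arr W C" "\<epsilon> = push \<B> a \<rho>"
    using tri_ext_ker_pull[OF w(2) k Ext_vanishesD[OF projective_Ext[OF w(1)] pull_closed[OF tw(2) k]]] by blast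
  obtain b where b: "b \<in> arr W B" "y \<cdot> b = a" using tri_lift[OF e a(1) rel_ext_syzygies[OF d W a(1)]] by blast
  show ?thesis using push_closed[OF b(1) tw(3)] push_cmp[OF b(1) t(2) tw(3)] b(2) a(2) by metis
qed

lemma rel_ext_onto_push: assumes e: "etri \<B> A x B y C \<delta>" and d: "\<delta> \<in> rel_ext C A" and Z: "Z \<in> \<H>" and k: "\<epsilon> \<in>
  rel_ext Z C"
  shows "\<exists>\<epsilon>'\<in>rel_ext Z B. push \<B> y \<epsilon>' = \<epsilon>"
proof -
  obtain Q c \<kappa> where f: "Q \<in> \<R>" "c \<in> arr Z Q" "\<kappa> \<in> ext \<B> Q C" "\<epsilon> = pull \<B> c \<kappa>"
    using rel_ext_factor[OF Z k]
    by blast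
  obtain \<kappa>' where k': "\<kappa>' \<in> ext \<B> Q B" "push \<B> y \<kappa>' = \<kappa>" using Ext_calR_onto[OF e d f(1,3)] by blast
  show ?thesis
    using rel_ext_calR[OF f(1,2) k'(1)] push_pull[OF etri_arr(2)[OF e] f(2) k'(1)] k'(2) f(4)
    by metis
qed

text \<open>The map A -> Q that induces \<open>\<epsilon>\<close> extends to \<open>B\<close>: the
  obstruction is a relative extension of \<open>C\<close> by an object of \<open>\<R>\<close>, and
  those vanish.\<close>

lemma rel_ext_onto_pull: assumes e: "etri \<B> A x B y C \<delta>" and d: "\<delta> \<in> rel_ext C A" and A: "A \<in> \<H>" and C: "C \<in> \<H>"
  and k: "\<epsilon> \<in> rel_ext A Z"
  shows "\<exists>\<epsilon>'\<in>rel_ext B Z. pull \<B> x \<epsilon>' = \<epsilon>"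
proof -
  obtain Q c \<kappa> where f: "Q \<in> \<R>" "c \<in> arr A Q" "\<kappa> \<in> ext \<B> Q Z" "\<epsilon> = pull \<B> c \<kappa>"
    using rel_ext_factor[OF A k]
    by blast
  obtain b where b: "b \<in> arr B Q" "b \<cdot> x = c"
    using tri_extend[OF e f(2) rel_vanishesD[OF rel_vanishes_calR[OF C f(1)] rel_ext_push[OF d f(2)]]] by blast
  show ?thesis using rel_ext_calR[OF f(1) b(1) f(3)] pull_cmp[OF b(1) etri_arr(1)[OF e] f(3)] b(2) f(4) by metis
qed

lemma rel_vanishes_quotient: "\<lbrakk>etri \<B> A x B y C \<delta>; \<delta> \<in> rel_ext C A; Z \<in> \<H>; rel_vanishes Z B\<rbrakk> \<Longrightarrow> rel_vanishes Z C"
  using rel_ext_onto_push push_zero[OF etri_arr(2)] unfolding rel_vanishes_def by metis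

lemma rel_vanishes_sub: "\<lbrakk>etri \<B> A x B y C \<delta>; \<delta> \<in> rel_ext C A; A \<in> \<H>; C \<in> \<H>; rel_vanishes B Z\<rbrakk> \<Longrightarrow> rel_vanishes A
  Z"
  using rel_ext_onto_pull pull_zero[OF etri_arr(1)] unfolding rel_vanishes_def by metis

text \<open>By exactness a class over \<open>C\<close> is a pushout of \<open>\<delta>\<close> along
  some \<open>a\<close>; as \<open>a\<close> extends along \<open>x\<close>, it is zero. The
  hypothesis on maps holds when \<open>x\<close> is a left approximation.\<close>

lemma rel_vanishes_cokernel: assumes e: "etri \<B> A x B y C \<delta>" and f: "\<And>a. a \<in> arr A T \<Longrightarrow> \<exists>b\<in>arr B T. b \<cdot> x = a"
  and B: "rel_vanishes B T"
  shows "rel_vanishes C T"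
  unfolding rel_vanishes_def
proof
  fix \<epsilon> assume k: "\<epsilon> \<in> rel_ext C T"
  note t = etri_arr[OF e]
  obtain a where a: "a \<in> arr A T" "\<epsilon> = push \<B> a \<delta>"
    using tri_ext_ker_pull[OF e rel_ext_ext[OF k] rel_vanishesD[OF B rel_ext_pull[OF k t(2)]]]
    by blast
  obtain b where b: "b \<in> arr B T" "b \<cdot> x = a" using f[OF a(1)] by blast
  show "\<epsilon> = zext C T" using push_cmp[OF t(1) b(1) t(3)] a(2) b(2) tri_push_self[OF e] push_zero[OF b(1)] by simp
qed

lemma rel_vanishes_kernel: assumes e: "etri \<B> A x B y C \<delta>" and f: "\<And>c. c \<in> arr T C \<Longrightarrow> \<exists>b\<in>arr T B. y \<cdot> b = c" and
  B: "rel_vanishes T B"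
  shows "rel_vanishes T A"
  unfolding rel_vanishes_def
proof
  fix \<epsilon> assume k: "\<epsilon> \<in> rel_ext T A"
  note t = etri_arr[OF e]
  obtain c where c: "c \<in> arr T C" "\<epsilon> = pull \<B> c \<delta>"
    using tri_ext_ker_push[OF e rel_ext_ext[OF k] rel_vanishesD[OF B rel_ext_push[OF k t(1)]]]
    by blast
  obtain b where b: "b \<in> arr T B" "y \<cdot> b = c" using f[OF c(1)] by blast
  show "\<epsilon> = zext T A" using pull_cmp[OF t(2) b(1) t(3)] c(2) b(2) tri_pull_self[OF e] pull_zero[OF b(1)] by simp
qed

lemma rel_vanishes_retract_left: assumes "rel_vanishes D A" "retract \<B> C D" shows "rel_vanishes C A"
  unfolding rel_vanishes_def
proof
  fix \<delta> assume d: "\<delta> \<in> rel_ext C A"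
  obtain i p where i: "i \<in> arr C D" "p \<in> arr D C" "p \<cdot> i = idt \<B> C"
    using assms(2)
    unfolding retract_def
    by blast
  have "\<delta> = pull \<B> i (pull \<B> p \<delta>)"
    using pull_cmp[OF i(2,1) rel_ext_ext[OF d]] i(3) pull_idt[OF rel_ext_ext[OF d]]
    by simp
  then show "\<delta> = zext C A" using rel_vanishesD[OF assms(1) rel_ext_pull[OF d i(2)]] pull_zero[OF i(1)] by simp
qed

lemma rel_vanishes_retract_right: assumes "rel_vanishes A D" "retract \<B> C D" shows "rel_vanishes A C"
  unfolding rel_vanishes_def
proof
  fix \<delta> assume d: "\<delta> \<in> rel_ext A C"
  obtain i p where i: "i \<in> arr C D" "p \<in> arr D C" "p \<cdot> i = idt \<B> C"
    using assms(2)
    unfolding retract_def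
    by blast
  have "\<delta> = push \<B> p (push \<B> i \<delta>)"
    using push_cmp[OF i(1,2) rel_ext_ext[OF d]] i(3) push_idt[OF rel_ext_ext[OF d]]
    by simp
  then show "\<delta> = zext A C" using rel_vanishesD[OF assms(1) rel_ext_push[OF d i(1)]] push_zero[OF i(2)] by simp
qed

lemma rel_vanishes_null: "idt \<B> C = zmor C C \<Longrightarrow> rel_vanishes C A" "idt \<B> A = zmor A A \<Longrightarrow> rel_vanishes C A"
  unfolding rel_vanishes_def using rel_ext_ext pull_idt zero_pull push_idt zero_push by metis+

lemma rel_vanishes_dsum_left: assumes a: "rel_vanishes C A" "rel_vanishes D A" shows "rel_vanishes (C \<boxplus> D) A"
  unfolding rel_vanishes_def
proof
  fix \<delta> assume d: "\<delta> \<in> rel_ext (C \<boxplus> D) A"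
  show "\<delta> = zext (C \<boxplus> D) A"
    using ext_biprod_expand[OF biprod_dsum rel_ext_ext[OF d]] rel_vanishesD[OF a(1) rel_ext_pull[OF d
      in1_closed]] rel_vanishesD[OF a(2) rel_ext_pull[OF d in2_closed]]
      pull_zero[OF pr1_closed] pull_zero[OF pr2_closed] ext_add_zero[OF ext_zero] by metis
qed

lemma rel_vanishes_dsum_right: assumes a: "rel_vanishes A C" "rel_vanishes A D" shows "rel_vanishes A (C \<boxplus> D)"
  unfolding rel_vanishes_def
proof
  fix \<delta> assume d: "\<delta> \<in> rel_ext A (C \<boxplus> D)"
  note d' = rel_ext_ext[OF d]
  have z: "push \<B> (pr1 \<B> C D) \<delta> = zext A C" "push \<B> (pr2 \<B> C D) \<delta> = zext A D"
    using rel_vanishesD[OF a(1) rel_ext_push[OF d pr1_closed]] rel_vanishesD[OF a(2) rel_ext_push[OF d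
      pr2_closed]] .
  have "\<delta> = push \<B> (in1 \<B> C D \<cdot> pr1 \<B> C D \<oplus>\<^bsub>Hom \<B> (C \<boxplus> D) (C \<boxplus> D)\<^esub> in2 \<B> C D \<cdot> pr2 \<B> C D) \<delta>"
    using in_pr_sum push_idt[OF d']
    by simp
  also have "... = push \<B> (in1 \<B> C D) (push \<B> (pr1 \<B> C D) \<delta>) \<oplus>\<^bsub>Ext \<B> A (C \<boxplus> D)\<^esub> push \<B> (in2 \<B> C D) (push \<B> (pr2
    \<B> C D) \<delta>)"
    using push_add_mor[OF cmp_closed[OF pr1_closed in1_closed] cmp_closed[OF pr2_closed in2_closed] d']
      push_cmp[OF pr1_closed in1_closed d'] push_cmp[OF pr2_closed in2_closed d'] by simp
  finally show "\<delta> = zext A (C \<boxplus> D)"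
    using z push_zero[OF in1_closed] push_zero[OF in2_closed] ext_add_zero[OF ext_zero]
    by simp
qed

lemma rel_vanishes_left_addclosed: "addclosed \<B> {C. rel_vanishes C A}"
  unfolding addclosed_def
    using rel_vanishes_dsum_left rel_vanishes_retract_left rel_vanishes_null(1) zob_null
    by auto

lemma rel_vanishes_right_addclosed: "addclosed \<B> {A. rel_vanishes C A}"
  unfolding addclosed_def
    using rel_vanishes_dsum_right rel_vanishes_retract_right rel_vanishes_null(2) zob_null
    by auto

lemma rel_vanishes_add_left: "\<lbrakk>rel_vanishes C A; T \<in> Add C\<rbrakk> \<Longrightarrow> rel_vanishes T A"
  using add_cl_least[OF rel_vanishes_left_addclosed] by blast

lemma rel_vanishes_add_right: "\<lbrakk>rel_vanishes C A; T \<in> Add A\<rbrakk> \<Longrightarrow> rel_vanishes C T"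
  using add_cl_least[OF rel_vanishes_right_addclosed] by blast

section \<open>Rigidity as vanishing of relative self-extensions\<close>

lemma injective_triangle: obtains j \<delta> where "inj_obj \<B> N \<in> injectives \<B>" "etri \<B> N j (inj_obj \<B> N) (inj_defl \<B>
  N) (Sig \<B> N) \<delta>"
proof -
  let ?P = "\<lambda>(j, I, i, S, \<delta>). I \<in> injectives \<B> \<and> etri \<B> N j I i S \<delta>"
  have "\<exists>t. ?P t" using ei unfolding enough_injectives_def by auto
  then have "?P (inj_tri \<B> N)" unfolding inj_tri_def by (rule someI_ex)
  then show ?thesis using that unfolding inj_obj_def inj_defl_def Sig_def by (auto split: prod.splits)
qed

lemma injective_ext_pull: assumes I: "I \<in> injectives \<B>" and e: "etri \<B> N j I i S \<iota>" and k: "\<kappa> \<in> ext \<B> C N"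
  shows "\<exists>c\<in>arr C S. \<kappa> = pull \<B> c \<iota>"
  using tri_ext_ker_push[OF e k Ext_vanishesD[OF injective_Ext[OF I] push_closed[OF etri_arr(1)[OF e] k]]] .

text \<open>Pulling back \<open>\<iota>\<close> turns maps X -> \<Sigma>X into extensions, and those
  that lift to the injective object go to zero. Maps through add R give the classes pulled back from
  \<open>\<R>\<close>, which on \<open>\<H>\<close> are the relative ones.\<close>

lemma R_rigid_iff: assumes X: "X \<in> \<H>" shows "R_rigid \<B> R X \<longleftrightarrow> rel_vanishes X X"
proof -
  obtain j \<iota> where I: "inj_obj \<B> X \<in> injectives \<B>" "etri \<B> X j (inj_obj \<B> X) (inj_defl \<B> X) (Sig \<B> X) \<iota>"
    by (rule injective_triangle)
  note t = etri_arr[OF I(2)]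
  have bar: "f \<in> R_mor_bar \<B> R X X \<longleftrightarrow> f \<in> R_mor \<B> R X X \<and> pull \<B> f \<iota> = zext X X" for f
  proof
    assume f: "f \<in> R_mor_bar \<B> R X X"
    then obtain h where h: "h \<in> arr X (inj_obj \<B> X)" "f = inj_defl \<B> X \<cdot> h" unfolding R_mor_bar_def by blast
    show "f \<in> R_mor \<B> R X X \<and> pull \<B> f \<iota> = zext X X"
      using f h(2) pull_cmp[OF t(2) h(1) t(3)] tri_pull_self[OF I(2)] pull_zero[OF h(1)]
        unfolding R_mor_bar_def
        by simp
  next
    assume f: "f \<in> R_mor \<B> R X X \<and> pull \<B> f \<iota> = zext X X"
    then have "f \<in> arr X (Sig \<B> X)" unfolding R_mor_def by blast
    then show "f \<in> R_mor_bar \<B> R X X" unfolding R_mor_bar_def using tri_lift[OF I(2)] f by blast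
  qed
  show ?thesis
  proof
    assume r: "R_rigid \<B> R X"
    show "rel_vanishes X X" unfolding rel_vanishes_def
    proof
      fix \<delta> assume "\<delta> \<in> rel_ext X X"
      then obtain Q c \<kappa> where Q: "Q \<in> \<R>" "c \<in> arr X Q" "\<kappa> \<in> ext \<B> Q X" "\<delta> = pull \<B> c \<kappa>"
        using rel_ext_factor[OF X]
        by blast
      obtain A P where A: "A \<in> Add R" "P \<in> \<P>" "isomorphic \<B> Q (A \<boxplus> P)" using Q(1) unfolding calR_def by blast
      obtain i p k q where b: "biprod \<B> A P Q i p k q" using isomorphic_biprod[OF A(3)] by blast
      then have tb: "i \<in> arr A Q" "p \<in> arr Q A" "k \<in> arr P Q" "q \<in> arr Q P" unfolding biprod_def by auto
      \<comment> \<open>The projective part of Q carries no extensions, so the class already comes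
        from the part \<open>A\<close> in add R, as \<open>R_mor\<close> demands.\<close>
      have "pull \<B> k \<kappa> = zext P X"
        by (rule Ext_vanishesD[OF projective_Ext[OF A(2)] pull_closed[OF tb(3) Q(3)]])
      then have "\<kappa> = pull \<B> p (pull \<B> i \<kappa>)"
        using ext_biprod_expand[OF b Q(3)] pull_zero[OF tb(4)] ext_add_zero[OF pull_closed[OF tb(2)
          pull_closed[OF tb(1) Q(3)]]]
          by simp
      then have d: "\<delta> = pull \<B> (p \<cdot> c) (pull \<B> i \<kappa>)"
        using Q(4) pull_cmp[OF tb(2) Q(2) pull_closed[OF tb(1) Q(3)]]
        by simp
      obtain s where s: "s \<in> arr A (Sig \<B> X)" "pull \<B> i \<kappa> = pull \<B> s \<iota>"
        using injective_ext_pull[OF I pull_closed[OF tb(1) Q(3)]]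
        by blast
      have pc: "p \<cdot> c \<in> arr X A" by (rule cmp_closed[OF Q(2) tb(2)])
      have "s \<cdot> (p \<cdot> c) \<in> R_mor \<B> R X X"
        unfolding R_mor_def factors_through_def
        using cmp_closed[OF pc s(1)] A(1) pc s(1)
        by blast
      then have "pull \<B> (s \<cdot> (p \<cdot> c)) \<iota> = zext X X" using r bar unfolding R_rigid_def by blast
      then show "\<delta> = zext X X" using d s(2) pull_cmp[OF s(1) pc t(3)] by simp
    qed
  next
    assume r: "rel_vanishes X X"
    have "f \<in> R_mor_bar \<B> R X X" if f: "f \<in> R_mor \<B> R X X" for f
    proof -
      obtain T a b where ab: "T \<in> Add R" "a \<in> arr X T" "b \<in> arr T (Sig \<B> X)" "f = b \<cdot> a"
        using f unfolding R_mor_def factors_through_def by blast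
      have "T \<in> \<R>" using ab(1) zob_projective retract_dsum1 unfolding calR_iff by blast
      then have "pull \<B> a (pull \<B> b \<iota>) \<in> rel_ext X X"
        using rel_ext_calR[OF _ ab(2) pull_closed[OF ab(3) t(3)]]
        by blast
      then show ?thesis using bar f ab(4) pull_cmp[OF ab(3,2) t(3)] rel_vanishesD[OF r] by simp
    qed
    then show "R_rigid \<B> R X" unfolding R_rigid_def R_mor_bar_def by blast
  qed
qed

section \<open>Closure properties of \<open>\<H>\<close>, and the classes N * [R]\<close>

lemma calR_calH: assumes Q: "Q \<in> \<R>" shows "Q \<in> \<H>"
proof -
  have "etri \<B> Q (in1 \<B> Q (zob \<B>)) (Q \<boxplus> zob \<B>) (pr2 \<B> Q (zob \<B>)) (zob \<B>) (zext (zob \<B>) Q)" by (rule etri_split)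
  moreover have "zob \<B> \<in> \<R>" using calR_addclosed unfolding addclosed_def by blast
  ultimately show ?thesis unfolding calH_def using addclosed_dsum[OF calR_addclosed Q] by blast
qed

text \<open>The cone E of Z -> V -> S is an extension of S' by Q; both lie in \<open>\<R>\<close>,
  so it splits and E lies in \<open>\<R>\<close>.\<close>

lemma calH_kernel: assumes V: "V \<in> \<H>" and e: "etri \<B> Z x V y Q \<delta>" and Q: "Q \<in> \<R>" shows "Z \<in> \<H>"
proof -
  obtain S S' u v \<rho> where s: "S \<in> \<R>" "S' \<in> \<R>" "etri \<B> V u S v S' \<rho>" using V unfolding calH_def by blast
  obtain E d w h \<delta>' where E: "etri \<B> Z (u \<cdot> x) S h E \<delta>'" "etri \<B> Q d E w S' (push \<B> y \<rho>)"
    using ET4[OF e s(3)] by blast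
  have "push \<B> y \<rho> = zext S' Q" using Ext_vanishesD[OF calR_calR[OF s(2) Q] etri_arr(3)[OF E(2)]] .
  then have "isomorphic \<B> E (Q \<boxplus> S')" using etri_zero_iso E(2) by metis
  then have "E \<in> \<R>"
    using addclosed_retract[OF calR_addclosed addclosed_dsum[OF calR_addclosed Q s(2)] retract_iso]
    by blast
  then show ?thesis using E(1) s(1) unfolding calH_def by blast
qed

text \<open>The two instances of interest are \<open>i = p = 1\<close>, for a map through which \<open>X \<rightarrow> S\<close> factors, and \<open>b = 1\<close>, for a
  direct summand \<open>A\<close> of \<open>X\<close>.\<close>

lemma cone_calR:
  assumes e: "etri \<B> A x M y C \<delta>" and X: "etri \<B> X u S v S' \<rho>" "S' \<in> \<R>" and M: "M \<in> \<R>"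
    and i: "i \<in> arr A X" "p \<in> arr X A" "p \<cdot> i = idt \<B> A" and b: "b \<in> arr M S" "b \<cdot> x = u \<cdot> i"
  shows "C \<in> \<R>"
proof -
  note t = etri_arr[OF e] and tX = etri_arr[OF X(1)]
  obtain c where c: "c \<in> arr C S'" "push \<B> i \<delta> = pull \<B> c \<rho>"
    using ET3[OF e X(1) i(1) b(1) b(2)[symmetric]]
    by blast
  have xp: "x \<cdot> p \<in> arr X M" by (rule cmp_closed[OF i(2) t(1)])
  obtain d where d: "d \<in> arr S M" "d \<cdot> u = x \<cdot> p"
    using tri_extend[OF X(1) xp Ext_vanishesD[OF calR_calR[OF X(2) M] push_closed[OF xp tX(3)]]] by blast
  obtain c' where c': "c' \<in> arr S' C" "push \<B> p \<rho> = pull \<B> c' \<delta>"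
    using ET3[OF X(1) e i(2) d(1) d(2)[symmetric]]
    by blast
  have "retract \<B> C (S' \<boxplus> M)" by (rule third_term_retract[OF e tX(3) i c(1) c'(1) c(2) c'(2)])
  then show ?thesis using addclosed_retract[OF calR_addclosed addclosed_dsum[OF calR_addclosed X(2) M]] by blast
qed

text \<open>(WIC) makes the inclusion of \<open>A\<close> an inflation; its composite with X -> S
  has a cone in \<open>\<R>\<close> by \<open>cone_calR\<close>.\<close>

lemma calH_retract: assumes X: "X \<in> \<H>" and r: "retract \<B> A X" shows "A \<in> \<H>"
proof -
  obtain S S' u v \<rho> where s: "S \<in> \<R>" "S' \<in> \<R>" "etri \<B> X u S v S' \<rho>" using X unfolding calH_def by blast
  obtain i p where i: "i \<in> arr A X" "p \<in> arr X A" "p \<cdot> i = idt \<B> A" using r unfolding retract_def by blast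
  have "etri \<B> A (idt \<B> A) A (zmor A (zob \<B>)) (zob \<B>) (zext (zob \<B>) A)" by (rule biprod_etri[OF biprod_zob])
  then have "inflation \<B> A X i" using wic i inflationI unfolding WIC_def by metis
  then have "inflation \<B> A S (u \<cdot> i)" using inflation_cmp inflationI[OF s(3)] by blast
  then obtain y C \<delta> where e: "etri \<B> A (u \<cdot> i) S y C \<delta>" unfolding inflation_def by blast
  have "C \<in> \<R>" by (rule cone_calR[OF e s(3,2,1) i idt_closed]) (rule cmp_idt_left[OF etri_arr(1)[OF e]])
  then show ?thesis using e s(1) unfolding calH_def by blast
qed

text \<open>The cone E of X -> V -> Q sits in a triangle C -> E -> Q', so it suffices that E lies in
  \<open>\<R>\<close>. This is \<open>cone_calR\<close>, because X -> S factors through Q.\<close>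

lemma calH_cokernel: assumes e: "etri \<B> X x V y C \<delta>" and V: "V \<in> \<H>"
    and X: "etri \<B> X u S v S' \<rho>" "S \<in> \<R>" "S' \<in> \<R>" and h: "h \<in> arr V S" "h \<cdot> x = u"
  shows "C \<in> \<H>"
proof -
  obtain Q Q' q q' \<kappa> where s: "Q \<in> \<R>" "Q' \<in> \<R>" "etri \<B> V q Q q' Q' \<kappa>" using V unfolding calH_def by blast
  note t = etri_arr[OF e] and ts = etri_arr[OF s(3)] and tX = etri_arr[OF X(1)]
  obtain E d w k \<delta>' where E: "etri \<B> X (q \<cdot> x) Q k E \<delta>'" "etri \<B> C d E w Q' (push \<B> y \<kappa>)"
    using ET4[OF e s(3)] by blast
  obtain b where b: "b \<in> arr Q S" "b \<cdot> q = h"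
    using tri_extend[OF s(3) h(1) Ext_vanishesD[OF calR_calR[OF s(2) X(2)] push_closed[OF h(1) ts(3)]]] by blast
  have "E \<in> \<R>"
  proof (rule cone_calR[OF E(1) X(1,3) s(1) idt_closed idt_closed cmp_idt_left[OF idt_closed] b(1)])
    show "b \<cdot> (q \<cdot> x) = u \<cdot> idt \<B> X"
      using cmp_assoc[OF t(1) ts(1) b(1)] b(2) h(2) cmp_idt_right[OF tX(1)]
      by simp
  qed
  then show ?thesis using E(2) s(2) unfolding calH_def by blast
qed

lemma calH_dsum: assumes "A \<in> \<H>" "C \<in> \<H>" shows "A \<boxplus> C \<in> \<H>"
proof -
  obtain S S' u v \<rho> where s: "S \<in> \<R>" "S' \<in> \<R>" "etri \<B> A u S v S' \<rho>" using assms(1) unfolding calH_def by blast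
  obtain Q Q' q q' \<kappa> where k: "Q \<in> \<R>" "Q' \<in> \<R>" "etri \<B> C q Q q' Q' \<kappa>" using assms(2) unfolding calH_def by blast
  have "dsum_ext \<B> S' Q' A C \<rho> \<kappa> \<in> ext \<B> (S' \<boxplus> Q') (A \<boxplus> C)" unfolding dsum_ext_def
    using ext_add[OF push_closed[OF in1_closed pull_closed[OF pr1_closed etri_arr(3)[OF s(3)]]]
      push_closed[OF in2_closed pull_closed[OF pr2_closed etri_arr(3)[OF k(3)]]]] .
  then have "etri \<B> (A \<boxplus> C) (dsum_mor \<B> A C S Q u q) (S \<boxplus> Q) (dsum_mor \<B> S Q S' Q' v q') (S' \<boxplus> Q') (dsum_ext \<B>
    S' Q' A C \<rho> \<kappa>)"
    using rlz_dsum[OF s(3) k(3)] unfolding etri_def by blast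
  then show ?thesis
    using addclosed_dsum[OF calR_addclosed s(1) k(1)] addclosed_dsum[OF calR_addclosed s(2) k(2)]
    unfolding calH_def
    by blast
qed

lemma calH_addclosed: "addclosed \<B> \<H>"
  unfolding addclosed_def using calH_dsum calH_retract calR_calH calR_addclosed unfolding addclosed_def by blast

lemma calH_Add: "\<lbrakk>U \<in> \<H>; T \<in> Add U\<rbrakk> \<Longrightarrow> T \<in> \<H>"
  using add_cl_least[OF calH_addclosed] by blast

text \<open>A projective is added to the third term at the cost of adding it to the middle: the part
  of the new middle term over \<open>C\<close> is \<open>B\<close> again, and the quotient P splits
  off.\<close>

lemma etri_add_summand: assumes e: "etri \<B> A x B y C \<delta>" and P: "P \<in> \<P>"
  shows "\<exists>x' B' y'. etri \<B> A x' B' y' (C \<boxplus> P) (pull \<B> (pr1 \<B> C P) \<delta>) \<and> retract \<B> B' (B \<boxplus> P)"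
proof -
  note t = etri_arr[OF e]
  obtain x' B' y' where e': "etri \<B> A x' B' y' (C \<boxplus> P) (pull \<B> (pr1 \<B> C P) \<delta>)"
    using etri_exists[OF pull_closed[OF pr1_closed t(3)]]
    by blast
  obtain E d w h \<delta>' where E: "d \<in> arr E C" "w \<in> arr A E" "etri \<B> E h B' (pr2 \<B> C P \<cdot> y') P \<delta>'"
    "etri \<B> A w E d C (pull \<B> (in1 \<B> C P) (pull \<B> (pr1 \<B> C P) \<delta>))" using ET4_op[OF etri_split e'] by blast
  have "pull \<B> (in1 \<B> C P) (pull \<B> (pr1 \<B> C P) \<delta>) = \<delta>"
    using pull_cmp[OF pr1_closed in1_closed t(3)] pr1_in1 pull_idt[OF t(3)]
    by simp
  then have "isomorphic \<B> E B" using etri_unique E(4) e unfolding isomorphic_def by force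
  then have r: "retract \<B> E B" by (rule retract_iso)
  have "\<delta>' = zext P E" using Ext_vanishesD[OF projective_Ext[OF P] etri_arr(3)[OF E(3)]] .
  then have i: "isomorphic \<B> B' (E \<boxplus> P)" using etri_zero_iso E(3) by metis
  then have "retract \<B> B' (B \<boxplus> P)"
    using retract_trans[OF retract_iso retract_dsum_mono[OF r retract_refl]]
    by blast
  then show ?thesis using e' by blast
qed

text \<open>X + P is an extension of some Q in \<open>\<R>\<close> by a syzygy W. Over W the class
  vanishes, so the part of the enlarged middle term over W is Y + W. It is also the kernel of a
  deflation from an object of \<open>\<H>\<close> to Q, hence lies in \<open>\<H>\<close>.\<close>

lemma calH_kernel_rel_ext: assumes e: "etri \<B> Y y V f X \<delta>" and d: "\<delta> \<in> rel_ext X Y" and V: "V \<in> \<H>" and X: "X \<in>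
  \<H>"
  shows "Y \<in> \<H>"
proof -
  obtain W P M m r w v Q \<kappa> where p: "W \<in> syzygies" "P \<in> \<P>" "Q \<in> \<R>" "m \<in> arr X M" "r \<in> arr M X" "r \<cdot> m = idt \<B> X"
    "isomorphic \<B> M (X \<boxplus> P)" "etri \<B> W w M v Q \<kappa>" using calH_presentation[OF X] by blast
  obtain a where a: "a \<in> iso_mor \<B> M (X \<boxplus> P)" using p(7) unfolding isomorphic_def by blast
  then obtain a' where a': "a \<in> arr M (X \<boxplus> P)" "a' \<in> arr (X \<boxplus> P) M" "a' \<cdot> a = idt \<B> M" "a \<cdot> a' = idt \<B> (X \<boxplus> P)"
    using iso_morE
    by metis
  obtain x' B' y' where b: "etri \<B> Y x' B' y' (X \<boxplus> P) (pull \<B> (pr1 \<B> X P) \<delta>)" "retract \<B> B' (V \<boxplus> P)"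
    using etri_add_summand[OF e p(2)] by blast
  note tb = etri_arr[OF b(1)] and tp = etri_arr[OF p(8)]
  have B': "B' \<in> \<H>" using calH_retract[OF calH_dsum[OF V] b(2)] calR_calH projectives_calR p(2) by blast
  have e2': "etri \<B> Y x' B' (a' \<cdot> y') M (pull \<B> a (pull \<B> (pr1 \<B> X P) \<delta>))"
    using etri_base_iso[OF b(1) a'(2,1,4,3)] .
  obtain E d' k h \<delta>' where E: "etri \<B> E h B' (v \<cdot> (a' \<cdot> y')) Q \<delta>'" "etri \<B> Y k E d' W (pull \<B> w (pull \<B> a (pull
    \<B> (pr1 \<B> X P) \<delta>)))"
    using ET4_op[OF p(8) e2'] by blast
  have "pull \<B> w (pull \<B> a (pull \<B> (pr1 \<B> X P) \<delta>)) = zext W Y"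
    using rel_ext_syzygies[OF rel_ext_pull[OF rel_ext_pull[OF d pr1_closed] a'(1)] p(1) tp(1)] .
  then have "isomorphic \<B> E (Y \<boxplus> W)" using etri_zero_iso E(2) by metis
  then have "retract \<B> Y E" using retract_trans[OF retract_dsum1 retract_iso[OF isomorphic_sym]] by blast
  then show ?thesis using calH_retract[OF calH_kernel[OF B' E(1) p(3)]] by blast
qed

text \<open>As I is injective, every class in E(R, N') is pulled back from S. So a class in E(R, A)
  comes from N' exactly if it is pulled back from S, that is, if \<open>\<eta>\<close> kills it; and
  killing all of E(R, A) is equivalent to factoring through \<open>R_perp\<close>.\<close>

lemma star_iff: "A \<in> star \<B> R N \<longleftrightarrow> (\<exists>N'\<in>Add N. \<exists>m\<in>arr N' A. \<forall>\<epsilon>\<in>ext \<B> R A. \<exists>\<epsilon>'\<in>ext \<B> R N'. push \<B> m \<epsilon>' = \<epsilon>)"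
proof
  assume "A \<in> star \<B> R N"
  then obtain N' I u v S \<delta> \<eta> C q \<delta>' m i where s: "N' \<in> Add N" "I \<in> injectives \<B>"
    "etri_morphism \<B> N' u I v S \<delta> A \<eta> C q S \<delta>' m i (idt \<B> S)" "factors_through \<B> A C (R_perp \<B> R) \<eta>"
    unfolding star_def by blast
  note s3 = s(3)[unfolded etri_morphism_def]
  have e: "etri \<B> N' u I v S \<delta>" "etri \<B> A \<eta> C q S \<delta>'" "m \<in> arr N' A" "push \<B> m \<delta> = pull \<B> (idt \<B> S) \<delta>'"
    using s3
    by auto
  note t = etri_arr[OF e(1)] and t' = etri_arr[OF e(2)]
  have \<delta>': "\<delta>' = push \<B> m \<delta>" using e(4) pull_idt[OF t'(3)] by simp
  obtain T a b where T: "T \<in> R_perp \<B> R" "a \<in> arr A T" "b \<in> arr T C" "\<eta> = b \<cdot> a"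
    using s(4)
    unfolding factors_through_def
    by blast
  have "\<exists>\<epsilon>'\<in>ext \<B> R N'. push \<B> m \<epsilon>' = \<epsilon>" if k: "\<epsilon> \<in> ext \<B> R A" for \<epsilon>
  proof -
    have "push \<B> a \<epsilon> = zext R T"
      using T(1) R_calR Ext_vanishesD push_closed[OF T(2) k]
      unfolding R_perp_def
      by blast
    then have "push \<B> \<eta> \<epsilon> = zext R C" using T(4) push_cmp[OF T(2,3) k] push_zero[OF T(3)] by simp
    then obtain c where c: "c \<in> arr R S" "\<epsilon> = pull \<B> c \<delta>'" using tri_ext_ker_push[OF e(2) k] by blast
    then show ?thesis using \<delta>' push_pull[OF e(3) c(1) t(3)] pull_closed[OF c(1) t(3)] by metis
  qed
  then show "\<exists>N'\<in>Add N. \<exists>m\<in>arr N' A. \<forall>\<epsilon>\<in>ext \<B> R A. \<exists>\<epsilon>'\<in>ext \<B> R N'. push \<B> m \<epsilon>' = \<epsilon>" using s(1) e(3) by blast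
next
  assume "\<exists>N'\<in>Add N. \<exists>m\<in>arr N' A. \<forall>\<epsilon>\<in>ext \<B> R A. \<exists>\<epsilon>'\<in>ext \<B> R N'. push \<B> m \<epsilon>' = \<epsilon>"
  then obtain N' m where m: "N' \<in> Add N" "m \<in> arr N' A" "\<And>\<epsilon>. \<epsilon> \<in> ext \<B> R A \<Longrightarrow> \<exists>\<epsilon>'\<in>ext \<B> R N'. push \<B> m \<epsilon>' = \<epsilon>"
    by blast
  obtain u I v S \<delta> where I: "I \<in> injectives \<B>" "etri \<B> N' u I v S \<delta>"
    using ei
    unfolding enough_injectives_def
    by blast
  note t = etri_arr[OF I(2)]
  obtain \<eta> C q where e: "etri \<B> A \<eta> C q S (push \<B> m \<delta>)" using etri_exists[OF push_closed[OF m(2) t(3)]] by blast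
  note t' = etri_arr[OF e]
  obtain i where i: "i \<in> arr I C" "i \<cdot> u = \<eta> \<cdot> m" "q \<cdot> i = idt \<B> S \<cdot> v"
    using rlz_morphism[OF I(2) e m(2) idt_closed] pull_idt[OF t'(3)] by auto
  have mor: "etri_morphism \<B> N' u I v S \<delta> A \<eta> C q S (push \<B> m \<delta>) m i (idt \<B> S)"
    unfolding etri_morphism_def using I(2) e m(2) i idt_closed pull_idt[OF t'(3)] by simp
  have kill: "push \<B> \<eta> \<epsilon> = zext R C" if k: "\<epsilon> \<in> ext \<B> R A" for \<epsilon>
  proof -
    obtain \<epsilon>' where k': "\<epsilon>' \<in> ext \<B> R N'" "push \<B> m \<epsilon>' = \<epsilon>" using m(3)[OF k] by blast
    obtain c where c: "c \<in> arr R S" "\<epsilon>' = pull \<B> c \<delta>" using injective_ext_pull[OF I k'(1)] by blast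
    have "\<epsilon> = pull \<B> c (push \<B> m \<delta>)" using k'(2) c(2) push_pull[OF m(2) c(1) t(3)] by simp
    then have "push \<B> \<eta> \<epsilon> = pull \<B> c (push \<B> \<eta> (push \<B> m \<delta>))" using push_pull[OF t'(1) c(1) t'(3)] by simp
    then show ?thesis using tri_push_self[OF e] pull_zero[OF c(1)] by simp
  qed
  obtain j J s T \<iota> where J: "J \<in> injectives \<B>" "etri \<B> A j J s T \<iota>"
    using ei
    unfolding enough_injectives_def
    by blast
  note tJ = etri_arr[OF J(2)]
  \<comment> \<open>Construction of the object of \<open>R_perp\<close>: a universal extension G of
    A by add R. Approximating the cosyzygy T by add R makes every class in E(R, A) a pullback of
    \<open>?d\<close>, so it dies in G, and rigidity of R lets no new classes arise from V.\<close>
  obtain V \<psi> where V: "right_approx \<B> (Add R) V T \<psi>"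
    using right_approx_add_cl[OF add_addclosed add_self finite_dim_Hom]
    by blast
  then have \<psi>: "\<psi> \<in> arr V T" "V \<in> Add R" unfolding right_approx_def by auto
  let ?d = "pull \<B> \<psi> \<iota>"
  have d: "?d \<in> ext \<B> V A" by (rule pull_closed[OF \<psi>(1) tJ(3)])
  obtain g G g' where G: "etri \<B> A g G g' V ?d" using etri_exists[OF d] by blast
  note tG = etri_arr[OF G]
  have "push \<B> \<eta> ?d = zext V C"
  proof -
    have "Add R \<subseteq> {Z. \<forall>\<epsilon>\<in>ext \<B> Z A. push \<B> \<eta> \<epsilon> = zext Z C}"
      by (rule add_cl_least[OF push_kill_addclosed[OF t'(1)]]) (use kill in simp)
    then show ?thesis using \<psi>(2) d by blast
  qed
  then obtain b where b: "b \<in> arr G C" "b \<cdot> g = \<eta>" using tri_extend[OF G t'(1)] by blast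
  have "G \<in> R_perp \<B> R"
  proof -
    have "Ext_vanishes \<B> R G" unfolding Ext_vanishes_iff
    proof
      fix \<epsilon> assume k: "\<epsilon> \<in> ext \<B> R G"
      have "V \<in> \<R>" using \<psi>(2) zob_projective retract_dsum1 unfolding calR_iff by blast
      then have "push \<B> g' \<epsilon> = zext R V"
        using Ext_vanishesD[OF calR_calR[OF R_calR] push_closed[OF tG(2) k]]
        by blast
      then obtain \<kappa> where \<kappa>: "\<kappa> \<in> ext \<B> R A" "\<epsilon> = push \<B> g \<kappa>" using tri_ext_mid_push[OF G k] by blast
      obtain c where c: "c \<in> arr R T" "\<kappa> = pull \<B> c \<iota>" using injective_ext_pull[OF J \<kappa>(1)] by blast
      obtain h where h: "h \<in> arr R V" "\<psi> \<cdot> h = c" using right_approxD[OF V add_self c(1)] by blast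
      have "\<kappa> = pull \<B> h ?d" using c(2) h(2) pull_cmp[OF \<psi>(1) h(1) tJ(3)] by simp
      then have "\<epsilon> = pull \<B> h (push \<B> g ?d)" using \<kappa>(2) push_pull[OF tG(1) h(1) d] by simp
      then show "\<epsilon> = zext R G" using tri_push_self[OF G] pull_zero[OF h(1)] by simp
    qed
    then have "\<R> \<subseteq> {Z. Ext_vanishes \<B> Z G}"
      by (intro calR_least[OF Ext_vanishes_left_addclosed]) (use projective_Ext in auto)
    then show ?thesis unfolding R_perp_def by blast
  qed
  then have "factors_through \<B> A C (R_perp \<B> R) \<eta>" unfolding factors_through_def using b tG(1) by blast
  then show "A \<in> star \<B> R N" unfolding star_def using m(1) I(1) mor by blast
qed

end

section \<open>Mutation\<close>

context extriangulated_category
begin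

text \<open>An idempotent \<open>e\<close> of \<open>Y\<close> extends to the triangle; as \<open>End X\<close> is local, \<open>e\<close> or its complement kills \<open>\<delta>\<close>,
  hence factors through \<open>y\<close>, and minimality of \<open>f\<close> makes it zero.\<close>

lemma kernel_idempotent:
  assumes t: "etri \<B> Y y V f X \<delta>" and X: "local_obj \<B> X" and min: "\<forall>h\<in>arr V V. f \<cdot> h = f \<longrightarrow> h \<in> iso_mor \<B> V V"
    and lift: "\<forall>s\<in>arr Y V. push \<B> s \<delta> = zext X V" and e: "e \<in> arr Y Y" "e \<cdot> e = e"
  shows "e = zmor Y Y \<or> e = idt \<B> Y"
proof -
  note tt = etri_arr[OF t]
  have kill: "e = zmor Y Y" if e: "e \<in> arr Y Y" "e \<cdot> e = e" "push \<B> e \<delta> = zext X Y" for e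
  proof -
    obtain r where r: "r \<in> arr V Y" "r \<cdot> y = e" using tri_extend[OF t e(1,3)] by blast
    have ye: "y \<cdot> e \<in> arr Y V" by (rule cmp_closed[OF e(1) tt(1)])
    \<comment> \<open>\<open>?k\<close> is an idempotent of \<open>V\<close> with f k = 0.
      Minimality of \<open>f\<close> makes 1 - k a unit, so k = 0, and with it e = r k y.\<close>
    let ?k = "y \<cdot> e \<cdot> r"
    have k: "?k \<in> arr V V" by (rule cmp_closed[OF r(1) ye])
    have ry: "r \<cdot> ?k = e \<cdot> r"
      using cmp_assoc[OF r(1) ye r(1)] cmp_assoc[OF e(1) tt(1) r(1)] r(2) e(2) by simp
    have kk: "?k \<cdot> ?k = ?k"
      using assoc_right[OF k r(1) ye] ry cmp_assoc[OF r(1) e(1) ye] assoc_right[OF e(1,1) tt(1)] e(2) by simp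
    obtain g where g: "g \<in> arr V V" "g \<oplus>\<^bsub>Hom \<B> V V\<^esub> ?k = idt \<B> V" using complement[OF k idt_closed] by blast
    have fk: "f \<cdot> ?k = zmor V X"
      using cmp_assoc[OF r(1) ye tt(2)] cmp_assoc[OF e(1) tt(1,2)] tri_cmp[OF t] zero_cmp[OF e(1)] zero_cmp[OF
        r(1)]
        by simp
    have "f \<cdot> g = f"
      using cmp_add_right[OF g(1) k tt(2)] g(2) fk cmp_idt_right[OF tt(2)] add_zero[OF cmp_closed[OF g(1)
        tt(2)]]
      by simp
    then have "g \<in> iso_mor \<B> V V" using min g(1) by blast
    then have "g = idt \<B> V" using idempotent_iso idempotent_compl(3)[OF k kk g] by blast
    then have k0: "?k = zmor V V" using idempotent_compl(1)[OF k kk g] cmp_idt_right[OF k] by simp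
    have "e = r \<cdot> ?k \<cdot> y" using ry assoc_right[OF tt(1) r(1) e(1)] r(2) e(2) by simp
    then show ?thesis using k0 cmp_zero[OF r(1)] zero_cmp[OF tt(1)] by simp
  qed
  have half: "push \<B> e' \<delta> = zext X Y" if e: "e \<in> arr Y Y" "e' \<in> arr Y Y" "e' \<cdot> e = zmor Y Y" and c: "c \<in> iso_mor
    \<B> X X" "push \<B> e \<delta> = pull \<B> c \<delta>" for e e' c
  proof -
    obtain d where d: "c \<in> arr X X" "d \<in> arr X X" "c \<cdot> d = idt \<B> X" using iso_morE[OF c(1)] by metis
    have "\<delta> = pull \<B> d (push \<B> e \<delta>)" using c(2) pull_cmp[OF d(1,2) tt(3)] d(3) pull_idt[OF tt(3)] by simp
    then have "\<delta> = push \<B> e (pull \<B> d \<delta>)" using push_pull[OF e(1) d(2) tt(3)] by simp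
    then have "push \<B> e' \<delta> = push \<B> (e' \<cdot> e) (pull \<B> d \<delta>)"
      using push_cmp[OF e(1,2) pull_closed[OF d(2) tt(3)]]
      by simp
    then show ?thesis using e(3) zero_push[OF pull_closed[OF d(2) tt(3)]] by simp
  qed
  obtain e' where e': "e' \<in> arr Y Y" "e' \<oplus>\<^bsub>Hom \<B> Y Y\<^esub> e = idt \<B> Y" using complement[OF e(1) idt_closed] by blast
  note i = idempotent_compl[OF e e']
  have ye: "y \<cdot> e \<in> arr Y V" by (rule cmp_closed[OF e(1) tt(1)])
  obtain b where b: "b \<in> arr V V" "b \<cdot> y = y \<cdot> e" using tri_extend[OF t ye] lift ye by blast
  obtain c where c: "c \<in> arr X X" "push \<B> e \<delta> = pull \<B> c \<delta>" using ET3[OF t t e(1) b(1) b(2)[symmetric]] by blast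
  \<comment> \<open>The complements (e', c') again form an endomorphism of the extension
    \<open>\<delta>\<close>, and one of \<open>c\<close>, \<open>c'\<close> is a unit.\<close>
  obtain c' where c': "c' \<in> arr X X" "c' \<oplus>\<^bsub>Hom \<B> X X\<^esub> c = idt \<B> X" using complement[OF c(1) idt_closed] by blast
  have pe: "push \<B> e' \<delta> \<in> ext \<B> X Y" "pull \<B> c' \<delta> \<in> ext \<B> X Y" "push \<B> e \<delta> \<in> ext \<B> X Y"
    using push_closed pull_closed tt e c' e' by auto
  have eq: "push \<B> e' \<delta> \<oplus>\<^bsub>Ext \<B> X Y\<^esub> push \<B> e \<delta> = pull \<B> c' \<delta> \<oplus>\<^bsub>Ext \<B> X Y\<^esub> push \<B> e \<delta>"
    using push_add_mor[OF e'(1) e(1) tt(3)] pull_add_mor[OF c'(1) c(1) tt(3)] e'(2) c'(2) c(2) push_idt[OF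
      tt(3)] pull_idt[OF tt(3)]
      by simp
  have pc: "push \<B> e' \<delta> = pull \<B> c' \<delta>"
  proof -
    obtain n where n: "n \<in> ext \<B> X Y" "n \<oplus>\<^bsub>Ext \<B> X Y\<^esub> push \<B> e \<delta> = zext X Y"
      using ext_compl[OF pe(3) ext_zero]
      by blast
    then have "push \<B> e \<delta> \<oplus>\<^bsub>Ext \<B> X Y\<^esub> n = zext X Y" using ext_comm[OF n(1) pe(3)] by simp
    then show ?thesis
      using arg_cong[OF eq, of "\<lambda>s. s \<oplus>\<^bsub>Ext \<B> X Y\<^esub> n"] ext_assoc[OF pe(1,3) n(1)] ext_assoc[OF pe(2,3) n(1)]
      ext_add_zero[OF pe(1)] ext_add_zero[OF pe(2)] by simp
  qed
  consider "c \<in> iso_mor \<B> X X" | "c' \<in> iso_mor \<B> X X" using local_objD[OF X c'(1) c(1) c'(2)] by blast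
  then show ?thesis
  proof cases
    case 1
    have "e' = zmor Y Y" by (rule kill[OF e'(1) i(3) half[OF e(1) e'(1) i(2) 1 c(2)]])
    then show ?thesis using e'(2) zero_add[OF e(1)] by simp
  next
    case 2
    have "e = zmor Y Y" by (rule kill[OF e half[OF e'(1) e(1) i(1) 2 pc]])
    then show ?thesis by simp
  qed
qed

end

context extriangulated_category
begin

lemma cokernel_idempotent:
  assumes t: "etri \<B> X g V z Y \<delta>" and X: "local_obj \<B> X" and min: "\<forall>h\<in>arr V V. h \<cdot> g = g \<longrightarrow> h \<in> iso_mor \<B> V V"
    and lift: "\<forall>s\<in>arr V Y. pull \<B> s \<delta> = zext V X" and e: "e \<in> arr Y Y" "e \<cdot> e = e"
  shows "e = zmor Y Y \<or> e = idt \<B> Y"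
  using extriangulated_category.kernel_idempotent[OF extriangulated_category_op_cat, of Y z V g X \<delta> e] assms
  by (simp add: op_cat_etri op_cat_local_obj op_cat_iso_mor)

end

context relative_setting
begin

section \<open>Approximations as conflations with relative class\<close>

lemma right_approx_exists: "\<exists>V \<psi>. right_approx \<B> (Add U) V D \<psi>"
  by (rule right_approx_add_cl[OF add_addclosed add_self finite_dim_Hom])

lemma left_approx_exists: "\<exists>V \<psi>. left_approx \<B> (Add U) D V \<psi>"
  by (rule left_approx_add_cl[OF add_addclosed add_self finite_dim_Hom])

lemma right_approx_minimal: "\<exists>V \<psi>. right_approx \<B> (Add U) V D \<psi> \<and> (\<forall>h\<in>arr V V. \<psi> \<cdot> h = \<psi> \<longrightarrow> h \<in> iso_mor \<B> V V)"
  by (rule minimal_right_approx[OF add_addclosed local_decomp_exists right_approx_exists])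

lemma left_approx_minimal: "\<exists>V \<psi>. left_approx \<B> (Add U) D V \<psi> \<and> (\<forall>h\<in>arr V V. h \<cdot> \<psi> = \<psi> \<longrightarrow> h \<in> iso_mor \<B> V V)"
  by (rule minimal_left_approx[OF add_addclosed local_decomp_exists left_approx_exists])

lemma left_approxD: "\<lbrakk>left_approx \<B> \<T> X T g; T' \<in> \<T>; f \<in> arr X T'\<rbrakk> \<Longrightarrow> \<exists>h\<in>arr T T'. h \<cdot> g = f"
  unfolding left_approx_def by blast

lemma Add_mono: "U \<in> Add M \<Longrightarrow> Add U \<subseteq> Add M"
  by (rule add_cl_least[OF add_addclosed])

lemma syzygy_exists: "\<exists>W u P v \<rho>. P \<in> \<P> \<and> etri \<B> W u P v R \<rho> \<and> W \<in> syzygies"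
proof -
  obtain W u P v \<rho> where w: "P \<in> \<P>" "etri \<B> W u P v R \<rho>" using ep unfolding enough_projectives_def by blast
  then show ?thesis using R_calR unfolding syzygies_def by blast
qed

text \<open>\<open>u\<close> = h g is an inflation, so (WIC) makes \<open>g\<close> one. Its class
  is pulled back from S' along the induced map of cones, hence relative.\<close>

lemma inflation_of_factor:
  assumes e: "etri \<B> A u S v S' \<rho>" "S \<in> \<R>" "S' \<in> \<R>" and V: "V \<in> \<H>" and g: "g \<in> arr A V" "h \<in> arr V S" "h \<cdot> g =
    u"
  shows "\<exists>z C \<delta>. etri \<B> A g V z C \<delta> \<and> \<delta> \<in> rel_ext C A \<and> C \<in> \<H>"
proof -
  have "inflation \<B> A S (h \<cdot> g)" using inflationI[OF e(1)] g(3) by simp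
  then have "inflation \<B> A V g" using wic g(1,2) unfolding WIC_def by blast
  then obtain z C \<delta> where z: "etri \<B> A g V z C \<delta>" unfolding inflation_def by blast
  note t = etri_arr[OF z]
  obtain c where c: "c \<in> arr C S'" "push \<B> (idt \<B> A) \<delta> = pull \<B> c \<rho>"
    using ET3[OF z e(1) idt_closed g(2)] cmp_idt_right[OF etri_arr(1)[OF e(1)]] g(3) by auto
  then have "\<delta> \<in> rel_ext C A" using rel_ext_calR[OF e(3) c(1) etri_arr(3)[OF e(1)]] push_idt[OF t(3)] by simp
  then show ?thesis using z calH_cokernel[OF z V e(1-3) g(2,3)] by blast
qed

text \<open>The inflation of \<open>A\<close> into an object of \<open>\<R>\<close> factors through
  \<open>g\<close>, since factoring may be checked on maps to R and to projectives.\<close>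

lemma left_approx_inflation:
  assumes P: "\<P> \<subseteq> Add U" and U: "U \<in> \<H>" and A: "A \<in> \<H>" and g: "left_approx \<B> (Add U) A V g"
    and f: "\<forall>c\<in>arr A R. factors_through \<B> A R (Add U) c"
  shows "\<exists>z C \<delta>. etri \<B> A g V z C \<delta> \<and> \<delta> \<in> rel_ext C A \<and> C \<in> \<H>"
proof -
  have gt: "g \<in> arr A V" "V \<in> Add U" using g unfolding left_approx_def by auto
  obtain u S v S' \<rho> where e: "etri \<B> A u S v S' \<rho>" "S \<in> \<R>" "S' \<in> \<R>" using A unfolding calH_def by blast
  have "\<R> \<subseteq> {T. \<forall>c\<in>arr A T. \<exists>h\<in>arr V T. h \<cdot> g = c}"
  proof (rule calR_least[OF cofactor_class_addclosed[OF gt(1)]])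
    show "\<P> \<subseteq> {T. \<forall>c\<in>arr A T. \<exists>h\<in>arr V T. h \<cdot> g = c}" using P left_approxD[OF g] by blast
    show "R \<in> {T. \<forall>c\<in>arr A T. \<exists>h\<in>arr V T. h \<cdot> g = c}"
    proof (intro CollectI ballI)
      fix c assume "c \<in> arr A R"
      then obtain T a b where T: "T \<in> Add U" "a \<in> arr A T" "b \<in> arr T R" "c = b \<cdot> a"
        using f
        unfolding factors_through_def
        by blast
      obtain h where h: "h \<in> arr V T" "h \<cdot> g = a" using left_approxD[OF g T(1,2)] by blast
      show "\<exists>h\<in>arr V R. h \<cdot> g = c"
        using cmp_closed[OF h(1) T(3)] assoc_right[OF gt(1) h(1) T(3)] h(2) T(4)
        by auto
    qed
  qed
  then obtain h where h: "h \<in> arr V S" "h \<cdot> g = u" using e(2) etri_arr(1)[OF e(1)] by blast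
  show ?thesis by (rule inflation_of_factor[OF e calH_Add[OF U gt(2)] gt(1) h])
qed

text \<open>Surjectivity of E(-, N') -> E(-, A) passes from R to all of \<open>\<R>\<close>. Hence,
  up to a map that extends to a projective, \<open>t\<close> factors through N'. Projectives lie in
  add N, so both parts factor through the approximation.\<close>

lemma star_factor:
  assumes P: "\<P> \<subseteq> Add N" and A: "A \<in> star \<B> R N" and W: "W \<in> syzygies" and t: "t \<in> arr W A" and f: "right_approx
    \<B> (Add N) V A f"
  shows "\<exists>s\<in>arr W V. f \<cdot> s = t"
proof -
  obtain N' m where m: "N' \<in> Add N" "m \<in> arr N' A" "\<And>\<epsilon>. \<epsilon> \<in> ext \<B> R A \<Longrightarrow> \<exists>\<epsilon>'\<in>ext \<B> R N'. push \<B> m \<epsilon>' = \<epsilon>"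
    using A unfolding star_iff by blast
  obtain u Q v Q' \<rho> where w: "Q \<in> \<P>" "Q' \<in> \<R>" "etri \<B> W u Q v Q' \<rho>" using W unfolding syzygies_def by blast
  note tw = etri_arr[OF w(3)]
  have ft: "f \<in> arr V A" using f unfolding right_approx_def by blast
  have "\<R> \<subseteq> {Z. \<forall>\<epsilon>\<in>ext \<B> Z A. \<exists>\<epsilon>'\<in>ext \<B> Z N'. push \<B> m \<epsilon>' = \<epsilon>}"
  proof (rule calR_least)
    show "R \<in> {Z. \<forall>\<epsilon>\<in>ext \<B> Z A. \<exists>\<epsilon>'\<in>ext \<B> Z N'. push \<B> m \<epsilon>' = \<epsilon>}" using m(3) by blast
    show "\<P> \<subseteq> {Z. \<forall>\<epsilon>\<in>ext \<B> Z A. \<exists>\<epsilon>'\<in>ext \<B> Z N'. push \<B> m \<epsilon>' = \<epsilon>}"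
      using Ext_vanishesD[OF projective_Ext] push_zero[OF m(2)] ext_zero by blast
    show "addclosed \<B> {Z. \<forall>\<epsilon>\<in>ext \<B> Z A. \<exists>\<epsilon>'\<in>ext \<B> Z N'. push \<B> m \<epsilon>' = \<epsilon>}"
      unfolding addclosed_def mem_Collect_eq
    proof (intro conjI ballI allI impI; (unfold mem_Collect_eq)?)
      fix \<epsilon> assume k: "\<epsilon> \<in> ext \<B> (zob \<B>) A"
      have "zob \<B> \<in> {Z. Ext_vanishes \<B> Z A}" using Ext_vanishes_left_addclosed unfolding addclosed_def by blast
      then show "\<exists>\<epsilon>'\<in>ext \<B> (zob \<B>) N'. push \<B> m \<epsilon>' = \<epsilon>"
        using Ext_vanishesD[OF _ k] push_zero[OF m(2)] ext_zero
        by blast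
    next
      fix D F \<epsilon> assume a: "\<forall>\<epsilon>\<in>ext \<B> D A. \<exists>\<epsilon>'\<in>ext \<B> D N'. push \<B> m \<epsilon>' = \<epsilon>" "\<forall>\<epsilon>\<in>ext \<B> F A. \<exists>\<epsilon>'\<in>ext \<B> F N'. push \<B>
        m \<epsilon>' = \<epsilon>" "\<epsilon> \<in> ext \<B> (D \<boxplus> F) A"
      obtain \<epsilon>1 where 1: "\<epsilon>1 \<in> ext \<B> D N'" "push \<B> m \<epsilon>1 = pull \<B> (in1 \<B> D F) \<epsilon>"
        using a(1) pull_closed[OF in1_closed a(3)]
        by blast
      obtain \<epsilon>2 where 2: "\<epsilon>2 \<in> ext \<B> F N'" "push \<B> m \<epsilon>2 = pull \<B> (in2 \<B> D F) \<epsilon>"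
        using a(2) pull_closed[OF in2_closed a(3)]
        by blast
      let ?e = "pull \<B> (pr1 \<B> D F) \<epsilon>1 \<oplus>\<^bsub>Ext \<B> (D \<boxplus> F) N'\<^esub> pull \<B> (pr2 \<B> D F) \<epsilon>2"
      have c: "pull \<B> (pr1 \<B> D F) \<epsilon>1 \<in> ext \<B> (D \<boxplus> F) N'" "pull \<B> (pr2 \<B> D F) \<epsilon>2 \<in> ext \<B> (D \<boxplus> F) N'"
        using pull_closed[OF pr1_closed 1(1)] pull_closed[OF pr2_closed 2(1)] .
      have "push \<B> m ?e = \<epsilon>"
        using push_add[OF m(2) c] push_pull[OF m(2) pr1_closed 1(1)] push_pull[OF m(2) pr2_closed 2(1)] 1(2)
          2(2) ext_biprod_expand[OF biprod_dsum a(3)]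
          by simp
      then show "\<exists>\<epsilon>'\<in>ext \<B> (D \<boxplus> F) N'. push \<B> m \<epsilon>' = \<epsilon>" using ext_add[OF c] by blast
    next
      fix D F \<epsilon> assume a: "\<forall>\<epsilon>\<in>ext \<B> F A. \<exists>\<epsilon>'\<in>ext \<B> F N'. push \<B> m \<epsilon>' = \<epsilon>" "retract \<B> D F" "\<epsilon> \<in> ext \<B> D A"
      obtain i p where i: "i \<in> arr D F" "p \<in> arr F D" "p \<cdot> i = idt \<B> D"
        using a(2)
        unfolding retract_def
        by blast
      obtain \<epsilon>' where k: "\<epsilon>' \<in> ext \<B> F N'" "push \<B> m \<epsilon>' = pull \<B> p \<epsilon>"
        using a(1) pull_closed[OF i(2) a(3)]
        by blast
      have "push \<B> m (pull \<B> i \<epsilon>') = \<epsilon>"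
        using push_pull[OF m(2) i(1) k(1)] k(2) pull_cmp[OF i(2,1) a(3)] i(3) pull_idt[OF a(3)]
        by simp
      then show "\<exists>\<epsilon>'\<in>ext \<B> D N'. push \<B> m \<epsilon>' = \<epsilon>" using pull_closed[OF i(1) k(1)] by blast
    qed
  qed
  then obtain \<epsilon>' where k: "\<epsilon>' \<in> ext \<B> Q' N'" "push \<B> m \<epsilon>' = push \<B> t \<rho>"
    using w(2) push_closed[OF t tw(3)]
    by blast
  obtain s where s: "s \<in> arr W N'" "\<epsilon>' = push \<B> s \<rho>"
    using tri_ext_ker_pull[OF w(3) k(1) Ext_vanishesD[OF projective_Ext[OF w(1)] pull_closed[OF tw(2) k(1)]]]
      by blast
  have ms: "m \<cdot> s \<in> arr W A" by (rule cmp_closed[OF s(1) m(2)])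
  \<comment> \<open>\<open>n\<close> is t - m s; it kills \<open>\<rho>\<close>, because
    \<open>t\<close> and m s push it to the same class, and so extends to the projective Q.\<close>
  obtain n where n: "n \<in> arr W A" "n \<oplus>\<^bsub>Hom \<B> W A\<^esub> m \<cdot> s = t" using complement[OF ms t] by blast
  note ptr = push_closed[OF t tw(3)] and pn = push_closed[OF n(1) tw(3)]
  have pms: "push \<B> (m \<cdot> s) \<rho> = push \<B> t \<rho>" using push_cmp[OF s(1) m(2) tw(3)] s(2) k(2) by simp
  have "push \<B> n \<rho> \<oplus>\<^bsub>Ext \<B> Q' A\<^esub> push \<B> t \<rho> = push \<B> t \<rho>"
    using push_add_mor[OF n(1) ms tw(3)] n(2) pms by simp
  then have "push \<B> n \<rho> = zext Q' A" using ext_zero_unique[OF ptr _ pn] ext_comm[OF pn ptr] by simp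
  then obtain b where b: "b \<in> arr Q A" "b \<cdot> u = n" using tri_extend[OF w(3) n(1)] by blast
  obtain b' where b': "b' \<in> arr Q V" "f \<cdot> b' = b" using right_approxD[OF f _ b(1)] P w(1) by blast
  obtain m' where m': "m' \<in> arr N' V" "f \<cdot> m' = m" using right_approxD[OF f m(1,2)] by blast
  have c: "b' \<cdot> u \<in> arr W V" "m' \<cdot> s \<in> arr W V" using cmp_closed b' m' tw s by auto
  have "f \<cdot> (b' \<cdot> u \<oplus>\<^bsub>Hom \<B> W V\<^esub> m' \<cdot> s) = t"
    using cmp_add_right[OF c ft] cmp_assoc[OF tw(1) b'(1) ft] cmp_assoc[OF s(1) m'(1) ft] b' m' b(2) n(2)
      by simp
  then show ?thesis using add_closed[OF c] by blast
qed

text \<open>A single map \<open>f\<close> out of one syzygy of R detects membership. This makes N *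
  [R] a factorisation class, from which closure and monotonicity follow by composing maps.\<close>

lemma star_iff_left_approx:
  assumes w: "P \<in> \<P>" "etri \<B> W u P v R \<rho>" and P: "\<P> \<subseteq> Add N" and f: "left_approx \<B> (Add N) W V f"
  shows "A \<in> star \<B> R N \<longleftrightarrow> (\<forall>t\<in>arr W A. \<exists>h\<in>arr V A. h \<cdot> f = t)"
proof -
  have W: "W \<in> syzygies" using w R_calR unfolding syzygies_def by blast
  have ft: "f \<in> arr W V" "V \<in> Add N" using f unfolding left_approx_def by auto
  obtain V' \<psi> where r: "right_approx \<B> (Add N) V' A \<psi>" using right_approx_exists by blast
  then have \<psi>: "\<psi> \<in> arr V' A" "V' \<in> Add N" unfolding right_approx_def by auto
  note tw = etri_arr[OF w(2)]
  show ?thesis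
  proof (intro iffI ballI)
    fix t assume A: "A \<in> star \<B> R N" and t: "t \<in> arr W A"
    obtain s where s: "s \<in> arr W V'" "\<psi> \<cdot> s = t" using star_factor[OF P A W t r] by blast
    obtain h where h: "h \<in> arr V V'" "h \<cdot> f = s" using left_approxD[OF f \<psi>(2) s(1)] by blast
    show "\<exists>h\<in>arr V A. h \<cdot> f = t"
      using cmp_closed[OF h(1) \<psi>(1)] assoc_right[OF ft(1) h(1) \<psi>(1)] h(2) s(2)
      by auto
  next
    assume a: "\<forall>t\<in>arr W A. \<exists>h\<in>arr V A. h \<cdot> f = t"
    have "\<exists>\<epsilon>'\<in>ext \<B> R V'. push \<B> \<psi> \<epsilon>' = \<epsilon>" if k: "\<epsilon> \<in> ext \<B> R A" for \<epsilon>
    proof -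
      obtain t where t: "t \<in> arr W A" "\<epsilon> = push \<B> t \<rho>"
        using tri_ext_ker_pull[OF w(2) k Ext_vanishesD[OF projective_Ext[OF w(1)] pull_closed[OF tw(2) k]]]
          by blast
      obtain h where h: "h \<in> arr V A" "h \<cdot> f = t" using a t(1) by blast
      obtain k where k: "k \<in> arr V V'" "\<psi> \<cdot> k = h" using right_approxD[OF r ft(2) h(1)] by blast
      have kf: "k \<cdot> f \<in> arr W V'" by (rule cmp_closed[OF ft(1) k(1)])
      have "\<psi> \<cdot> (k \<cdot> f) = t" using cmp_assoc[OF ft(1) k(1) \<psi>(1)] k(2) h(2) by simp
      then show ?thesis using push_cmp[OF kf \<psi>(1) tw(3)] t(2) push_closed[OF kf tw(3)] by metis
    qed
    then show "A \<in> star \<B> R N" unfolding star_iff using \<psi> by blast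
  qed
qed

lemma star_addclosed: assumes P: "\<P> \<subseteq> Add N" shows "addclosed \<B> (star \<B> R N)"
proof -
  obtain W u Q v \<rho> where w: "Q \<in> \<P>" "etri \<B> W u Q v R \<rho>" using syzygy_exists by blast
  obtain V f where f: "left_approx \<B> (Add N) W V f" using left_approx_exists by blast
  have "star \<B> R N = {A. \<forall>t\<in>arr W A. \<exists>h\<in>arr V A. h \<cdot> f = t}" using star_iff_left_approx[OF w P f] by blast
  moreover have "f \<in> arr W V" using f unfolding left_approx_def by blast
  ultimately show ?thesis using cofactor_class_addclosed by simp
qed

lemma Add_star: assumes P: "\<P> \<subseteq> Add N" shows "Add N \<subseteq> star \<B> R N"
proof -
  obtain W u Q v \<rho> where w: "Q \<in> \<P>" "etri \<B> W u Q v R \<rho>" using syzygy_exists by blast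
  obtain V f where f: "left_approx \<B> (Add N) W V f" using left_approx_exists by blast
  show ?thesis using star_iff_left_approx[OF w P f] left_approxD[OF f] by blast
qed

lemma star_mono: assumes P: "\<P> \<subseteq> Add N" "\<P> \<subseteq> Add M" and N: "N \<in> star \<B> R M" shows "star \<B> R N \<subseteq> star \<B> R M"
proof
  fix A assume A: "A \<in> star \<B> R N"
  obtain W u Q v \<rho> where w: "Q \<in> \<P>" "etri \<B> W u Q v R \<rho>" using syzygy_exists by blast
  obtain V f where f: "left_approx \<B> (Add N) W V f" using left_approx_exists by blast
  obtain V' f' where f': "left_approx \<B> (Add M) W V' f'" using left_approx_exists by blast
  have t: "f \<in> arr W V" "V \<in> Add N" "f' \<in> arr W V'" using f f' unfolding left_approx_def by auto
  have "V \<in> star \<B> R M" using add_cl_least[OF star_addclosed[OF P(2)] N] t(2) by blast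
  then obtain h where h: "h \<in> arr V' V" "h \<cdot> f' = f" using star_iff_left_approx[OF w P(2) f'] t(1) by blast
  show "A \<in> star \<B> R M" unfolding star_iff_left_approx[OF w P(2) f']
  proof
    fix s assume "s \<in> arr W A"
    then obtain k where k: "k \<in> arr V A" "k \<cdot> f = s" using A star_iff_left_approx[OF w P(1) f] by blast
    show "\<exists>h\<in>arr V' A. h \<cdot> f' = s"
      using cmp_closed[OF h(1) k(1)] assoc_right[OF t(3) h(1) k(1)] h(2) k(2)
      by auto
  qed
qed

text \<open>A deflation from a projective to \<open>A\<close> factors through \<open>f\<close>, so
  (WIC) makes \<open>f\<close> a deflation. Its class is relative because maps from syzygies lift
  along \<open>f\<close> by \<open>star_factor\<close>.\<close>

lemma right_approx_deflation:
  assumes P: "\<P> \<subseteq> Add U" and U: "U \<in> \<H>" and A: "A \<in> \<H>" "A \<in> star \<B> R U" and f: "right_approx \<B> (Add U) V A f"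
  shows "\<exists>K k \<delta>. etri \<B> K k V f A \<delta> \<and> \<delta> \<in> rel_ext A K \<and> K \<in> \<H>"
proof -
  have ft: "f \<in> arr V A" "V \<in> Add U" using f unfolding right_approx_def by auto
  obtain B x Q q \<rho> where q: "Q \<in> \<P>" "etri \<B> B x Q q A \<rho>" using ep unfolding enough_projectives_def by blast
  obtain p where p: "p \<in> arr Q V" "f \<cdot> p = q" using right_approxD[OF f _ etri_arr(2)[OF q(2)]] P q(1) by blast
  have "deflation \<B> Q A (f \<cdot> p)" using deflationI[OF q(2)] p(2) by simp
  then have "deflation \<B> V A f" using wic p(1) ft(1) unfolding WIC_def by blast
  then obtain K k \<delta> where k: "etri \<B> K k V f A \<delta>" unfolding deflation_def by blast
  note t = etri_arr[OF k]
  have d: "\<delta> \<in> rel_ext A K" unfolding rel_ext_def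
  proof (intro CollectI conjI ballI t(3))
    fix W s assume "W \<in> syzygies" "s \<in> arr W A"
    then obtain r where r: "r \<in> arr W V" "f \<cdot> r = s" using star_factor[OF P A(2) _ _ f] by blast
    then show "pull \<B> s \<delta> = zext W K"
      using pull_cmp[OF t(2) r(1) t(3)] tri_pull_self[OF k] pull_zero[OF r(1)]
      by simp
  qed
  show ?thesis using k d calH_kernel_rel_ext[OF k d calH_Add[OF U ft(2)] A(1)] by blast
qed

text \<open>Unlike in \<open>max_R_rigid\<close>, the test object Z may be decomposable or
  projective, and separate vanishing conditions replace rigidity of the sum.\<close>

definition rel_maximal :: "'o \<Rightarrow> bool"
  where "rel_maximal M \<longleftrightarrow> M \<in> \<H> \<and> rel_vanishes M M \<and> \<P> \<subseteq> Add M \<and>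
    (\<forall>Z\<in>\<H>. rel_vanishes M Z \<and> rel_vanishes Z M \<and> rel_vanishes Z Z \<longrightarrow> Z \<in> Add M)"

section \<open>Maximal objects and their resolutions\<close>

lemma rel_vanishes_dsum: "\<lbrakk>rel_vanishes A A; rel_vanishes A C; rel_vanishes C A; rel_vanishes C C\<rbrakk> \<Longrightarrow>
  rel_vanishes (A \<boxplus> C) (A \<boxplus> C)"
  using rel_vanishes_dsum_left rel_vanishes_dsum_right by blast

lemma rel_vanishes_retract: "\<lbrakk>rel_vanishes D F; retract \<B> A D; retract \<B> C F\<rbrakk> \<Longrightarrow> rel_vanishes A C"
  using rel_vanishes_retract_left rel_vanishes_retract_right by blast

text \<open>Each local summand of Z is either projective, hence in add M, or a legitimate test
  object for \<open>max_R_rigid\<close>.\<close>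

lemma max_R_rigid_rel_maximal: assumes P: "\<P> \<subseteq> Add M" and m: "max_R_rigid \<B> R M" shows "rel_maximal M"
proof -
  have M: "M \<in> \<H>" "rel_vanishes M M" using m R_rigid_iff unfolding max_R_rigid_def by auto
  have "Z \<in> Add M" if Z: "Z \<in> \<H>" "rel_vanishes M Z" "rel_vanishes Z M" "rel_vanishes Z Z" for Z
  proof -
    obtain n where "local_decomp \<B> n Z" using local_decomp_exists by blast
    then show ?thesis
    proof (rule local_decomp_closed[OF _ add_addclosed])
      fix A assume A: "local_obj \<B> A" "retract \<B> A Z"
      have "rel_vanishes M A" "rel_vanishes A M" "rel_vanishes A A"
        using rel_vanishes_retract[OF _ _ _] Z A(2) retract_refl
        by blast+
      then have "rel_vanishes (M \<boxplus> A) (M \<boxplus> A)" using rel_vanishes_dsum M(2) by blast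
      moreover have AH: "A \<in> \<H>" using calH_retract Z(1) A(2) by blast
      ultimately have "R_rigid \<B> R (M \<boxplus> A)" using R_rigid_iff calH_dsum M(1) by blast
      then show "A \<in> Add M" using m P AH local_obj_indecomposable[OF A(1)] unfolding max_R_rigid_def by blast
    qed
  qed
  then show ?thesis using M P unfolding rel_maximal_def by blast
qed

lemma max_R_rigidI: assumes N: "N \<in> \<H>" "rel_vanishes N N" and Z: "\<And>Z. \<lbrakk>Z \<in> \<H>; rel_vanishes N Z; rel_vanishes Z
  N\<rbrakk> \<Longrightarrow> Z \<in> Add N"
  shows "max_R_rigid \<B> R N"
  unfolding max_R_rigid_def
proof (intro conjI ballI impI N(1))
  show "R_rigid \<B> R N" using R_rigid_iff N by blast
  fix Y assume Y: "Y \<in> \<H>" "indecomposable \<B> Y \<and> Y \<notin> \<P> \<and> R_rigid \<B> R (N \<boxplus> Y)"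
  then have "rel_vanishes (N \<boxplus> Y) (N \<boxplus> Y)" using R_rigid_iff calH_dsum N(1) by blast
  then show "Y \<in> Add N" using Z[OF Y(1)] rel_vanishes_retract retract_dsum1 retract_dsum2 by blast
qed

lemma rel_ext_split: "\<lbrakk>etri \<B> A x B y C \<delta>; \<delta> \<in> rel_ext C A; rel_vanishes C A; B \<in> Add N\<rbrakk> \<Longrightarrow> A \<in> Add N \<and> C \<in> Add
  N"
  using etri_zero_iso[of A x B y C] rel_vanishesD retract_iso[OF isomorphic_sym, of B "A \<boxplus> C"]
    retract_trans[OF retract_dsum1[of A C]] retract_trans[OF retract_dsum2[of C A]] addclosed_retract[OF
      add_addclosed]
      by metis

text \<open>The kernel K of the approximation V -> Z again satisfies the hypothesis, so it is a
  relative quotient of an object V' of add N. As Z has no relative extensions by V', it has none by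
  K, and the first triangle splits.\<close>

lemma max_of_star:
  assumes P: "\<P> \<subseteq> Add N" and N: "N \<in> \<H>" "rel_vanishes N N"
    and s: "\<And>A. \<lbrakk>A \<in> \<H>; rel_vanishes N A\<rbrakk> \<Longrightarrow> A \<in> star \<B> R N"
  shows "max_R_rigid \<B> R N"
proof (rule max_R_rigidI[OF N])
  fix Z assume Z: "Z \<in> \<H>" "rel_vanishes N Z" "rel_vanishes Z N"
  obtain V f where f: "right_approx \<B> (Add N) V Z f" using right_approx_exists by blast
  then have V: "V \<in> Add N" unfolding right_approx_def by blast
  obtain K k \<delta> where k: "etri \<B> K k V f Z \<delta>" "\<delta> \<in> rel_ext Z K" "K \<in> \<H>"
    using right_approx_deflation[OF P N(1) Z(1) s[OF Z(1,2)] f]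
    by blast
  have NK: "rel_vanishes N K"
    by (rule rel_vanishes_kernel[OF k(1) _ rel_vanishes_add_right[OF N(2) V]]) (rule right_approxD[OF f
      add_self])
  obtain V' f' where f': "right_approx \<B> (Add N) V' K f'" using right_approx_exists by blast
  then have V': "V' \<in> Add N" unfolding right_approx_def by blast
  obtain K' k' \<delta>' where k': "etri \<B> K' k' V' f' K \<delta>'" "\<delta>' \<in> rel_ext K K'"
    using right_approx_deflation[OF P N(1) k(3) s[OF k(3) NK] f']
    by blast
  have "rel_vanishes Z K" by (rule rel_vanishes_quotient[OF k' Z(1) rel_vanishes_add_right[OF Z(3) V']])
  then show "Z \<in> Add N" using rel_ext_split[OF k(1,2) _ V] by blast
qed

text \<open>Same scheme with cones. Factoring maps to R through add N is what makes the left
  approximations of Z, and then of its cone, inflations with relative class.\<close>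

lemma max_of_costar:
  assumes P: "\<P> \<subseteq> Add N" and N: "N \<in> \<H>" "rel_vanishes N N"
    and s: "\<And>A. \<lbrakk>A \<in> \<H>; rel_vanishes A N\<rbrakk> \<Longrightarrow> \<forall>c\<in>arr A R. factors_through \<B> A R (Add N) c"
  shows "max_R_rigid \<B> R N"
proof (rule max_R_rigidI[OF N])
  fix Z assume Z: "Z \<in> \<H>" "rel_vanishes N Z" "rel_vanishes Z N"
  obtain V g where g: "left_approx \<B> (Add N) Z V g" using left_approx_exists by blast
  then have V: "V \<in> Add N" unfolding left_approx_def by blast
  obtain z C \<delta> where k: "etri \<B> Z g V z C \<delta>" "\<delta> \<in> rel_ext C Z" "C \<in> \<H>"
    using left_approx_inflation[OF P N(1) Z(1) g s[OF Z(1,3)]]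
    by blast
  have CN: "rel_vanishes C N"
    by (rule rel_vanishes_cokernel[OF k(1) _ rel_vanishes_add_left[OF N(2) V]]) (rule left_approxD[OF g
      add_self])
  obtain V' g' where g': "left_approx \<B> (Add N) C V' g'" using left_approx_exists by blast
  then have V': "V' \<in> Add N" unfolding left_approx_def by blast
  obtain z' C' \<delta>' where k': "etri \<B> C g' V' z' C' \<delta>'" "\<delta>' \<in> rel_ext C' C" "C' \<in> \<H>"
    using left_approx_inflation[OF P N(1) k(3) g' s[OF k(3) CN]] by blast
  have "rel_vanishes C Z" by (rule rel_vanishes_sub[OF k'(1,2) k(3) k'(3) rel_vanishes_add_left[OF Z(2) V']])
  then show "Z \<in> Add N" using rel_ext_split[OF k(1,2) _ V] by blast
qed

text \<open>Maps to M extend along the approximation, so C has no relative extensions by M; right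
  exactness gives those of M by C, and then of C by itself. Maximality does the rest.\<close>

lemma syzygy_coresolution:
  assumes M: "rel_maximal M" and w: "P \<in> \<P>" "etri \<B> W u P v R \<rho>" and f: "left_approx \<B> (Add M) W V f"
  shows "\<exists>y C \<delta>. etri \<B> W f V y C \<delta> \<and> \<delta> \<in> rel_ext C W \<and> C \<in> Add M"
proof -
  note m = M[unfolded rel_maximal_def]
  have ft: "f \<in> arr W V" "V \<in> Add M" using f unfolding left_approx_def by auto
  note tw = etri_arr[OF w(2)]
  obtain h where h: "h \<in> arr V P" "h \<cdot> f = u" using left_approxD[OF f _ tw(1)] m w(1) by blast
  have "P \<in> \<R>" using projectives_calR w(1) by blast
  then obtain y C \<delta> where y: "etri \<B> W f V y C \<delta>" "\<delta> \<in> rel_ext C W" "C \<in> \<H>"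
    using inflation_of_factor[OF w(2) _ R_calR calH_Add[OF _ ft(2)] ft(1) h] m by blast
  have 1: "rel_vanishes C M"
    by (rule rel_vanishes_cokernel[OF y(1) _ rel_vanishes_add_left[OF _ ft(2)]]) (use left_approxD[OF f
      add_self] m in auto)
  have 2: "rel_vanishes M C"
    by (rule rel_vanishes_quotient[OF y(1,2) _ rel_vanishes_add_right[OF _ ft(2)]]) (use m in auto)
  have 3: "rel_vanishes C C" by (rule rel_vanishes_quotient[OF y rel_vanishes_add_right[OF 1 ft(2)]])
  show ?thesis using y 1 2 3 m by blast
qed

text \<open>The counterpart at R itself. No condition of the form R in M * [R] is needed, as every
  class over R is relative.\<close>

lemma R_resolution:
  assumes M: "rel_maximal M" and f: "right_approx \<B> (Add M) V R f"
  shows "\<exists>K k \<delta>. etri \<B> K k V f R \<delta> \<and> K \<in> Add M"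
proof -
  note m = M[unfolded rel_maximal_def]
  have ft: "f \<in> arr V R" "V \<in> Add M" using f unfolding right_approx_def by auto
  obtain W u P v \<rho> where w: "P \<in> \<P>" "etri \<B> W u P v R \<rho>" using syzygy_exists by blast
  obtain p where p: "p \<in> arr P V" "f \<cdot> p = v" using right_approxD[OF f _ etri_arr(2)[OF w(2)]] m w(1) by blast
  have "deflation \<B> P R (f \<cdot> p)" using deflationI[OF w(2)] p(2) by simp
  then have "deflation \<B> V R f" using wic p(1) ft(1) unfolding WIC_def by blast
  then obtain K k \<delta> where k: "etri \<B> K k V f R \<delta>" unfolding deflation_def by blast
  have V: "V \<in> \<H>" using calH_Add ft(2) m by blast
  have K: "K \<in> \<H>" by (rule calH_kernel[OF V k R_calR])
  have d: "\<delta> \<in> rel_ext R K" by (rule rel_ext_of_calR[OF R_calR etri_arr(3)[OF k]])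
  have 1: "rel_vanishes M K"
    by (rule rel_vanishes_kernel[OF k _ rel_vanishes_add_right[OF _ ft(2)]]) (use right_approxD[OF f add_self] m
      in auto)
  have 2: "rel_vanishes K M"
    by (rule rel_vanishes_sub[OF k d K calR_calH[OF R_calR] rel_vanishes_add_left[OF _ ft(2)]]) (use m in auto)
  have 3: "rel_vanishes K K"
    by (rule rel_vanishes_sub[OF k d K calR_calH[OF R_calR] rel_vanishes_add_left[OF 1 ft(2)]])
  show ?thesis using k K 1 2 3 m by blast
qed

text \<open>If \<open>b \<cdot> y \<cdot> a\<close> were a unit, then some \<open>p\<close> with \<open>p \<cdot> a = 1\<close> and \<open>p \<cdot> f = 0\<close> would give a nonzero idempotent
  \<open>a \<cdot> p\<close> killing \<open>f\<close>, against left minimality.\<close>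

lemma minimal_cokernel_radical:
  assumes t: "etri \<B> W f V y C \<delta>" and min: "\<forall>h\<in>arr V V. h \<cdot> f = f \<longrightarrow> h \<in> iso_mor \<B> V V" and X: "local_obj \<B> X"
    and a: "a \<in> arr X V" and b: "b \<in> arr C X"
  shows "b \<cdot> (y \<cdot> a) \<in> radical \<B> X X"
proof (rule ccontr)
  note tt = etri_arr[OF t]
  assume "b \<cdot> (y \<cdot> a) \<notin> radical \<B> X X"
  then have "b \<cdot> (y \<cdot> a) \<in> iso_mor \<B> X X"
    using local_obj_not_radical_iso[OF X X cmp_closed[OF cmp_closed[OF a tt(2)] b]]
    by blast
  then obtain s where s: "s \<in> arr X X" "s \<cdot> (b \<cdot> (y \<cdot> a)) = idt \<B> X" using iso_morE by metis
  define p where "p = s \<cdot> b \<cdot> y"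
  have sb: "s \<cdot> b \<in> arr C X" by (rule cmp_closed[OF b s(1)])
  have p: "p \<in> arr V X" unfolding p_def by (rule cmp_closed[OF tt(2) sb])
  have pa: "p \<cdot> a = idt \<B> X" unfolding p_def
    using assoc_right[OF a tt(2) sb] assoc_right[OF cmp_closed[OF a tt(2)] b s(1)] s(2) by simp
  have pf: "p \<cdot> f = zmor W X"
    unfolding p_def
    using assoc_right[OF tt(1,2) sb] tri_cmp[OF t] cmp_zero[OF sb]
    by simp
  have e: "a \<cdot> p \<in> arr V V" "a \<cdot> p \<cdot> (a \<cdot> p) = a \<cdot> p"
    using cmp_closed[OF p a] cmp_mid_idt[OF p a p a pa]
    by auto
  obtain g where g: "g \<in> arr V V" "g \<oplus>\<^bsub>Hom \<B> V V\<^esub> a \<cdot> p = idt \<B> V" using complement[OF e(1) idt_closed] by blast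
  have ef: "a \<cdot> p \<cdot> f = zmor W V" using assoc_right[OF tt(1) p a] pf cmp_zero[OF a] by simp
  have "g \<cdot> f = f"
    using cmp_add_left[OF tt(1) g(1) e(1)] g(2) ef cmp_idt_left[OF tt(1)] add_zero[OF cmp_closed[OF tt(1) g(1)]]
    by simp
  then have "g = idt \<B> V" using min g(1) idempotent_iso idempotent_compl(3)[OF e g] by blast
  then have "a \<cdot> p = zmor V V" using idempotent_compl(1)[OF e g] cmp_idt_right[OF e(1)] by simp
  then have "p \<cdot> (a \<cdot> p \<cdot> a) = zmor X X" using zero_cmp[OF a] cmp_zero[OF p] by simp
  then have "idt \<B> X = zmor X X" using assoc_right[OF a p a] pa cmp_idt_right[OF a] by simp
  then show False using local_obj_nonzero[OF X] by simp
qed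

end

locale mutation_setting = relative_setting K \<B> R
  for K :: "'k ring" and \<B> :: "('k, 'o, 'm, 'e) excat" (structure) and R :: 'o +
  fixes M U X :: 'o
  assumes M_iso: "isomorphic \<B> M (U \<boxplus> X)" and M_basic: "basic \<B> M" and M_max: "max_R_rigid \<B> R M"
    and X_indec: "indecomposable \<B> X" and P_U: "\<P> \<subseteq> Add U"
begin

section \<open>The two exchange triangles\<close>

lemma X_local_obj: "local_obj \<B> X"
  using indecomposable_local_obj[OF X_indec] local_decomp_exists by blast

lemma UX_M: "retract \<B> U M" "retract \<B> X M" "retract \<B> M (U \<boxplus> X)"
  using M_iso retract_iso isomorphic_sym retract_trans[OF retract_dsum1] retract_trans[OF retract_dsum2]
    by blast+

lemma U_M: "U \<in> Add M" and X_M: "X \<in> Add M"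
  using UX_M addclosed_retract[OF add_addclosed add_self] by auto

lemma X_U: "X \<notin> Add U"
  using basic_no_repeat[OF ks M_basic M_iso X_local_obj] local_obj_retract_add_cl[OF X_local_obj] by blast

lemma P_M: "\<P> \<subseteq> Add M"
  using P_U Add_mono[OF U_M] by blast

lemma M_rel_maximal: "rel_maximal M"
  by (rule max_R_rigid_rel_maximal[OF P_M M_max])

lemma UX_calH: "U \<in> \<H>" "X \<in> \<H>"
  using M_rel_maximal calH_retract UX_M unfolding rel_maximal_def by auto

lemma UX_rel_vanishes: "rel_vanishes U U" "rel_vanishes U X" "rel_vanishes X U" "rel_vanishes X X"
  using M_rel_maximal rel_vanishes_retract UX_M unfolding rel_maximal_def by auto

lemma rel_vanishes_M: "\<lbrakk>rel_vanishes U A; rel_vanishes X A\<rbrakk> \<Longrightarrow> rel_vanishes M A" "\<lbrakk>rel_vanishes A U; rel_vanishes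
  A X\<rbrakk> \<Longrightarrow> rel_vanishes A M"
  using rel_vanishes_dsum_left rel_vanishes_dsum_right rel_vanishes_retract_left rel_vanishes_retract_right
    UX_M(3)
    by blast+

lemma Add_M_class: "\<lbrakk>addclosed \<B> \<T>; U \<in> \<T>; X \<in> \<T>\<rbrakk> \<Longrightarrow> Add M \<subseteq> \<T>"
  using add_cl_least addclosed_dsum addclosed_retract UX_M(3) by meson

text \<open>A local summand of T is a summand of U or isomorphic to X, and the latter is
  excluded.\<close>

lemma Add_M_no_X: assumes T: "T \<in> Add M" and n: "\<not> retract \<B> X T" shows "T \<in> Add U"
proof -
  obtain k where "local_decomp \<B> k T" using local_decomp_exists by blast
  then show ?thesis
  proof (rule local_decomp_closed[OF _ add_addclosed])
    fix A assume A: "local_obj \<B> A" "retract \<B> A T"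
    then have "retract \<B> A M" using addclosed_retract[OF add_addclosed T] local_obj_retract_add_cl by blast
    then have "retract \<B> A U \<or> retract \<B> A X"
      using local_obj_retract_dsum[OF A(1)] retract_trans UX_M(3)
      by blast
    moreover have "\<not> retract \<B> A X"
      using local_obj_retract_isomorphic[OF X_local_obj local_obj_nonzero[OF A(1)]] retract_trans[OF
        retract_iso[OF isomorphic_sym] A(2)] n
        by blast
    ultimately show "A \<in> Add U" using addclosed_retract[OF add_addclosed add_self] by blast
  qed
qed

text \<open>Exactly one of X and Y lies in U * [R], which is closed under isomorphism, so they
  differ. Y is not projective because projectives lie in add U.\<close>

lemma new_summand_complement:
  assumes Y: "Y \<in> \<H>" "Y \<notin> Add U" "\<And>e. \<lbrakk>e \<in> arr Y Y; e \<cdot> e = e\<rbrakk> \<Longrightarrow> e = zmor Y Y \<or> e = idt \<B> Y"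
    and n: "X \<in> star \<B> R U \<longleftrightarrow> Y \<notin> star \<B> R U" and m: "max_R_rigid \<B> R (U \<boxplus> Y)"
  shows "another_complement \<B> R U X Y"
proof -
  have "idt \<B> Y \<noteq> zmor Y Y" using Y(2) addclosed_null[OF add_addclosed] by blast
  then have "indecomposable \<B> Y" by (rule indecomposableI[OF _ Y(3)])
  moreover have "\<not> isomorphic \<B> Y X"
    using n addclosed_retract[OF star_addclosed[OF P_U]] retract_iso isomorphic_sym by blast
  ultimately show ?thesis unfolding another_complement_def using Y(1,2) P_U m by blast
qed

lemma star_U_sub: assumes N: "U \<in> Add N" shows "star \<B> R U \<subseteq> star \<B> R N"
proof -
  have "\<P> \<subseteq> Add N" using P_U Add_mono[OF N] by blast
  then show ?thesis using star_mono[OF P_U] Add_star N by blast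
qed

lemma star_sub_U: assumes N: "retract \<B> N (U \<boxplus> Z)" "U \<in> Add N" and Z: "Z \<in> star \<B> R U" shows "star \<B> R N \<subseteq> star
  \<B> R U"
proof -
  have "U \<in> star \<B> R U" using Add_star[OF P_U] add_self by blast
  then have "N \<in> star \<B> R U"
    using addclosed_retract[OF star_addclosed[OF P_U]] addclosed_dsum[OF star_addclosed[OF P_U]] Z N(1)
    by blast
  moreover have "\<P> \<subseteq> Add N" using P_U Add_mono[OF N(2)] by blast
  ultimately show ?thesis using star_mono P_U by blast
qed

lemma UY_Add: "U \<in> Add (U \<boxplus> Y)" "Y \<in> Add (U \<boxplus> Y)"
  using addclosed_retract[OF add_addclosed add_self] retract_dsum1 retract_dsum2 by auto

text \<open>The class of N is contained in that of U, as its further summand lies there; the class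
  of L contains that of U and also \<open>Z'\<close>, which is outside. Both cases use this, with X
  and Y in exchanged roles.\<close>

lemma gt_R_iff_star:
  assumes N: "retract \<B> N (U \<boxplus> Z)" "U \<in> Add N" "Z \<in> Add N" "Z \<in> star \<B> R U"
    and L: "U \<in> Add L" "Z' \<in> Add L" "Z' \<notin> star \<B> R U"
  shows "gt_R \<B> R L N"
proof -
  have "star \<B> R N \<subseteq> star \<B> R U" by (rule star_sub_U[OF N(1,2,4)])
  moreover have "Z' \<in> star \<B> R L" using Add_star L(1,2) P_U Add_mono by blast
  ultimately show ?thesis using star_U_sub[OF L(1)] L(3) unfolding gt_R_def geq_R_def by blast
qed

theorem mutation_left:
  assumes X: "X \<in> star \<B> R U"
  shows "\<exists>Y y V f \<delta>. etri \<B> Y y V f X \<delta> \<and> right_min_approx \<B> (Add U) V X f \<and>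
    another_complement \<B> R U X Y \<and> gt_R \<B> R (U \<boxplus> Y) M"
proof -
  obtain V f where f: "right_approx \<B> (Add U) V X f" "\<forall>h\<in>arr V V. f \<cdot> h = f \<longrightarrow> h \<in> iso_mor \<B> V V"
    using right_approx_minimal
    by blast
  then have V: "V \<in> Add U" unfolding right_approx_def by blast
  obtain Y y \<delta> where y: "etri \<B> Y y V f X \<delta>" "\<delta> \<in> rel_ext X Y" "Y \<in> \<H>"
    using right_approx_deflation[OF P_U UX_calH X f(1)]
    by blast
  have UY: "rel_vanishes U Y"
    by (rule rel_vanishes_kernel[OF y(1) _ rel_vanishes_add_right[OF UX_rel_vanishes(1) V]]) (rule
      right_approxD[OF f(1) add_self])
  have YU: "rel_vanishes Y U"
    by (rule rel_vanishes_sub[OF y UX_calH(2) rel_vanishes_add_left[OF UX_rel_vanishes(1) V]])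
  have YY: "rel_vanishes Y Y" by (rule rel_vanishes_sub[OF y UX_calH(2) rel_vanishes_add_left[OF UY V]])
  \<comment> \<open>Otherwise the triangle splits and X is a summand of V in add U, against
    \<open>X_U\<close>.\<close>
  have split: "\<not> rel_vanishes X Y" using rel_ext_split[OF y(1,2) _ V] X_U by blast
  \<comment> \<open>If Y were in U * [R], it would be a relative quotient of an object of add U. X
    has no relative extensions by such an object, so by right exactness it would have none by Y,
    against \<open>split\<close>.\<close>
  have Ys: "Y \<notin> star \<B> R U"
  proof
    assume s: "Y \<in> star \<B> R U"
    obtain V' g where g: "right_approx \<B> (Add U) V' Y g" using right_approx_exists by blast
    then have V': "V' \<in> Add U" unfolding right_approx_def by blast
    obtain K k \<delta>' where "etri \<B> K k V' g Y \<delta>'" "\<delta>' \<in> rel_ext Y K"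
      using right_approx_deflation[OF P_U UX_calH(1) y(3) s g]
      by blast
    then show False
      using rel_vanishes_quotient[OF _ _ UX_calH(2) rel_vanishes_add_right[OF UX_rel_vanishes(3) V']] split
      by blast
  qed
  then have YU': "Y \<notin> Add U" using Add_star[OF P_U] by blast
  let ?N = "U \<boxplus> Y"
  have PN: "\<P> \<subseteq> Add ?N" using P_U Add_mono[OF UY_Add(1)] by blast
  have max: "max_R_rigid \<B> R ?N"
  proof (rule max_of_costar[OF PN calH_dsum[OF UX_calH(1) y(3)] rel_vanishes_dsum[OF UX_rel_vanishes(1) UY YU
    YY]])
    fix A assume A: "A \<in> \<H>" "rel_vanishes A ?N"
    have AU: "rel_vanishes A U" and AY: "rel_vanishes A Y"
      using rel_vanishes_retract_right[OF A(2)] retract_dsum1 retract_dsum2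
      by auto
    have "rel_vanishes A X" by (rule rel_vanishes_quotient[OF y(1,2) A(1) rel_vanishes_add_right[OF AU V]])
    then have AM: "rel_vanishes A M" by (rule rel_vanishes_M(2)[OF AU])
    obtain V' r where r: "right_approx \<B> (Add M) V' R r" using right_approx_exists by blast
    then have rt: "V' \<in> Add M" "r \<in> arr V' R" unfolding right_approx_def by auto
    obtain K k \<epsilon> where k: "etri \<B> K k V' r R \<epsilon>" "K \<in> Add M" using R_resolution[OF M_rel_maximal r] by blast
    obtain L g where g: "left_approx \<B> (Add ?N) A L g" using left_approx_exists by blast
    then have gt: "L \<in> Add ?N" "g \<in> arr A L" unfolding left_approx_def by auto
    \<comment> \<open>Maps from A to add M factor through add (U + Y): those to X lift along
      \<open>f\<close>, as A has no relative extensions by Y. Maps from A to R in turn lift to the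
      presentation of R by add M.\<close>
    have "Add M \<subseteq> {T. \<forall>s\<in>arr A T. \<exists>h\<in>arr L T. h \<cdot> g = s}"
    proof (rule Add_M_class[OF cofactor_class_addclosed[OF gt(2)]])
      show "U \<in> {T. \<forall>s\<in>arr A T. \<exists>h\<in>arr L T. h \<cdot> g = s}" using left_approxD[OF g UY_Add(1)] by blast
      show "X \<in> {T. \<forall>s\<in>arr A T. \<exists>h\<in>arr L T. h \<cdot> g = s}"
      proof (intro CollectI ballI)
        fix s assume s: "s \<in> arr A X"
        obtain b where b: "b \<in> arr A V" "f \<cdot> b = s"
          using tri_lift[OF y(1) s rel_vanishesD[OF AY rel_ext_pull[OF y(2) s]]]
          by blast
        obtain h where h: "h \<in> arr L V" "h \<cdot> g = b"
          using left_approxD[OF g _ b(1)] V Add_mono[OF UY_Add(1)]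
          by blast
        show "\<exists>h\<in>arr L X. h \<cdot> g = s"
          using cmp_closed[OF h(1) etri_arr(2)[OF y(1)]] assoc_right[OF gt(2) h(1) etri_arr(2)[OF y(1)]] h(2)
            b(2)
          by auto
      qed
    qed
    then have V': "\<forall>s\<in>arr A V'. \<exists>h\<in>arr L V'. h \<cdot> g = s" using rt(1) by blast
    show "\<forall>c\<in>arr A R. factors_through \<B> A R (Add ?N) c"
    proof
      fix c assume c: "c \<in> arr A R"
      have "pull \<B> c \<epsilon> = zext A K"
        by (rule rel_vanishesD[OF rel_vanishes_add_right[OF AM k(2)] rel_ext_calR[OF R_calR c etri_arr(3)[OF
          k(1)]]])
      then obtain b where b: "b \<in> arr A V'" "r \<cdot> b = c" using tri_lift[OF k(1) c] by blast
      obtain h where h: "h \<in> arr L V'" "h \<cdot> g = b" using V' b(1) by blast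
      have "c = r \<cdot> h \<cdot> g" using assoc_right[OF gt(2) h(1) rt(2)] h(2) b(2) by simp
      then show "factors_through \<B> A R (Add ?N) c"
        unfolding factors_through_def
        using gt cmp_closed[OF h(1) rt(2)]
        by blast
    qed
  qed
  have idem: "e = zmor Y Y \<or> e = idt \<B> Y" if "e \<in> arr Y Y" "e \<cdot> e = e" for e
  proof (rule kernel_idempotent[OF y(1) X_local_obj f(2) _ that])
    show "\<forall>s\<in>arr Y V. push \<B> s \<delta> = zext X V"
      using rel_vanishesD[OF rel_vanishes_add_right[OF UX_rel_vanishes(3) V] rel_ext_push[OF y(2)]]
      by blast
  qed
  have "another_complement \<B> R U X Y" using new_summand_complement[OF y(3) YU' idem _ max] X Ys by blast
  moreover have "gt_R \<B> R ?N M" by (rule gt_R_iff_star[OF UX_M(3) U_M X_M X UY_Add Ys])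
  moreover have "right_min_approx \<B> (Add U) V X f"
    using f
    unfolding right_approx_def right_min_approx_def
    by blast
  ultimately show ?thesis using y(1) by blast
qed

lemma factors_R:
  assumes X: "X \<notin> star \<B> R U"
  shows "\<forall>c\<in>arr X R. factors_through \<B> X R (Add U) c"
proof
  fix c assume c: "c \<in> arr X R"
  obtain W u P v \<rho> where w: "P \<in> \<P>" "etri \<B> W u P v R \<rho>" "W \<in> syzygies" using syzygy_exists by blast
  obtain V f where f: "left_approx \<B> (Add M) W V f" "\<forall>h\<in>arr V V. h \<cdot> f = f \<longrightarrow> h \<in> iso_mor \<B> V V"
    using left_approx_minimal
    by blast
  then have ft: "V \<in> Add M" "f \<in> arr W V" unfolding left_approx_def by auto
  obtain y C \<delta> where y: "etri \<B> W f V y C \<delta>" "\<delta> \<in> rel_ext C W" "C \<in> Add M"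
    using syzygy_coresolution[OF M_rel_maximal w(1,2) f(1)]
    by blast
  note ty = etri_arr[OF y(1)]
  \<comment> \<open>Otherwise \<open>f\<close> would already be a left approximation by add U, and
    X, being in add M, would lie in U * [R].\<close>
  have "retract \<B> X V"
  proof (rule ccontr)
    assume "\<not> retract \<B> X V"
    then have V: "V \<in> Add U" using Add_M_no_X ft(1) by blast
    then have "left_approx \<B> (Add U) W V f" using f(1) Add_mono[OF U_M] ft(2) unfolding left_approx_def by blast
    then have "X \<in> star \<B> R U" using star_iff_left_approx[OF w(1,2) P_U] left_approxD[OF f(1) X_M] by blast
    then show False using X by blast
  qed
  then obtain j q where j: "j \<in> arr X V" "q \<in> arr V X" "q \<cdot> j = idt \<B> X" unfolding retract_def by blast
  txt \<open>Every \<open>h : V \<rightarrow> C\<close> has the form \<open>y \<cdot> s' + k \<cdot> y\<close>, as \<open>h \<cdot> f\<close> lifts along \<open>y\<close> because \<open>W\<close> is a syzygy. With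
    \<open>y\<close> radical, no \<open>h\<close> can be an isomorphism on a common summand \<open>X\<close>.\<close>
  have "\<not> retract \<B> X C"
  proof
    assume "retract \<B> X C"
    then obtain i p where i: "i \<in> arr X C" "p \<in> arr C X" "p \<cdot> i = idt \<B> X" unfolding retract_def by blast
    have iq: "i \<cdot> q \<in> arr V C" by (rule cmp_closed[OF j(2) i(1)])
    have iqf: "i \<cdot> q \<cdot> f \<in> arr W C" by (rule cmp_closed[OF ft(2) iq])
    obtain s where s: "s \<in> arr W V" "y \<cdot> s = i \<cdot> q \<cdot> f"
      using tri_lift[OF y(1) iqf rel_ext_syzygies[OF y(2) w(3) iqf]]
      by blast
    obtain s' where s': "s' \<in> arr V V" "s' \<cdot> f = s" using left_approxD[OF f(1) ft(1) s(1)] by blast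
    have ys: "y \<cdot> s' \<in> arr V C" by (rule cmp_closed[OF s'(1) ty(2)])
    obtain n where n: "n \<in> arr V C" "n \<oplus>\<^bsub>Hom \<B> V C\<^esub> y \<cdot> s' = i \<cdot> q" using complement[OF ys iq] by blast
    have nf: "n \<cdot> f \<in> arr W C" by (rule cmp_closed[OF ft(2) n(1)])
    have "n \<cdot> f \<oplus>\<^bsub>Hom \<B> W C\<^esub> i \<cdot> q \<cdot> f = i \<cdot> q \<cdot> f"
      using cmp_add_left[OF ft(2) n(1) ys] n(2) assoc_right[OF ft(2) s'(1) ty(2)] s'(2) s(2) by simp
    then have "n \<cdot> f = zmor W C" using zero_unique[OF iqf _ nf] add_comm[OF nf iqf] by simp
    then obtain k where k: "k \<in> arr C C" "k \<cdot> y = n" using tri_coker[OF y(1) n(1)] by blast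
    have sj: "s' \<cdot> j \<in> arr X V" and pk: "p \<cdot> k \<in> arr C X" and nj: "n \<cdot> j \<in> arr X C" and yj: "y \<cdot> j \<in> arr X C"
      using cmp_closed s' j i k n ty by auto
    have "n \<cdot> j \<oplus>\<^bsub>Hom \<B> X C\<^esub> y \<cdot> (s' \<cdot> j) = i"
      using cmp_add_left[OF j(1) n(1) ys] n(2) assoc_right[OF j(1) s'(1) ty(2)] assoc_right[OF j(1,2) i(1)] j(3)
        cmp_idt_right[OF i(1)]
        by simp
    then have "idt \<B> X = p \<cdot> (n \<cdot> j) \<oplus>\<^bsub>Hom \<B> X X\<^esub> p \<cdot> (y \<cdot> (s' \<cdot> j))"
      using i(3) cmp_add_right[OF nj cmp_closed[OF sj ty(2)] i(2)] by simp
    moreover have "p \<cdot> (n \<cdot> j) = p \<cdot> k \<cdot> (y \<cdot> j)"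
      using k(2) assoc_right[OF j(1) ty(2) k(1)] assoc_right[OF yj k(1) i(2)]
      by simp
    ultimately have "idt \<B> X \<in> radical \<B> X X"
      using radical_add[OF minimal_cokernel_radical[OF y(1) f(2) X_local_obj j(1) pk]
        minimal_cokernel_radical[OF y(1) f(2) X_local_obj sj i(2)]]
        by simp
    then show False using local_obj_iso_not_radical[OF X_local_obj iso_mor_idt] by blast
  qed
  then have C: "C \<in> Add U" using Add_M_no_X y(3) by blast
  obtain D m h m' h' where D: "etri \<B> P m D h C (push \<B> u \<delta>)" "etri \<B> V m' D h' R (push \<B> f \<rho>)"
    using pushout_square[OF y(1) w(2)] by blast
  note tw = etri_arr[OF w(2)]
  obtain b where b: "b \<in> arr V P" "b \<cdot> f = u" using left_approxD[OF f(1) _ tw(1)] P_M w(1) by blast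
  \<comment> \<open>P lies in add M, so \<open>u\<close> extends along \<open>f\<close> and kills
    \<open>\<delta>\<close>. Thus the pushout D is P + C and lies in add U, although V has X as a
    summand.\<close>
  have "push \<B> u \<delta> = zext C P"
    using push_cmp[OF ft(2) b(1) ty(3)] b(2) tri_push_self[OF y(1)] push_zero[OF b(1)] by simp
  then have "isomorphic \<B> D (P \<boxplus> C)" using etri_zero_iso D(1) by metis
  then have DU: "D \<in> Add U"
    using addclosed_retract[OF add_addclosed addclosed_dsum[OF add_addclosed _ C] retract_iso] P_U w(1)
    by blast
  have "rel_vanishes X V" using rel_vanishes_add_right[OF rel_vanishes_M(2)[OF UX_rel_vanishes(3,4)] ft(1)] .
  then have "pull \<B> c (push \<B> f \<rho>) = zext X V"
    using rel_vanishesD rel_ext_calR[OF R_calR c etri_arr(3)[OF D(2)]]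
    by blast
  then obtain d where "d \<in> arr X D" "h' \<cdot> d = c" using tri_lift[OF D(2) c] by blast
  then show "factors_through \<B> X R (Add U) c"
    unfolding factors_through_def
    using DU etri_arr(2)[OF D(2)]
    by blast
qed

theorem mutation_right:
  assumes X: "X \<notin> star \<B> R U"
  shows "\<exists>g V z Y \<delta>. etri \<B> X g V z Y \<delta> \<and> left_min_approx \<B> (Add U) X V g \<and>
    another_complement \<B> R U X Y \<and> gt_R \<B> R M (U \<boxplus> Y)"
proof -
  obtain V g where g: "left_approx \<B> (Add U) X V g" "\<forall>h\<in>arr V V. h \<cdot> g = g \<longrightarrow> h \<in> iso_mor \<B> V V"
    using left_approx_minimal
    by blast
  then have V: "V \<in> Add U" unfolding left_approx_def by blast
  obtain z Y \<delta> where z: "etri \<B> X g V z Y \<delta>" "\<delta> \<in> rel_ext Y X" "Y \<in> \<H>"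
    using left_approx_inflation[OF P_U UX_calH g(1) factors_R[OF X]]
    by blast
  note tz = etri_arr[OF z(1)]
  have YU: "rel_vanishes Y U"
    by (rule rel_vanishes_cokernel[OF z(1) _ rel_vanishes_add_left[OF UX_rel_vanishes(1) V]]) (rule
      left_approxD[OF g(1) add_self])
  have UY: "rel_vanishes U Y"
    by (rule rel_vanishes_quotient[OF z(1,2) UX_calH(1) rel_vanishes_add_right[OF UX_rel_vanishes(1) V]])
  have YY: "rel_vanishes Y Y" by (rule rel_vanishes_quotient[OF z rel_vanishes_add_right[OF YU V]])
  \<comment> \<open>Were Y in add U, it would have no relative extensions by X, so the triangle
    would split and X would lie in add U.\<close>
  have YU': "Y \<notin> Add U"
    using rel_ext_split[OF z(1,2) _ V] rel_vanishes_add_left[OF UX_rel_vanishes(2)] X_U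
    by blast
  obtain W u P v \<rho> where w: "P \<in> \<P>" "etri \<B> W u P v R \<rho>" "W \<in> syzygies" using syzygy_exists by blast
  \<comment> \<open>Maps from the syzygy to Y lift along \<open>z\<close>, the class being relative,
    and so pass through V in add U.\<close>
  have Ys: "Y \<in> star \<B> R U"
  proof -
    obtain L f where f: "left_approx \<B> (Add U) W L f" using left_approx_exists by blast
    then have ft: "f \<in> arr W L" unfolding left_approx_def by blast
    show ?thesis unfolding star_iff_left_approx[OF w(1,2) P_U f]
    proof
      fix t assume t: "t \<in> arr W Y"
      obtain s where s: "s \<in> arr W V" "z \<cdot> s = t"
        using tri_lift[OF z(1) t rel_ext_syzygies[OF z(2) w(3) t]]
        by blast
      obtain h where h: "h \<in> arr L V" "h \<cdot> f = s" using left_approxD[OF f V s(1)] by blast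
      show "\<exists>h\<in>arr L Y. h \<cdot> f = t"
        using cmp_closed[OF h(1) tz(2)] assoc_right[OF ft h(1) tz(2)] h(2) s(2)
        by auto
    qed
  qed
  let ?N = "U \<boxplus> Y"
  have PN: "\<P> \<subseteq> Add ?N" using P_U Add_mono[OF UY_Add(1)] by blast
  have max: "max_R_rigid \<B> R ?N"
  proof (rule max_of_star[OF PN calH_dsum[OF UX_calH(1) z(3)] rel_vanishes_dsum[OF UX_rel_vanishes(1) UY YU
    YY]])
    fix A assume A: "A \<in> \<H>" "rel_vanishes ?N A"
    have UA: "rel_vanishes U A" and YA: "rel_vanishes Y A"
      using rel_vanishes_retract_left[OF A(2)] retract_dsum1 retract_dsum2
      by auto
    have "rel_vanishes X A" by (rule rel_vanishes_sub[OF z(1,2) UX_calH(2) z(3) rel_vanishes_add_left[OF UA V]])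
    then have MA: "rel_vanishes M A" by (rule rel_vanishes_M(1)[OF UA])
    obtain V0 f where f: "left_approx \<B> (Add M) W V0 f" using left_approx_exists by blast
    then have ft: "V0 \<in> Add M" "f \<in> arr W V0" unfolding left_approx_def by auto
    obtain y C \<epsilon> where y: "etri \<B> W f V0 y C \<epsilon>" "\<epsilon> \<in> rel_ext C W" "C \<in> Add M"
      using syzygy_coresolution[OF M_rel_maximal w(1,2) f]
      by blast
    obtain L \<psi> where r: "right_approx \<B> (Add U) L A \<psi>" using right_approx_exists by blast
    then have \<psi>: "L \<in> Add U" "\<psi> \<in> arr L A" unfolding right_approx_def by auto
    \<comment> \<open>Maps from X to A extend along \<open>g\<close>, as Y has no relative
      extensions by A; hence maps from add M to A factor through add U. Maps from the syzygy to A
      extend to \<open>V0\<close> in add M, so A even lies in U * [R].\<close>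
    have "Add M \<subseteq> {T. \<forall>s\<in>arr T A. \<exists>h\<in>arr T L. \<psi> \<cdot> h = s}"
    proof (rule Add_M_class[OF factor_class_addclosed[OF \<psi>(2)]])
      show "U \<in> {T. \<forall>s\<in>arr T A. \<exists>h\<in>arr T L. \<psi> \<cdot> h = s}" using right_approxD[OF r add_self] by blast
      show "X \<in> {T. \<forall>s\<in>arr T A. \<exists>h\<in>arr T L. \<psi> \<cdot> h = s}"
      proof (intro CollectI ballI)
        fix s assume s: "s \<in> arr X A"
        obtain b where b: "b \<in> arr V A" "b \<cdot> g = s"
          using tri_extend[OF z(1) s rel_vanishesD[OF YA rel_ext_push[OF z(2) s]]]
          by blast
        obtain h where h: "h \<in> arr V L" "\<psi> \<cdot> h = b" using right_approxD[OF r V b(1)] by blast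
        show "\<exists>h\<in>arr X L. \<psi> \<cdot> h = s"
          using cmp_closed[OF tz(1) h(1)] cmp_assoc[OF tz(1) h(1) \<psi>(2)] h(2) b(2)
          by auto
      qed
    qed
    then have V0: "\<forall>s\<in>arr V0 A. \<exists>h\<in>arr V0 L. \<psi> \<cdot> h = s" using ft(1) by blast
    obtain L' f' where f': "left_approx \<B> (Add U) W L' f'" using left_approx_exists by blast
    then have ft': "f' \<in> arr W L'" unfolding left_approx_def by blast
    have "A \<in> star \<B> R U" unfolding star_iff_left_approx[OF w(1,2) P_U f']
    proof
      fix t assume t: "t \<in> arr W A"
      obtain b where b: "b \<in> arr V0 A" "b \<cdot> f = t"
        using tri_extend[OF y(1) t rel_vanishesD[OF rel_vanishes_add_left[OF MA y(3)] rel_ext_push[OF y(2) t]]]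
          by blast
      obtain h where h: "h \<in> arr V0 L" "\<psi> \<cdot> h = b" using V0 b(1) by blast
      obtain k where k: "k \<in> arr L' L" "k \<cdot> f' = h \<cdot> f"
        using left_approxD[OF f' \<psi>(1) cmp_closed[OF ft(2) h(1)]]
        by blast
      have "\<psi> \<cdot> k \<cdot> f' = t"
        using assoc_right[OF ft' k(1) \<psi>(2)] k(2) cmp_assoc[OF ft(2) h(1) \<psi>(2)] h(2) b(2)
        by simp
      then show "\<exists>h\<in>arr L' A. h \<cdot> f' = t" using cmp_closed[OF k(1) \<psi>(2)] by blast
    qed
    then show "A \<in> star \<B> R ?N" using star_U_sub[OF UY_Add(1)] by blast
  qed
  have idem: "e = zmor Y Y \<or> e = idt \<B> Y" if "e \<in> arr Y Y" "e \<cdot> e = e" for e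
  proof (rule cokernel_idempotent[OF z(1) X_local_obj g(2) _ that])
    show "\<forall>s\<in>arr V Y. pull \<B> s \<delta> = zext V X"
      using rel_vanishesD[OF rel_vanishes_add_left[OF UX_rel_vanishes(2) V] rel_ext_pull[OF z(2)]]
      by blast
  qed
  have "another_complement \<B> R U X Y" using new_summand_complement[OF z(3) YU' idem _ max] X Ys by blast
  moreover have "gt_R \<B> R M ?N" by (rule gt_R_iff_star[OF retract_refl UY_Add Ys U_M X_M X])
  moreover have "left_min_approx \<B> (Add U) X V g" using g unfolding left_approx_def left_min_approx_def by blast
  ultimately show ?thesis using z(1) by blast
qed

end

theorem theorem5p5:
  fixes K :: "'k ring" and \<B> :: "('k, 'o, 'm, 'e) excat" and R M U X :: 'o
  assumes "extriangulated_category K \<B>"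
    and "hom_finite K \<B>"
    and "krull_schmidt \<B>"
    and "enough_projectives \<B>"
    and "enough_injectives \<B>"
    and "WIC \<B>"
    and "basic \<B> R"
    and "rigid \<B> R"
    and "\<And>Z. \<lbrakk>summand \<B> Z R; Z \<in> projectives \<B>\<rbrakk> \<Longrightarrow> zero_object \<B> Z"
    and "\<And>P. P \<in> projectives \<B> \<Longrightarrow> Ext_vanishes \<B> R P"
    and "isomorphic \<B> M (U \<boxplus>\<^bsub>\<B>\<^esub> X)"
    and "M \<in> calH \<B> R"
    and "basic \<B> M"
    and "max_R_rigid \<B> R M"
    and "indecomposable \<B> X"
    and "X \<notin> projectives \<B>"
    and "projectives \<B> \<subseteq> add_cl \<B> U"
  shows "(X \<in> star \<B> R U \<longrightarrow>
      (\<exists>Y y U\<^sub>1 f \<delta>. etri \<B> Y y U\<^sub>1 f X \<delta> \<and> right_min_approx \<B> (add_cl \<B> U) U\<^sub>1 X f \<and>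
        another_complement \<B> R U X Y \<and> gt_R \<B> R (U \<boxplus>\<^bsub>\<B>\<^esub> Y) M)) \<and>
    (X \<notin> star \<B> R U \<longrightarrow>
      (\<exists>g U\<^sub>2 z Y \<delta>. etri \<B> X g U\<^sub>2 z Y \<delta> \<and> left_min_approx \<B> (add_cl \<B> U) X U\<^sub>2 g \<and>
        another_complement \<B> R U X Y \<and> gt_R \<B> R M (U \<boxplus>\<^bsub>\<B>\<^esub> Y)))"
proof -
  interpret extriangulated_category K \<B> by (rule assms(1))
  interpret mutation_setting K \<B> R M U X
    by unfold_locales (use assms in auto)
  show ?thesis using mutation_left mutation_right by blast
qed

end
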